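(* Let $K/K_0$ be a PAC extension. Let $G$ be a finite group that occurs as a Galois group over $K$ (i.e. $G\cong\mathrm{Gal}(L/K)$ for some finite Galois extension $L/K$) and that is regular over $K_0$. Then $G$ occurs as a Galois group over $K_0$.
   Context: A field extension $K/K_0$ (not necessarily algebraic) is called a PAC extension if for every absolutely irreducible variety $V$ of dimension $r\geq 1$ defined over $K$ and every separable dominating rational map $\nu\colon V\to\mathbb{A}^r$ defined over $K$ there exists $a\in V(K)$ for which $\nu(a)\in K_0^r$. A finite group $G$ is regular over $K_0$ if there exists a Galois extension $F_0/K_0(t)$ ($t$ transcendental over $K_0$) with Galois group isomorphic to $G$ and such that $F_0$ is a regular extension of $K_0$. *)

theory Defs
  imports
    "HOL-Algebra.Algebraic_Closure_Type"
    "HOL-Algebra.Generated_Fields"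
    "HOL-Algebra.Bij"
    "HOL-Library.Poly_Mapping"
begin

text \<open>
  The conventions are those of Weil and of Fried--Jarden, \<^emph>\<open>Field Arithmetic\<close>: all fields are
  subfields of one universal domain, an algebraically closed field that has infinite transcendence
  degree over the base field.  A finite extension of a subfield, the function field of a variety,
  and an extension such as \<open>F\<^sub>0 / K\<^sub>0(t)\<close> all have isomorphic copies inside it, so a quantifier over
  such fields is a quantifier over subsets of the universal domain.

  The definitions below are for an arbitrary type \<open>'a\<close> in the role of the universal domain.  The
  type \<open>'k universal_domain\<close> at the end of the theory plays this role for an arbitrary field \<open>'k\<close>.
\<close>

abbreviation Dom :: "'a::alg_closed_field ring" where
  "Dom \<equiv> ring_of_type_algebra"

abbreviation field_adjoin :: "'a::alg_closed_field set \<Rightarrow> 'a set \<Rightarrow> 'a set" where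
  "field_adjoin K S \<equiv> generate_field Dom (K \<union> S)"


subsection \<open>Galois extensions\<close>

definition field_extension :: "'a::alg_closed_field set \<Rightarrow> 'a set \<Rightarrow> bool" where
  "field_extension K L \<longleftrightarrow> subfield K Dom \<and> subfield L Dom \<and> K \<subseteq> L"

text \<open>\<^term>\<open>ring.Irr Dom K x\<close> is the minimal polynomial of \<open>x\<close> over \<open>K\<close>, and its roots and
  multiplicities are taken in the universal domain.\<close>

definition separable_over :: "'a::alg_closed_field set \<Rightarrow> 'a \<Rightarrow> bool" where
  "separable_over K x \<longleftrightarrow>
     ring.algebraic Dom K x \<and> (\<forall>y. ring.alg_mult Dom (ring.Irr Dom K x) y \<le> 1)"

definition separable_algebraic_extension :: "'a::alg_closed_field set \<Rightarrow> 'a set \<Rightarrow> bool" where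
  "separable_algebraic_extension K L \<longleftrightarrow> field_extension K L \<and> (\<forall>x\<in>L. separable_over K x)"

definition normal_extension :: "'a::alg_closed_field set \<Rightarrow> 'a set \<Rightarrow> bool" where
  "normal_extension K L \<longleftrightarrow> field_extension K L \<and>
     (\<forall>x\<in>L. ring.algebraic Dom K x \<and> (\<forall>y. ring.is_root Dom (ring.Irr Dom K x) y \<longrightarrow> y \<in> L))"

definition finite_galois_extension :: "'a::alg_closed_field set \<Rightarrow> 'a set \<Rightarrow> bool" where
  "finite_galois_extension K L \<longleftrightarrow>
     ring.finite_dimension Dom K L \<and> separable_algebraic_extension K L \<and> normal_extension K L"

definition galois_group :: "'a::alg_closed_field set \<Rightarrow> 'a set \<Rightarrow> ('a \<Rightarrow> 'a) monoid" where
  "galois_group K L = (BijGroup L)\<lparr>carrier :=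
     {\<sigma> \<in> Bij L. \<sigma> \<in> ring_hom (Dom\<lparr>carrier := L\<rparr>) (Dom\<lparr>carrier := L\<rparr>) \<and> (\<forall>x\<in>K. \<sigma> x = x)}\<rparr>"

definition occurs_as_galois_group ::
    "('g, 'm) monoid_scheme \<Rightarrow> 'a::alg_closed_field set \<Rightarrow> bool" where
  "occurs_as_galois_group G K \<longleftrightarrow>
     (\<exists>L. finite_galois_extension K L \<and> G \<cong> galois_group K L)"


subsection \<open>Regular extensions and groups regular over a field\<close>

definition linearly_disjoint ::
    "'a::alg_closed_field set \<Rightarrow> 'a set \<Rightarrow> 'a set \<Rightarrow> bool" where
  "linearly_disjoint K E F \<longleftrightarrow>
     (\<forall>us. set us \<subseteq> E \<and> ring.independent Dom K us \<longrightarrow> ring.independent Dom F us)"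

text \<open>\<open>F/K\<close> is regular if \<open>F\<close> is linearly disjoint over \<open>K\<close> from the algebraic closure of \<open>K\<close>.\<close>

definition regular_extension :: "'a::alg_closed_field set \<Rightarrow> 'a set \<Rightarrow> bool" where
  "regular_extension K F \<longleftrightarrow>
     field_extension K F \<and> linearly_disjoint K F {x. ring.algebraic Dom K x}"

definition regular_group_over ::
    "('g, 'm) monoid_scheme \<Rightarrow> 'a::alg_closed_field set \<Rightarrow> bool" where
  "regular_group_over G K \<longleftrightarrow>
     (\<exists>t F. ring.transcendental Dom K t \<and>
            finite_galois_extension (field_adjoin K {t}) F \<and>
            G \<cong> galois_group (field_adjoin K {t}) F \<and>
            regular_extension K F)"


subsection \<open>Affine varieties\<close>

type_synonym 'a mpol = "(nat \<Rightarrow>\<^sub>0 nat) \<Rightarrow>\<^sub>0 'a"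

text \<open>\<open>K[X\<^sub>0, \<dots>, X\<^bsub>n-1\<^esub>]\<close>\<close>

definition mpols :: "'a::zero set \<Rightarrow> nat \<Rightarrow> 'a mpol set" where
  "mpols K n = {p. \<forall>m\<in>Poly_Mapping.keys p.
      Poly_Mapping.lookup p m \<in> K \<and> Poly_Mapping.keys m \<subseteq> {..<n}}"

definition mpol_eval :: "'a::comm_ring_1 mpol \<Rightarrow> (nat \<Rightarrow> 'a) \<Rightarrow> 'a" where
  "mpol_eval p x = (\<Sum>m\<in>Poly_Mapping.keys p.
      Poly_Mapping.lookup p m * (\<Prod>i\<in>Poly_Mapping.keys m. x i ^ Poly_Mapping.lookup m i))"

definition affine_space :: "nat \<Rightarrow> 'a set \<Rightarrow> (nat \<Rightarrow> 'a) set" where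
  "affine_space n K = {..<n} \<rightarrow>\<^sub>E K"

definition zero_set :: "nat \<Rightarrow> 'a::alg_closed_field mpol set \<Rightarrow> (nat \<Rightarrow> 'a) set" where
  "zero_set n S = {x \<in> affine_space n UNIV. \<forall>p\<in>S. mpol_eval p x = 0}"

definition vanishing_ideal ::
    "'a::alg_closed_field set \<Rightarrow> nat \<Rightarrow> (nat \<Rightarrow> 'a) set \<Rightarrow> 'a mpol set" where
  "vanishing_ideal K n V = {p \<in> mpols K n. \<forall>x\<in>V. mpol_eval p x = 0}"

definition zariski_closed :: "nat \<Rightarrow> (nat \<Rightarrow> 'a::alg_closed_field) set \<Rightarrow> bool" where
  "zariski_closed n V \<longleftrightarrow> (\<exists>S \<subseteq> mpols UNIV n. V = zero_set n S)"

definition zariski_closure ::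
    "nat \<Rightarrow> (nat \<Rightarrow> 'a::alg_closed_field) set \<Rightarrow> (nat \<Rightarrow> 'a) set" where
  "zariski_closure n A = \<Inter> {V. zariski_closed n V \<and> A \<subseteq> V}"

text \<open>Irreducibility refers to all Zariski closed sets over the algebraically closed universal
  domain, so it is absolute irreducibility.\<close>

definition absolutely_irreducible :: "nat \<Rightarrow> (nat \<Rightarrow> 'a::alg_closed_field) set \<Rightarrow> bool" where
  "absolutely_irreducible n V \<longleftrightarrow> zariski_closed n V \<and> V \<noteq> {} \<and>
     (\<forall>V1 V2. zariski_closed n V1 \<and> zariski_closed n V2 \<and> V = V1 \<union> V2 \<longrightarrow> V = V1 \<or> V = V2)"

text \<open>\<open>V\<close> is defined over \<open>K\<close> if its full vanishing ideal is generated by polynomials with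
  coefficients in \<open>K\<close>.  Being the zero set of such polynomials would not be enough when \<open>K\<close> is
  imperfect.\<close>

definition defined_over ::
    "'a::alg_closed_field set \<Rightarrow> nat \<Rightarrow> (nat \<Rightarrow> 'a) set \<Rightarrow> bool" where
  "defined_over K n V \<longleftrightarrow>
     (\<forall>p \<in> vanishing_ideal UNIV n V. \<exists>Q h. finite Q \<and> Q \<subseteq> vanishing_ideal K n V \<and>
        (\<forall>q\<in>Q. h q \<in> mpols UNIV n) \<and> p = (\<Sum>q\<in>Q. h q * q))"


subsection \<open>Function fields and rational maps\<close>

text \<open>The function field of \<open>V\<close> over \<open>K\<close> is \<open>K(x)\<close> for a generic point \<open>x\<close> of \<open>V\<close> over \<open>K\<close>; any two
  generic points give \<open>K\<close>-isomorphic fields.\<close>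

definition generic_point ::
    "'a::alg_closed_field set \<Rightarrow> nat \<Rightarrow> (nat \<Rightarrow> 'a) set \<Rightarrow> (nat \<Rightarrow> 'a) \<Rightarrow> bool" where
  "generic_point K n V x \<longleftrightarrow> x \<in> V \<and>
     (\<forall>p \<in> mpols K n. mpol_eval p x = 0 \<longrightarrow> p \<in> vanishing_ideal K n V)"

abbreviation field_adjoin_tuple ::
    "'a::alg_closed_field set \<Rightarrow> nat \<Rightarrow> (nat \<Rightarrow> 'a) \<Rightarrow> 'a set" where
  "field_adjoin_tuple K n x \<equiv> field_adjoin K (x ` {..<n})"

definition algebraically_independent ::
    "'a::alg_closed_field set \<Rightarrow> nat \<Rightarrow> (nat \<Rightarrow> 'a) \<Rightarrow> bool" where
  "algebraically_independent K r y \<longleftrightarrow> (\<forall>p \<in> mpols K r. mpol_eval p y = 0 \<longrightarrow> p = 0)"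

definition has_transcendence_degree ::
    "'a::alg_closed_field set \<Rightarrow> 'a set \<Rightarrow> nat \<Rightarrow> bool" where
  "has_transcendence_degree K F r \<longleftrightarrow>
     (\<exists>y \<in> {..<r} \<rightarrow> F. algebraically_independent K r y \<and>
        (\<forall>z\<in>F. ring.algebraic Dom (field_adjoin_tuple K r y) z))"

text \<open>With \<open>x\<close> a generic point of \<open>V\<close> over \<open>K\<close>, a rational function on \<open>V\<close> over \<open>K\<close> is an element \<open>f\<close>
  of \<open>K(x)\<close>.  It is defined at \<open>a \<in> V\<close>, with value \<open>b\<close>, if it has some representation
  \<open>f = p(x)/q(x)\<close> with \<open>q(a) \<noteq> 0\<close> and \<open>b = p(a)/q(a)\<close>.  The value does not depend on the
  representation, because every polynomial over \<open>K\<close> that vanishes at \<open>x\<close> vanishes on \<open>V\<close>.\<close>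

definition rational_function_value ::
    "'a::alg_closed_field set \<Rightarrow> nat \<Rightarrow> (nat \<Rightarrow> 'a) \<Rightarrow> 'a \<Rightarrow> (nat \<Rightarrow> 'a) \<Rightarrow> 'a \<Rightarrow> bool" where
  "rational_function_value K n x f a b \<longleftrightarrow>
     (\<exists>p \<in> mpols K n. \<exists>q \<in> mpols K n.
        mpol_eval q x \<noteq> 0 \<and> f = mpol_eval p x / mpol_eval q x \<and>
        mpol_eval q a \<noteq> 0 \<and> b = mpol_eval p a / mpol_eval q a)"

text \<open>A rational map \<open>\<nu>\<close> from \<open>V\<close> to affine \<open>r\<close>-space over \<open>K\<close> is an \<open>r\<close>-tuple over \<open>K(x)\<close>.\<close>

definition rational_map_value ::
    "'a::alg_closed_field set \<Rightarrow> nat \<Rightarrow> (nat \<Rightarrow> 'a) \<Rightarrow> nat \<Rightarrow> (nat \<Rightarrow> 'a) \<Rightarrow>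
     (nat \<Rightarrow> 'a) \<Rightarrow> (nat \<Rightarrow> 'a) \<Rightarrow> bool" where
  "rational_map_value K n x r \<nu> a b \<longleftrightarrow> b \<in> affine_space r UNIV \<and>
     (\<forall>i<r. rational_function_value K n x (\<nu> i) a (b i))"

definition dominating_map ::
    "'a::alg_closed_field set \<Rightarrow> nat \<Rightarrow> (nat \<Rightarrow> 'a) set \<Rightarrow> (nat \<Rightarrow> 'a) \<Rightarrow> nat \<Rightarrow>
     (nat \<Rightarrow> 'a) \<Rightarrow> bool" where
  "dominating_map K n V x r \<nu> \<longleftrightarrow>
     zariski_closure r {b. \<exists>a\<in>V. rational_map_value K n x r \<nu> a b} = affine_space r UNIV"

text \<open>\<open>\<nu>\<close> is separable if \<open>K(V)\<close> is a separable extension of the function field \<open>K(\<nu>)\<close> of affine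
  \<open>r\<close>-space.  For a dominating \<open>\<nu>\<close> on a variety of dimension \<open>r\<close> this extension is algebraic.\<close>

definition separable_map ::
    "'a::alg_closed_field set \<Rightarrow> nat \<Rightarrow> (nat \<Rightarrow> 'a) \<Rightarrow> nat \<Rightarrow> (nat \<Rightarrow> 'a) \<Rightarrow> bool" where
  "separable_map K n x r \<nu> \<longleftrightarrow>
     separable_algebraic_extension (field_adjoin_tuple K r \<nu>) (field_adjoin_tuple K n x)"


subsection \<open>PAC extensions\<close>

definition PAC_extension :: "'a::alg_closed_field set \<Rightarrow> 'a set \<Rightarrow> bool" where
  "PAC_extension K0 K \<longleftrightarrow> field_extension K0 K \<and>
     (\<forall>n V x r \<nu>.
        absolutely_irreducible n V \<and> defined_over K n V \<and>
        generic_point K n V x \<and>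
        has_transcendence_degree K (field_adjoin_tuple K n x) r \<and> r \<ge> 1 \<and>
        \<nu> \<in> affine_space r (field_adjoin_tuple K n x) \<and>
        dominating_map K n V x r \<nu> \<and> separable_map K n x r \<nu> \<longrightarrow>
        (\<exists>a \<in> V \<inter> affine_space n K. \<exists>b \<in> affine_space r K0.
            rational_map_value K n x r \<nu> a b))"


subsection \<open>A universal domain over an arbitrary field\<close>

text \<open>The algebraic closure of the field of rational functions over \<open>'k\<close> in countably many
  variables.\<close>

type_synonym 'k universal_domain = "'k mpol fract alg_closure"

definition to_universal_domain :: "'k::field \<Rightarrow> 'k universal_domain" where
  "to_universal_domain c = to_ac (Fract (Poly_Mapping.single 0 c) 1)"

lemma to_universal_domain_hom:
  "to_universal_domain 0 = (0 :: 'k::field universal_domain)"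
  "to_universal_domain 1 = (1 :: 'k universal_domain)"
  "to_universal_domain (a + b) = (to_universal_domain a + to_universal_domain b :: 'k universal_domain)"
  "to_universal_domain (a * b) = (to_universal_domain a * to_universal_domain b :: 'k universal_domain)"
  by (simp_all add: to_universal_domain_def single_add mult_single Zero_fract_def One_fract_def
      single_zero single_one flip: to_ac_add to_ac_mult to_ac_0 to_ac_1)

lemma inj_to_universal_domain: "inj (to_universal_domain :: 'k::field \<Rightarrow> 'k universal_domain)"
  by (auto simp: inj_on_def to_universal_domain_def eq_fract dest!: arg_cong[where f = "\<lambda>p. Poly_Mapping.lookup p 0"])

end

theory Submission
  imports Defs
begin

text \<open>
  The proof is a field crossing argument.  Move the regular Galois extension of \<open>K\<^sub>0(t\<^sub>0)\<close> to one
  with parameter \<open>t\<close> transcendental over \<open>K\<close>, and let \<open>Z g\<close> be the conjugates of a primitive element,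
  the roots of \<open>f(t, -)\<close>.  Regularity makes \<open>f\<close> irreducible over the universal domain, so
  \<open>G \<times> G\<close> acts on \<open>L(t, Z 1)\<close> with fixed field \<open>K(t)\<close>.  The fixed field \<open>D\<close> of the diagonal is
  regular over \<open>K\<close>, hence the function field of an absolutely irreducible plane curve over \<open>K\<close>, and
  the PAC property provides a \<open>K\<close>-point of this curve at which \<open>t\<close> takes a value \<open>a\<close> in \<open>K\<^sub>0\<close>.

  Let \<open>w g\<close> be the conjugates of a primitive element of \<open>L/K\<close>.  The sums \<open>\<Sum>g. (w g)\<^sup>i Z g\<close> lie
  in \<open>D\<close>, so they specialize into \<open>K\<close>.  By the Vandermonde determinant the specialized \<open>Z g\<close> lie in
  \<open>L\<close> and are permuted by \<open>Gal(L/K)\<close> as \<open>G\<close> permutes itself by translations.  They are also the roots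
  of \<open>f(a, -)\<close>, which has coefficients in \<open>K\<^sub>0\<close>, and each of them generates the others over \<open>K\<^sub>0\<close>;
  hence they generate a Galois extension of \<open>K\<^sub>0\<close> with group \<open>G\<close>.
\<close>


subsection \<open>Subrings and partially defined homomorphisms\<close>

text \<open>The PAC property yields one point and no control over it, while the specialization must
  avoid the zeros of finitely many polynomials: denominators, the discriminant of the
  \<open>Z g\<close>, and \<open>\<delta>\<close>. Their product \<open>d\<close> is therefore built
  into the curve: the primitive element of the diagonal field is scaled by the square of
  \<open>d(t)\<close>, and the curve is drawn in the reciprocal coordinate, which leaves no point
  over a zero of \<open>d\<close>. The same device, with \<open>d\<close> vanishing exactly on a
  supposedly finite \<open>K0\<close>, shows that \<open>K0\<close> is infinite, as the choice of
  primitive elements requires. The diagonal field is regular because the maps moving only the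
  \<open>Z g\<close> can be chosen to fix the whole algebraic closure of \<open>K\<close>, and they
  still give its primitive element \<open>n\<close> distinct conjugates. Irreducibility is mostly
  handled as the absence of nonzero relations of degree less than \<open>n\<close>. This form also
  drives the specialization: a homomorphism on a local ring extends to a generator with a monic
  relation of least degree, so \<open>t\<close> and then the primitive element receive their values
  one after the other.\<close>

definition sring :: "'a::comm_ring_1 set \<Rightarrow> bool" where
  "sring R \<longleftrightarrow> 1 \<in> R \<and> (\<forall>x\<in>R. \<forall>y\<in>R. x - y \<in> R \<and> x * y \<in> R)"

lemma sringD:
  assumes "sring R"
  shows "0 \<in> R" "1 \<in> R" "x \<in> R \<Longrightarrow> - x \<in> R" "x \<in> R \<Longrightarrow> y \<in> R \<Longrightarrow> x + y \<in> R"
    "x \<in> R \<Longrightarrow> y \<in> R \<Longrightarrow> x - y \<in> R" "x \<in> R \<Longrightarrow> y \<in> R \<Longrightarrow> x * y \<in> R"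
proof -
  show 1: "1 \<in> R" and d: "\<And>x y. x \<in> R \<Longrightarrow> y \<in> R \<Longrightarrow> x - y \<in> R"
    and "\<And>x y. x \<in> R \<Longrightarrow> y \<in> R \<Longrightarrow> x * y \<in> R"
    using assms unfolding sring_def by auto
  show 0: "0 \<in> R" using d[OF 1 1] by simp
  show m: "\<And>x. x \<in> R \<Longrightarrow> - x \<in> R" using d[OF 0] by simp
  show "\<And>x y. x \<in> R \<Longrightarrow> y \<in> R \<Longrightarrow> x + y \<in> R" using d m by fastforce
qed

lemma sring_sum: "sring R \<Longrightarrow> (\<And>i. i \<in> I \<Longrightarrow> f i \<in> R) \<Longrightarrow> sum f I \<in> R"
  by (induction I rule: infinite_finite_induct) (auto simp: sringD)

lemma sring_prod: "sring R \<Longrightarrow> (\<And>i. i \<in> I \<Longrightarrow> f i \<in> R) \<Longrightarrow> prod f I \<in> R"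
  by (induction I rule: infinite_finite_induct) (auto simp: sringD)

lemma sring_power: "sring R \<Longrightarrow> x \<in> R \<Longrightarrow> x ^ n \<in> R"
  by (induction n) (auto simp: sringD)

lemma sring_UNIV: "sring UNIV" by (simp add: sring_def)

text \<open>Since \<open>inverse 0 = 0\<close>, the closure condition can range over all of
  \<open>K\<close>.\<close>

definition sfield :: "'a::field set \<Rightarrow> bool" where
  "sfield K \<longleftrightarrow> sring K \<and> (\<forall>x\<in>K. inverse x \<in> K)"

lemma sfieldD:
  assumes "sfield K"
  shows "sring K" "x \<in> K \<Longrightarrow> inverse x \<in> K" "x \<in> K \<Longrightarrow> y \<in> K \<Longrightarrow> x / y \<in> K"
  using assms sringD(6)[of K] unfolding sfield_def by (auto simp: divide_inverse)

section \<open>Polynomials with coefficients in a subring\<close>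

definition polys :: "'a::comm_ring_1 set \<Rightarrow> 'a poly set" where
  "polys R = {p. \<forall>i. coeff p i \<in> R}"

lemma polysI: "(\<And>i. coeff p i \<in> R) \<Longrightarrow> p \<in> polys R" by (simp add: polys_def)
lemma polysD: "p \<in> polys R \<Longrightarrow> coeff p i \<in> R" by (simp add: polys_def)
lemma polys_mono: "R \<subseteq> S \<Longrightarrow> polys R \<subseteq> polys S" by (auto simp: polys_def)
lemma polys_UNIV [simp]: "polys UNIV = UNIV" by (auto simp: polys_def)

lemma sring_polys:
  assumes "sring R" shows "sring (polys R)"
  unfolding sring_def
proof (intro conjI ballI polysI)
  note S = sringD[OF assms]
  show "coeff 1 i \<in> R" for i using S by (simp add: coeff_1)
  fix p q i assume pq: "p \<in> polys R" "q \<in> polys R"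
  show "coeff (p - q) i \<in> R" using pq by (simp add: S polysD)
  show "coeff (p * q) i \<in> R" unfolding coeff_mult
    by (intro sring_sum[OF assms] S(6) polysD pq)
qed

lemma all_nat_split: "(\<forall>i::nat. P i) \<longleftrightarrow> P 0 \<and> (\<forall>i. P (Suc i))"
  by (metis not0_implies_Suc)

lemma polys_pCons: "sring R \<Longrightarrow> pCons a p \<in> polys R \<longleftrightarrow> a \<in> R \<and> p \<in> polys R"
  unfolding polys_def mem_Collect_eq by (subst all_nat_split) simp

lemma polys_const: "sring R \<Longrightarrow> [:a:] \<in> polys R \<longleftrightarrow> a \<in> R"
  by (simp add: polys_pCons sringD sring_polys)

lemma polys_smult: "sring R \<Longrightarrow> a \<in> R \<Longrightarrow> p \<in> polys R \<Longrightarrow> smult a p \<in> polys R"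
  by (intro polysI) (simp add: sringD polysD)

lemma polys_monom: "sring R \<Longrightarrow> a \<in> R \<Longrightarrow> monom a n \<in> polys R"
  by (intro polysI) (simp add: sringD)

lemma poly_in: "sring R \<Longrightarrow> p \<in> polys R \<Longrightarrow> x \<in> R \<Longrightarrow> poly p x \<in> R"
  by (induction p) (auto simp: polys_pCons sringD)

text \<open>Multiplying \<open>P\<close> by the leading coefficient of \<open>f\<close> replaces
  division by it, so the algorithm runs in any subring. The rings of interest are the
  \<open>polys C\<close>, where leading coefficients are polynomials in the first variable.\<close>

lemma pseudo_division:
  fixes f :: "'a::idom poly"
  assumes R: "sring R" and f: "f \<in> polys R" "f \<noteq> 0" and P: "P \<in> polys R"
  shows "\<exists>k. \<exists>q\<in>polys R. \<exists>r\<in>polys R. smult (lead_coeff f ^ k) P = f * q + r \<and> (r = 0 \<or> degree r < degree f)"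
  using P
proof (induction "degree P" arbitrary: P rule: less_induct)
  case less
  note PR = sringD[OF sring_polys[OF R]]
  show ?case
  proof (cases "P = 0 \<or> degree P < degree f")
    case True
    have "smult (lead_coeff f ^ 0) P = f * 0 + P" by simp
    then show ?thesis using PR(1) less.prems True by blast
  next
    case False
    define c where "c = lead_coeff f"
    define m where "m = monom (lead_coeff P) (degree P - degree f)"
    define P' where "P' = smult c P - f * m"
    have c: "c \<in> R" unfolding c_def by (rule polysD[OF f(1)])
    have m: "m \<in> polys R" unfolding m_def by (rule polys_monom[OF R polysD[OF less.prems]])
    have P': "P' \<in> polys R" unfolding P'_def by (intro PR(5,6) f m polys_smult[OF R c less.prems])
    have m0: "m \<noteq> 0" using False by (simp add: m_def)
    have c0: "c \<noteq> 0" using f by (simp add: c_def)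
    have dm: "degree (f * m) = degree P"
      using False f m0 by (simp add: degree_mult_eq) (simp add: m_def degree_monom_eq)
    have lm: "coeff (f * m) (degree P) = c * lead_coeff P"
      using lead_coeff_mult[of f m] dm False by (simp add: c_def) (simp add: m_def degree_monom_eq)
    have "degree P' \<le> degree P" unfolding P'_def using dm by (intro degree_diff_le) auto
    moreover have "coeff P' (degree P) = 0" by (simp add: P'_def lm)
    ultimately consider "degree P' < degree P" | "P' = 0"
      by (metis le_neq_implies_less leading_coeff_0_iff)
    then have "\<exists>k. \<exists>q\<in>polys R. \<exists>r\<in>polys R. smult (c ^ k) P' = f * q + r \<and> (r = 0 \<or> degree r < degree f)"
    proof cases
      case 1 then show ?thesis using less.hyps[OF _ P'] by (simp add: c_def)
    next
      case 2
      then have "smult (c ^ 0) P' = f * 0 + 0" by simp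
      then show ?thesis using PR(1) by blast
    qed
    then obtain k q r where *: "q \<in> polys R" "r \<in> polys R" "smult (c ^ k) P' = f * q + r" "r = 0 \<or> degree r < degree f"
      by blast
    have "smult (c ^ Suc k) P = f * (q + smult (c^k) m) + r"
      using *(3) by (simp add: P'_def algebra_simps smult_diff_right)
    moreover have "q + smult (c^k) m \<in> polys R"
      using * PR(4) polys_smult[OF R sring_power[OF R c] m] by blast
    ultimately show ?thesis using * unfolding c_def by blast
  qed
qed

lemma monic_division:
  fixes f :: "'a::idom poly"
  assumes "sring R" "f \<in> polys R" "lead_coeff f = 1" "P \<in> polys R"
  obtains q r where "q \<in> polys R" "r \<in> polys R" "P = f * q + r" "r = 0 \<or> degree r < degree f"
proof -
  have "f \<noteq> 0" using assms(3) by auto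
  with pseudo_division[OF assms(1,2) _ assms(4)] assms(3) that show ?thesis by (auto; metis)
qed

text \<open>Nothing is required of \<open>\<tau>\<close> outside \<open>R\<close>, so one total
  function serves as a homomorphism on every smaller subring, and an extension only has to agree on
  \<open>R\<close>.\<close>

definition rhom :: "'a::comm_ring_1 set \<Rightarrow> ('a \<Rightarrow> 'b::comm_ring_1) \<Rightarrow> bool" where
  "rhom R \<tau> \<longleftrightarrow> sring R \<and> \<tau> 1 = 1 \<and>
     (\<forall>x\<in>R. \<forall>y\<in>R. \<tau> (x - y) = \<tau> x - \<tau> y \<and> \<tau> (x * y) = \<tau> x * \<tau> y)"

lemma rhomD:
  assumes "rhom R \<tau>"
  shows "sring R" "\<tau> 1 = 1" "\<tau> 0 = 0" "x \<in> R \<Longrightarrow> \<tau> (- x) = - \<tau> x"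
    "x \<in> R \<Longrightarrow> y \<in> R \<Longrightarrow> \<tau> (x + y) = \<tau> x + \<tau> y"
    "x \<in> R \<Longrightarrow> y \<in> R \<Longrightarrow> \<tau> (x - y) = \<tau> x - \<tau> y"
    "x \<in> R \<Longrightarrow> y \<in> R \<Longrightarrow> \<tau> (x * y) = \<tau> x * \<tau> y"
proof -
  show R: "sring R" and "\<tau> 1 = 1" and d: "\<And>x y. x \<in> R \<Longrightarrow> y \<in> R \<Longrightarrow> \<tau> (x - y) = \<tau> x - \<tau> y"
    and "\<And>x y. x \<in> R \<Longrightarrow> y \<in> R \<Longrightarrow> \<tau> (x * y) = \<tau> x * \<tau> y"
    using assms unfolding rhom_def by auto
  note S = sringD[OF R]
  show 0: "\<tau> 0 = 0" using d[OF S(2) S(2)] by simp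
  show m: "\<And>x. x \<in> R \<Longrightarrow> \<tau> (- x) = - \<tau> x" using d[OF S(1)] 0 by simp
  show "\<And>x y. x \<in> R \<Longrightarrow> y \<in> R \<Longrightarrow> \<tau> (x + y) = \<tau> x + \<tau> y"
    using d[OF _ S(3)] m by simp
qed

lemma rhom_sum: "rhom R \<tau> \<Longrightarrow> (\<And>i. i \<in> I \<Longrightarrow> f i \<in> R) \<Longrightarrow> \<tau> (sum f I) = (\<Sum>i\<in>I. \<tau> (f i))"
proof (induction I rule: infinite_finite_induct)
  case (insert x F)
  moreover have "sum f F \<in> R" using insert by (auto intro!: sring_sum rhomD)
  ultimately show ?case by (simp add: rhomD)
qed (auto simp: rhomD)

lemma rhom_prod: "rhom R \<tau> \<Longrightarrow> (\<And>i. i \<in> I \<Longrightarrow> f i \<in> R) \<Longrightarrow> \<tau> (prod f I) = (\<Prod>i\<in>I. \<tau> (f i))"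
proof (induction I rule: infinite_finite_induct)
  case (insert x F)
  moreover have "prod f F \<in> R" using insert by (auto intro!: sring_prod rhomD)
  ultimately show ?case by (simp add: rhomD)
qed (auto simp: rhomD)

lemma rhom_power: "rhom R \<tau> \<Longrightarrow> x \<in> R \<Longrightarrow> \<tau> (x ^ n) = \<tau> x ^ n"
  by (induction n) (auto simp: rhomD sring_power)

lemma rhom_subset: "rhom R \<tau> \<Longrightarrow> sring S \<Longrightarrow> S \<subseteq> R \<Longrightarrow> rhom S \<tau>"
  unfolding rhom_def by blast

lemma rhom_id: "sring R \<Longrightarrow> rhom R (\<lambda>x. x)" by (simp add: rhom_def)

lemma rhom_cong: "rhom R \<tau> \<Longrightarrow> (\<And>x. x \<in> R \<Longrightarrow> \<sigma> x = \<tau> x) \<Longrightarrow> rhom R \<sigma>"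
  unfolding rhom_def by (auto simp: sringD)

lemma rhom_comp: "rhom R \<tau> \<Longrightarrow> rhom S \<sigma> \<Longrightarrow> \<tau> ` R \<subseteq> S \<Longrightarrow> rhom R (\<lambda>x. \<sigma> (\<tau> x))"
  unfolding rhom_def by (auto simp: image_subset_iff)

lemma coeff_map: "rhom R \<tau> \<Longrightarrow> coeff (map_poly \<tau> p) i = \<tau> (coeff p i)"
  by (simp add: coeff_map_poly rhomD)

lemma map_poly_rhom: "rhom R \<tau> \<Longrightarrow> rhom (polys R) (map_poly \<tau>)"
  unfolding rhom_def[of "polys R"]
proof safe
  assume h: "rhom R \<tau>"
  show "sring (polys R)" using h by (simp add: rhomD sring_polys)
  show "map_poly \<tau> 1 = 1" using h by (simp add: rhomD)
  fix p q assume pq: "p \<in> polys R" "q \<in> polys R"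
  show "map_poly \<tau> (p - q) = map_poly \<tau> p - map_poly \<tau> q"
    using pq h by (intro poly_eqI) (simp add: coeff_map rhomD polysD)
  show "map_poly \<tau> (p * q) = map_poly \<tau> p * map_poly \<tau> q"
  proof (intro poly_eqI)
    fix n
    have "\<tau> (\<Sum>i\<le>n. coeff p i * coeff q (n - i)) = (\<Sum>i\<le>n. \<tau> (coeff p i * coeff q (n - i)))"
      using pq by (intro rhom_sum[OF h]) (simp add: rhomD[OF h] polysD sringD)
    then show "coeff (map_poly \<tau> (p * q)) n = coeff (map_poly \<tau> p * map_poly \<tau> q) n"
      using pq h by (simp add: coeff_map coeff_mult polysD rhomD)
  qed
qed

lemma map_poly_polys:
  "rhom R \<tau> \<Longrightarrow> p \<in> polys R \<Longrightarrow> \<tau> ` R \<subseteq> S \<Longrightarrow> map_poly \<tau> p \<in> polys S"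
  by (intro polysI) (auto simp: coeff_map polysD)

lemma map_pCons: "rhom R \<tau> \<Longrightarrow> map_poly \<tau> (pCons a p) = pCons (\<tau> a) (map_poly \<tau> p)"
  by (intro map_poly_pCons) (auto simp: rhomD)

lemma poly_map: "rhom R \<tau> \<Longrightarrow> p \<in> polys R \<Longrightarrow> x \<in> R \<Longrightarrow> poly (map_poly \<tau> p) (\<tau> x) = \<tau> (poly p x)"
  by (induction p) (auto simp: map_pCons rhomD polys_pCons poly_in sringD)

lemma map_monic:
  assumes "rhom R \<tau>" "lead_coeff f = 1"
  shows "degree (map_poly \<tau> f) = degree f" "lead_coeff (map_poly \<tau> f) = 1"
proof -
  show *: "degree (map_poly \<tau> f) = degree f"
  proof (rule antisym)
    show "degree (map_poly \<tau> f) \<le> degree f" using assms(1)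
      by (intro degree_le) (simp add: coeff_map coeff_eq_0 rhomD)
    show "degree f \<le> degree (map_poly \<tau> f)"
      using assms by (intro le_degree) (simp add: coeff_map rhomD)
  qed
  show "lead_coeff (map_poly \<tau> f) = 1" using assms by (simp add: * coeff_map rhomD)
qed

lemma map_poly_fixed: "(\<And>i. \<tau> (coeff p i) = coeff p i) \<Longrightarrow> \<tau> 0 = 0 \<Longrightarrow> map_poly \<tau> p = p"
  by (intro poly_eqI) (simp add: coeff_map_poly)

lemma map_polys_fixed: "rhom R \<tau> \<Longrightarrow> (\<And>c. c \<in> C \<Longrightarrow> \<tau> c = c) \<Longrightarrow> p \<in> polys C \<Longrightarrow> map_poly \<tau> p = p"
  by (rule map_poly_fixed) (auto simp: polysD rhomD)

lemma rhom_poly_fixed: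
  assumes "rhom R \<tau>" "C \<subseteq> R" "x \<in> R" "\<And>c. c \<in> C \<Longrightarrow> \<tau> c = c" "p \<in> polys C"
  shows "\<tau> (poly p x) = poly p (\<tau> x)"
  using poly_map[OF assms(1) _ assms(3), of p] map_polys_fixed[OF assms(1,4,5)] assms(5) polys_mono[OF assms(2)] by auto

lemma polys_linear: "sring R \<Longrightarrow> x \<in> R \<Longrightarrow> [:- x, 1:] \<in> polys R"
  by (simp add: polys_pCons sringD sring_polys)

lemma map_linear: "rhom R \<tau> \<Longrightarrow> x \<in> R \<Longrightarrow> map_poly \<tau> [:- x, 1:] = [:- \<tau> x, 1:]"
  by (simp add: map_pCons rhomD)

lemma rhom_field_nz:
  fixes \<tau> :: "'a::field \<Rightarrow> 'b::field"
  assumes "rhom K \<tau>" "sfield K" "x \<in> K" "x \<noteq> 0" shows "\<tau> x \<noteq> 0"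
  using rhomD(7)[OF assms(1,3), of "inverse x"] rhomD(2)[OF assms(1)] assms sfieldD(2)[of K x] by auto

lemma rhom_field_inj:
  fixes \<tau> :: "'a::field \<Rightarrow> 'b::field"
  assumes "rhom K \<tau>" "sfield K" shows "inj_on \<tau> K"
proof (rule inj_onI)
  fix x y assume "x \<in> K" "y \<in> K" "\<tau> x = \<tau> y"
  with rhom_field_nz[OF assms, of "x - y"] rhomD(6)[OF assms(1), of x y] sringD(5)[OF rhomD(1)[OF assms(1)]]
  show "x = y" by force
qed

lemma rhom_inverse:
  fixes \<tau> :: "'a::field \<Rightarrow> 'b::field"
  assumes "rhom R \<tau>" "x \<in> R" "inverse x \<in> R" shows "\<tau> (inverse x) = inverse (\<tau> x)"
proof (cases "x = 0")
  case False
  then have "\<tau> x * \<tau> (inverse x) = 1" using rhomD(7)[OF assms] rhomD(2)[OF assms(1)] by simp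
  then show ?thesis by (metis inverse_unique)
qed (simp add: rhomD[OF assms(1)])

text \<open>Specializations are homomorphisms on a local subring, the elements outside the kernel being
  units.  For a field \<open>R\<close> this is just an embedding.\<close>

definition lhom :: "'a::field set \<Rightarrow> ('a \<Rightarrow> 'b::field) \<Rightarrow> bool" where
  "lhom R \<tau> \<longleftrightarrow> rhom R \<tau> \<and> (\<forall>x\<in>R. \<tau> x \<noteq> 0 \<longrightarrow> inverse x \<in> R)"

lemma lhom_field: "sfield K \<Longrightarrow> rhom K \<tau> \<Longrightarrow> lhom K \<tau>"
  by (simp add: lhom_def sfieldD)

text \<open>This is the localization of \<open>R[u]\<close> at the kernel of the map sending
  \<open>u\<close> to \<open>u'\<close>, which \<open>van\<close> makes well defined. Its elements
  are the fractions whose denominator does not vanish at \<open>u'\<close>; they again form a local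
  ring, so generators can be specialized one by one.\<close>

lemma lhom_extend:
  fixes \<tau> :: "'a::field \<Rightarrow> 'b::field"
  assumes l: "lhom R \<tau>" and van: "\<And>P. P \<in> polys R \<Longrightarrow> poly P u = 0 \<Longrightarrow> poly (map_poly \<tau> P) u' = 0"
  obtains R' \<tau>' where "lhom R' \<tau>'" "R \<subseteq> R'" "u \<in> R'" "\<And>x. x \<in> R \<Longrightarrow> \<tau>' x = \<tau> x" "\<tau>' u = u'"
    "\<And>Q. Q \<in> polys R \<Longrightarrow> poly (map_poly \<tau> Q) u' \<noteq> 0 \<Longrightarrow> inverse (poly Q u) \<in> R'"
    "\<And>x. x \<in> R' \<Longrightarrow> \<exists>P\<in>polys R. \<exists>Q\<in>polys R. poly Q u \<noteq> 0 \<and> x = poly P u / poly Q u"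
proof -
  have h: "rhom R \<tau>" using l by (simp add: lhom_def)
  note R = rhomD(1)[OF h] note PR = sring_polys[OF R] note mh = map_poly_rhom[OF h]
  \<comment> \<open>By contraposition of \<open>van\<close>, a denominator that is nonzero at
    \<open>u'\<close> is nonzero at \<open>u\<close>, so the fraction makes sense.\<close>
  define ok where "ok P Q x \<longleftrightarrow> P \<in> polys R \<and> Q \<in> polys R \<and> poly (map_poly \<tau> Q) u' \<noteq> 0 \<and> x = poly P u / poly Q u" for P Q x
  define ev where "ev P = poly (map_poly \<tau> P) u'" for P
  have ev: "ev (P * Q) = ev P * ev Q" "ev (P - Q) = ev P - ev Q" "ev (P + Q) = ev P + ev Q" if "P \<in> polys R" "Q \<in> polys R" for P Q
    using that by (simp_all add: ev_def rhomD[OF mh])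
  have ev1: "ev 1 = 1" "ev 0 = 0" by (simp_all add: ev_def rhomD[OF mh])
  have okD: "P \<in> polys R" "Q \<in> polys R" "ev Q \<noteq> 0" "poly Q u \<noteq> 0" "x = poly P u / poly Q u" if "ok P Q x" for P Q x
    using that van unfolding ok_def ev_def by auto
  \<comment> \<open>Cross-multiplying two representations of \<open>x\<close> gives a polynomial
    relation for \<open>u\<close>, to which \<open>van\<close> applies.\<close>
  have uniq: "ev P / ev Q = ev P1 / ev Q1" if "ok P Q x" "ok P1 Q1 x" for P Q P1 Q1 x
  proof -
    note a = okD[OF that(1)] and b = okD[OF that(2)]
    have "poly (P * Q1 - P1 * Q) u = 0" using a(4,5) b(4,5) by (simp add: field_simps)
    moreover have "P * Q1 - P1 * Q \<in> polys R" by (intro sringD(5,6)[OF PR] a b)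
    ultimately have "ev (P * Q1 - P1 * Q) = 0" using van unfolding ev_def by blast
    then show ?thesis using a b sringD(6)[OF PR] by (simp add: ev field_simps)
  qed
  define R' where "R' = {x. \<exists>P Q. ok P Q x}"
  define \<tau>' where "\<tau>' x = (SOME v. \<exists>P Q. ok P Q x \<and> v = ev P / ev Q)" for x
  have t: "\<tau>' x = ev P / ev Q" if "ok P Q x" for P Q x
  proof -
    have "\<exists>P Q. ok P Q x \<and> \<tau>' x = ev P / ev Q"
      unfolding \<tau>'_def by (rule someI_ex) (use that in blast)
    then show ?thesis using uniq[OF that] by metis
  qed
  have okI: "ok P Q x" if "P \<in> polys R" "Q \<in> polys R" "ev Q \<noteq> 0" "x = poly P u / poly Q u" for P Q x
    using that unfolding ok_def ev_def by auto
  have okm: "ok (P * P1) (Q * Q1) (x * y)" and okd: "ok (P * Q1 - P1 * Q) (Q * Q1) (x - y)" if "ok P Q x" "ok P1 Q1 y" for P Q x P1 Q1 y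
  proof -
    note a = okD[OF that(1)] and b = okD[OF that(2)]
    show "ok (P * P1) (Q * Q1) (x * y)" using a b sringD[OF PR] by (intro okI) (auto simp: ev)
    have "x - y = poly (P * Q1 - P1 * Q) u / poly (Q * Q1) u"
      using a(4) b(4) by (simp add: a(5) b(5) diff_frac_eq)
    moreover have "ev (Q * Q1) \<noteq> 0" using a(1-3) b(1-3) by (simp add: ev)
    ultimately show "ok (P * Q1 - P1 * Q) (Q * Q1) (x - y)"
      by (intro okI sringD(5,6)[OF PR] a b)
  qed
  have okR: "ok [:x:] 1 x" if "x \<in> R" for x using that by (intro okI) (auto simp: ev1 sringD[OF PR] polys_const[OF R])
  have ev_const: "ev [:x:] = \<tau> x" for x by (simp add: ev_def map_pCons[OF h] rhomD[OF h])
  have oku: "ok [:0,1:] 1 u" by (intro okI) (auto simp: ev1 sringD[OF PR] sringD[OF R] polys_pCons[OF R])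
  have "sring R'" unfolding sring_def R'_def using okm okd okR[OF sringD(2)[OF R]] by (auto, blast+)
  then have rh: "rhom R' \<tau>'"
    unfolding rhom_def
  proof (safe)
    show "\<tau>' 1 = 1" using t[OF okR[OF sringD(2)[OF R]]] by (simp add: ev_const ev1 rhomD[OF h])
    fix x y assume "x \<in> R'" "y \<in> R'"
    then obtain P Q P1 Q1 where o: "ok P Q x" "ok P1 Q1 y" unfolding R'_def by blast
    show "\<tau>' (x * y) = \<tau>' x * \<tau>' y" unfolding t[OF okm[OF o]] t[OF o(1)] t[OF o(2)]
      using okD(1-3)[OF o(1)] okD(1-3)[OF o(2)] by (simp add: ev)
    show "\<tau>' (x - y) = \<tau>' x - \<tau>' y" 
      unfolding t[OF okd[OF o]] t[OF o(1)] t[OF o(2)]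
      using okD(1-3)[OF o(1)] okD(1-3)[OF o(2)] sringD(6)[OF PR] by (simp add: ev diff_frac_eq)
  qed
  have inv: "ok Q P (inverse x)" if "ok P Q x" "ev P \<noteq> 0" for P Q x
    using okD(1-3)[OF that(1)] that(2) by (intro okI) (auto simp: okD(5)[OF that(1)] inverse_divide)
  have "lhom R' \<tau>'" unfolding lhom_def
  proof (safe)
    fix x assume x: "x \<in> R'" "\<tau>' x \<noteq> 0"
    then obtain P Q where o: "ok P Q x" unfolding R'_def by blast
    have "ev P \<noteq> 0" using x t[OF o] by auto
    then show "inverse x \<in> R'" using inv[OF o] unfolding R'_def by blast
  qed (rule rh)
  moreover have "R \<subseteq> R'" using okR unfolding R'_def by blast
  moreover have "u \<in> R'" using oku unfolding R'_def by blast
  moreover have "\<tau>' x = \<tau> x" if "x \<in> R" for x using t[OF okR[OF that]] by (simp add: ev_const ev1)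
  moreover have "\<tau>' u = u'" using t[OF oku] ev1(1) by (simp add: ev_def map_pCons[OF h] rhomD[OF h])
  moreover have "inverse (poly Q u) \<in> R'" if "Q \<in> polys R" "poly (map_poly \<tau> Q) u' \<noteq> 0" for Q
  proof -
    have "ok 1 Q (inverse (poly Q u))" using that sringD(2)[OF PR] by (intro okI) (auto simp: ev_def inverse_eq_divide)
    then show ?thesis unfolding R'_def by blast
  qed
  moreover have "\<exists>P\<in>polys R. \<exists>Q\<in>polys R. poly Q u \<noteq> 0 \<and> x = poly P u / poly Q u" if "x \<in> R'" for x
    using that okD unfolding R'_def by blast
  ultimately show thesis using that by blast
qed

text \<open>As \<open>R\<close> may be a mere local ring, a monic relation \<open>f\<close> of least
  degree takes the place of a minimal polynomial: the remainder of \<open>P\<close> modulo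
  \<open>f\<close> is a relation of smaller degree, hence zero. This supplies the hypothesis
  \<open>van\<close> of \<open>lhom_extend\<close>.\<close>

lemma minimal_vanishing:
  fixes f :: "'a::field poly" and \<tau> :: "'a \<Rightarrow> 'b::field"
  assumes h: "rhom R \<tau>" and f: "f \<in> polys R" "lead_coeff f = 1" "poly f u = 0" "poly (map_poly \<tau> f) u' = 0"
    and mn: "\<And>r. r \<in> polys R \<Longrightarrow> degree r < degree f \<Longrightarrow> poly r u = 0 \<Longrightarrow> r = 0"
    and P: "P \<in> polys R" "poly P u = 0"
  shows "poly (map_poly \<tau> P) u' = 0"
proof -
  obtain q r where qr: "q \<in> polys R" "r \<in> polys R" "P = f * q + r" "r = 0 \<or> degree r < degree f"
    using monic_division[OF rhomD(1)[OF h] f(1,2) P(1)] by blast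
  have "poly r u = 0" using P(2) f(3) qr(3) by simp
  then have "r = 0" using mn qr by blast
  then show ?thesis using qr f rhomD(7)[OF map_poly_rhom[OF h] f(1) qr(1)] by simp
qed

subsection \<open>Polynomials over subfields of the universal domain\<close>

lemma field_Dom: "field (Dom :: 'a::alg_closed_field ring)" by (rule field_from_type_algebra)

interpretation D: domain "Dom :: 'a::alg_closed_field ring"
  using field_Dom by (rule field.axioms)

lemma Dom_simps [simp]:
  "carrier (Dom :: 'a::alg_closed_field ring) = UNIV"
  "monoid.mult (Dom :: 'a ring) x y = x * y" "monoid.one (Dom :: 'a ring) = 1"
  "ring.zero (Dom :: 'a ring) = 0" "ring.add (Dom :: 'a ring) x y = x + y"
  by (simp_all add: ring_of_type_algebra_def)

lemma Dom_a_inv [simp]: "a_inv Dom x = - (x :: 'a::alg_closed_field)"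
  using D.minus_equality[of "- x" x] by simp

lemma Dom_m_inv: "x \<noteq> 0 \<Longrightarrow> m_inv Dom x = inverse (x :: 'a::alg_closed_field)"
  using D.comm_inv_char[of x "inverse x"] by simp

lemma Dom_pow [simp]: "pow Dom x (n::nat) = (x :: 'a::alg_closed_field) ^ n"
  by (induction n) (simp_all add: mult.commute)

lemma subring_Dom: "subring K (Dom :: 'a::alg_closed_field ring) \<longleftrightarrow> sring K"
proof
  assume "subring K (Dom :: 'a ring)"
  note s = subringE[OF this]
  have "x - y \<in> K" if "x \<in> K" "y \<in> K" for x y
    using s(7)[of x "- y"] s(5)[of y] that by simp
  then show "sring K" using s(3,6) unfolding sring_def by simp
next
  assume "sring K" then show "subring K (Dom :: 'a ring)"
    by (intro D.subringI) (auto simp: sringD)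
qed

lemma subfield_Dom: "subfield K (Dom :: 'a::alg_closed_field ring) \<longleftrightarrow> sfield K"
proof
  assume s: "subfield K (Dom :: 'a ring)"
  have r: "sring K" using subfieldE(1)[OF s] by (simp add: subring_Dom)
  have "inverse x \<in> K" if "x \<in> K" for x
    using D.subfield_m_inv(1)[OF s, of x] that Dom_m_inv[of x] sringD(1)[OF r] by (cases "x = 0") auto
  with r show "sfield K" by (simp add: sfield_def)
next
  assume "sfield K"
  then show "subfield K (Dom :: 'a ring)"
    by (intro field.subfieldI'[OF field_Dom]) (auto simp: subring_Dom sfield_def Dom_m_inv)
qed

text \<open>In a finite field the product of all \<open>X - a\<close>, plus 1, is a nonconstant
  polynomial without a root.\<close>

lemma infinite_alg_closed: "infinite (UNIV :: 'a::alg_closed_field set)"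
proof
  assume fin: "finite (UNIV :: 'a set)"
  define p :: "'a poly" where "p = (\<Prod>a\<in>UNIV. [:- a, 1:])"
  have d: "degree p = card (UNIV :: 'a set)" unfolding p_def
    by (subst degree_prod_eq_sum_degree) auto
  have "degree (p + 1) = degree p" using d fin
    by (intro degree_add_eq_left) (auto simp: card_gt_0_iff)
  then have "degree (p + 1) > 0" using d fin by (simp add: card_gt_0_iff)
  then obtain x where "poly (p + 1) x = 0" using alg_closed_imp_poly_has_root by blast
  moreover have "poly p x = 0" using fin by (auto simp: p_def poly_prod prod_zero_iff)
  ultimately show False by simp
qed

lemma poly_zero_on_infinite:
  fixes p :: "'a::idom poly"
  assumes "infinite S" "\<And>x. x \<in> S \<Longrightarrow> poly p x = 0" shows "p = 0"
proof (rule ccontr)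
  assume "p \<noteq> 0"
  then have "finite {x. poly p x = 0}" by (rule poly_roots_finite)
  moreover have "S \<subseteq> {x. poly p x = 0}" using assms by auto
  ultimately show False using assms finite_subset by blast
qed

text \<open>HOL-Algebra stores the leading coefficient of a polynomial at the head of the list.\<close>

definition lpoly :: "'a::zero list \<Rightarrow> 'a poly" where "lpoly p = Poly (rev p)"

lemma eval_Dom: "ring.eval Dom p x = poly (lpoly p) (x :: 'a::alg_closed_field)"
  by (induction p) (auto simp: lpoly_def Poly_snoc poly_monom)

lemma coeffs_lpoly:
  assumes "p \<in> carrier (univ_poly Dom K)" shows "coeffs (lpoly p) = rev (p :: 'a::alg_closed_field list)"
proof -
  have "p = [] \<or> hd p \<noteq> 0" using assms by (auto simp: univ_poly_def polynomial_def)
  then show ?thesis by (cases p) (auto simp: lpoly_def strip_while_def)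
qed

lemma lpoly_props:
  assumes "p \<in> carrier (univ_poly Dom K)" "sring K"
  shows "lpoly p \<in> polys K" "lpoly p = 0 \<longleftrightarrow> p = []" "p \<noteq> [] \<Longrightarrow> lead_coeff (lpoly p) = hd p"
proof -
  show z: "lpoly p = 0 \<longleftrightarrow> p = []" using coeffs_lpoly[OF assms(1)] by (metis coeffs_eq_Nil rev_is_Nil_conv)
  have sub: "set p \<subseteq> K" using assms by (auto simp: univ_poly_def polynomial_def)
  have c: "coeff (lpoly p) i \<in> insert 0 (set p)" for i
    by (auto simp: lpoly_def nth_default_def)  (metis length_rev nth_mem set_rev)
  show "lpoly p \<in> polys K"
  proof (rule polysI)
    fix i show "coeff (lpoly p) i \<in> K" using c[of i] sub sringD(1)[OF assms(2)] by auto
  qed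
  show "lead_coeff (lpoly p) = hd p" if "p \<noteq> []"
    using that z coeffs_lpoly[OF assms(1)] last_coeffs_eq_coeff_degree[of "lpoly p"] by (simp add: last_rev)
qed

lemma lpoly_inj:
  assumes "p \<in> carrier (univ_poly Dom K)" "q \<in> carrier (univ_poly Dom K)" "lpoly p = lpoly q"
  shows "p = (q :: 'a::alg_closed_field list)"
  using coeffs_lpoly[OF assms(1)] coeffs_lpoly[OF assms(2)] assms(3) by (metis rev_rev_ident)

definition polyl :: "'a::zero poly \<Rightarrow> 'a list" where "polyl p = rev (coeffs p)"

lemma lpoly_polyl [simp]: "lpoly (polyl p) = p" by (simp add: lpoly_def polyl_def)

lemma polyl_carrier:
  assumes "p \<in> polys K" shows "polyl p \<in> carrier (univ_poly Dom (K :: 'a::alg_closed_field set))"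
proof (cases "p = 0")
  case False
  have "set (coeffs p) \<subseteq> K" using assms by (auto simp: coeffs_def polysD)
  moreover have "hd (rev (coeffs p)) = lead_coeff p" using False by (simp add: hd_rev last_coeffs_eq_coeff_degree)
  ultimately show ?thesis using False by (auto simp: univ_poly_def polynomial_def polyl_def)
qed (simp add: polyl_def univ_poly_def polynomial_def)

lemma polyl_Nil: "polyl p = [] \<longleftrightarrow> p = 0" by (simp add: polyl_def)

lemma poly_eqI_eval:
  fixes p q :: "'a::alg_closed_field poly"
  assumes "\<And>x. poly p x = poly q x" shows "p = q"
  using poly_zero_on_infinite[OF infinite_alg_closed, of "p - q"] assms by simp

text \<open>Comparing values suffices because the field is infinite. Evaluation is known to be
  multiplicative on both sides, so the convolution of coefficient lists is never unfolded.\<close>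

lemma lpoly_mult:
  fixes K :: "'a::alg_closed_field set"
  assumes "sring K" "p \<in> carrier (univ_poly Dom K)" "q \<in> carrier (univ_poly Dom K)"
  shows "lpoly (monoid.mult (univ_poly Dom K) p q) = lpoly p * lpoly q"
proof (rule poly_eqI_eval)
  fix x :: 'a
  have K: "subring K Dom" using assms by (simp add: subring_Dom)
  interpret E: ring_hom_ring "univ_poly Dom K" Dom "\<lambda>p. ring.eval Dom p x"
    using D.eval_ring_hom[OF K] by simp
  show "poly (lpoly (monoid.mult (univ_poly Dom K) p q)) x = poly (lpoly p * lpoly q) x"
    using E.hom_mult[OF assms(2,3)] by (simp add: eval_Dom)
qed

lemma pdivides_Dom:
  assumes "p \<in> carrier (univ_poly Dom UNIV)" "q \<in> carrier (univ_poly Dom UNIV)"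
  shows "p pdivides\<^bsub>Dom\<^esub> q \<longleftrightarrow> lpoly p dvd (lpoly q :: 'a::alg_closed_field poly)"
proof
  assume "p pdivides\<^bsub>Dom\<^esub> q"
  then obtain c where "c \<in> carrier (univ_poly Dom UNIV)" "q = monoid.mult (univ_poly Dom UNIV) p c"
    unfolding pdivides_def factor_def by auto
  with lpoly_mult[OF sring_UNIV assms(1)] show "lpoly p dvd lpoly q" by (metis dvd_triv_left)
next
  assume "lpoly p dvd lpoly q"
  then obtain c where c: "lpoly q = lpoly p * c" by (rule dvdE)
  have cc: "polyl c \<in> carrier (univ_poly Dom UNIV)" by (rule polyl_carrier) simp
  interpret U: ring "univ_poly Dom (UNIV :: 'a set)"
    using D.univ_poly_is_ring[of UNIV] by (simp add: subring_Dom sring_UNIV)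
  have "q = monoid.mult (univ_poly Dom UNIV) p (polyl c)"
    using lpoly_mult[OF sring_UNIV assms(1) cc] c assms(2) U.m_closed[OF assms(1) cc]
    by (intro lpoly_inj[of _ UNIV]) auto
  with cc show "p pdivides\<^bsub>Dom\<^esub> q" unfolding pdivides_def factor_def by auto
qed

lemma lpoly_linear_pow:
  "[1, - y] [^]\<^bsub>univ_poly Dom UNIV\<^esub> (n::nat) \<in> carrier (univ_poly Dom UNIV)"
  "lpoly ([1, - y] [^]\<^bsub>univ_poly Dom UNIV\<^esub> n) = [:- (y :: 'a::alg_closed_field), 1:] ^ n"
proof -
  interpret U: ring "univ_poly Dom (UNIV :: 'a set)"
    using D.univ_poly_is_ring[of UNIV] by (simp add: subring_Dom sring_UNIV)
  have l: "[1, - y] \<in> carrier (univ_poly Dom UNIV)" by (simp add: univ_poly_def polynomial_def)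
  show "[1, - y] [^]\<^bsub>univ_poly Dom UNIV\<^esub> n \<in> carrier (univ_poly Dom UNIV)" for n :: nat
    by (rule U.nat_pow_closed[OF l])
  then show "lpoly ([1, - y] [^]\<^bsub>univ_poly Dom UNIV\<^esub> n) = [:- y, 1:] ^ n"
  proof (induction n)
    case 0 show ?case by (simp add: univ_poly_def lpoly_def one_pCons)
  next
    case (Suc n)
    have "lpoly [1, - y] = [:- y, 1:]" by (simp add: lpoly_def)
    then show ?case using Suc lpoly_mult[OF sring_UNIV Suc.prems l, of n] by (simp add: mult.commute)
  qed
qed

lemma alg_mult_le_1:
  assumes "p \<in> carrier (univ_poly Dom UNIV)" "p \<noteq> []"
  shows "ring.alg_mult Dom p y \<le> 1 \<longleftrightarrow> \<not> [:- y, 1:] ^ 2 dvd (lpoly p :: 'a::alg_closed_field poly)"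
proof -
  note pd = pdivides_Dom[OF lpoly_linear_pow(1) assms(1), where y1 = y and n1 = 2, unfolded lpoly_linear_pow(2)]
  have "2 \<le> ring.alg_mult Dom p y \<longleftrightarrow> ([1, - y] [^]\<^bsub>univ_poly Dom UNIV\<^esub> (2::nat)) pdivides\<^bsub>Dom\<^esub> p"
    using D.le_alg_mult_imp_pdivides[of y p 2] D.alg_multE(2)[of y p 2] assms by auto
  then show ?thesis using pd by linarith
qed

section \<open>Algebraic elements, minimal polynomials and separability\<close>

definition alg :: "'a::comm_ring_1 set \<Rightarrow> 'a \<Rightarrow> bool" where
  "alg K x \<longleftrightarrow> (\<exists>p\<in>polys K. p \<noteq> 0 \<and> poly p x = 0)"

lemma algI: "p \<in> polys K \<Longrightarrow> p \<noteq> 0 \<Longrightarrow> poly p x = 0 \<Longrightarrow> alg K x" by (auto simp: alg_def)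

lemma alg_mono: "K \<subseteq> L \<Longrightarrow> alg K x \<Longrightarrow> alg L x" unfolding alg_def using polys_mono by blast

lemma alg_self: "sring K \<Longrightarrow> x \<in> K \<Longrightarrow> alg K x"
  by (rule algI[of "[:- x, 1:]"]) (auto simp: polys_pCons sringD sring_polys)

lemma algebraic_Dom:
  fixes K :: "'a::alg_closed_field set"
  assumes "sring K" shows "ring.algebraic Dom K x \<longleftrightarrow> alg K x"
proof
  assume "ring.algebraic Dom K x"
  then obtain p where "p \<in> carrier (univ_poly Dom K)" "p \<noteq> []" "ring.eval Dom p x = 0"
    using D.algebraicE[of K x] assms by (auto simp: over_def subring_Dom)
  with lpoly_props[OF this(1) assms] show "alg K x" by (auto simp: eval_Dom intro: algI)
next
  assume "alg K x"
  then obtain p where "p \<in> polys K" "p \<noteq> 0" "poly p x = 0" unfolding alg_def by blast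
  then show "ring.algebraic Dom K x"
    using D.algebraicI[of "polyl p" K x] polyl_carrier[of p K] by (auto simp: eval_Dom polyl_Nil over_def)
qed

definition irr :: "'a::alg_closed_field set \<Rightarrow> 'a \<Rightarrow> 'a poly" where
  "irr K x = lpoly (ring.Irr Dom K x)"

lemma irr_props:
  fixes K :: "'a::alg_closed_field set"
  assumes K: "sfield K" and x: "alg K x"
  shows "irr K x \<in> polys K" "lead_coeff (irr K x) = 1" "poly (irr K x) x = 0" "irr K x \<noteq> 0"
    "ring.is_root Dom (ring.Irr Dom K x) y \<longleftrightarrow> poly (irr K x) y = 0"
    "\<And>P. P \<in> polys K \<Longrightarrow> poly P x = 0 \<Longrightarrow> irr K x dvd P"
    "separable_over K x \<longleftrightarrow> (\<forall>y. \<not> [:- y, 1:] ^ 2 dvd irr K x)"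
proof -
  have r: "sring K" using K by (simp add: sfieldD)
  have sf: "subfield K (Dom :: 'a ring)" using K by (simp add: subfield_Dom)
  have a: "ring.algebraic Dom K x" using x r by (simp add: algebraic_Dom)
  have a': "(ring.algebraic Dom over K) x" using a by (simp add: over_def)
  have U: "x \<in> carrier Dom" by simp
  note I = D.IrrE[OF sf U a']
  have cU: "p \<in> carrier (univ_poly Dom UNIV)" if "p \<in> carrier (univ_poly Dom K)" for p
    using that by (auto simp: univ_poly_def polynomial_def)
  have ne: "ring.Irr Dom K x \<noteq> []"
    using D.pirreducibleE(1)[OF subfieldE(1)[OF sf] I(1,2)] by (simp add: univ_poly_def)
  note lp = lpoly_props[OF I(1) r, folded irr_def]
  show "irr K x \<in> polys K" "lead_coeff (irr K x) = 1" "poly (irr K x) x = 0" "irr K x \<noteq> 0"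
    using lp I(3,4) ne by (auto simp: eval_Dom irr_def)
  show "ring.is_root Dom (ring.Irr Dom K x) y \<longleftrightarrow> poly (irr K x) y = 0"
    using ne by (simp add: D.is_root_def eval_Dom irr_def)
  show "irr K x dvd P" if "P \<in> polys K" "poly P x = 0" for P
  proof -
    have "ring.Irr Dom K x pdivides\<^bsub>Dom\<^esub> polyl P"
      using D.Irr_minimal[OF sf U a', of "polyl P"] that polyl_carrier[of P K] by (simp add: eval_Dom)
    then show ?thesis using pdivides_Dom[OF cU[OF I(1)] cU[OF polyl_carrier[OF that(1)]]] by (simp add: irr_def)
  qed
  show "separable_over K x \<longleftrightarrow> (\<forall>y. \<not> [:- y, 1:] ^ 2 dvd irr K x)"
    unfolding separable_over_def using a alg_mult_le_1[OF cU[OF I(1)] ne] by (simp add: irr_def)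
qed

text \<open>The minimal polynomial divides a product of distinct linear factors. This gives
  algebraicity, separability and the location of all conjugates at once; \<open>S\<close> will be an
  orbit of a finite group.\<close>

lemma separable_overI:
  assumes K: "sfield K" and S: "finite S" "x \<in> S" "(\<Prod>s\<in>S. [:- s, 1:]) \<in> polys K"
  shows "alg K x" "separable_over K x" "ring.is_root Dom (ring.Irr Dom K x) y \<Longrightarrow> y \<in> S"
proof -
  define P where "P = (\<Prod>s\<in>S. [:- s, 1:])"
  have root: "poly P y = 0 \<longleftrightarrow> y \<in> S" for y
    using S(1) by (auto simp: P_def poly_prod prod_zero_iff)
  have "P \<noteq> 0" using S by (auto simp: P_def)
  then show a: "alg K x" using S root by (intro algI[of P]) (auto simp: P_def)
  have d: "irr K x dvd P" using irr_props(6)[OF K a] S root by (simp add: P_def)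
  obtain q where q: "P = irr K x * q" using d by (rule dvdE)
  show "y \<in> S" if "ring.is_root Dom (ring.Irr Dom K x) y"
    using that root[of y] by (simp add: irr_props(5)[OF K a] q)
  have "\<not> [:- y, 1:] ^ 2 dvd P" for y
  proof
    assume *: "[:- y, 1:] ^ 2 dvd P"
    then have "poly P y = 0" by (metis dvd_power_same dvd_trans dvd_triv_left poly_eq_0_iff_dvd power2_eq_square)
    then have y: "y \<in> S" by (simp add: root)
    then have P: "P = [:- y, 1:] * (\<Prod>s\<in>S - {y}. [:- s, 1:])" using S by (simp add: P_def prod.remove)
    have "[:- y, 1:] * [:- y, 1:] dvd [:- y, 1:] * (\<Prod>s\<in>S - {y}. [:- s, 1:])"
      using * unfolding P power2_eq_square .
    then have "[:- y, 1:] dvd (\<Prod>s\<in>S - {y}. [:- s, 1:])"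
      unfolding dvd_mult_cancel_left by auto
    then show False using S by (auto simp: poly_eq_0_iff_dvd[symmetric] poly_prod prod_zero_iff)
  qed
  then show "separable_over K x" unfolding irr_props(7)[OF K a] using d dvd_trans by blast
qed

text \<open>Outside \<open>K\<close> the minimal polynomial has degree at least 2, so the cofactor
  of \<open>X - x\<close> has a root, and separability keeps that root apart from
  \<open>x\<close>.\<close>

lemma separable_conjugate:
  assumes K: "sfield K" and x: "separable_over K x" "x \<notin> K"
  obtains x' where "x' \<noteq> x" "ring.is_root Dom (ring.Irr Dom K x) x'"
    "\<And>P. P \<in> polys K \<Longrightarrow> poly P x = 0 \<Longrightarrow> poly P x' = 0"
proof -
  have a: "alg K x" using x algebraic_Dom[of K x] K by (simp add: separable_over_def sfieldD)
  note I = irr_props[OF K a]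
  obtain q where q: "irr K x = [:- x, 1:] * q" using I(3) unfolding poly_eq_0_iff_dvd by (rule dvdE)
  have q0: "q \<noteq> 0" using I(4) q by auto
  have lq: "lead_coeff q = 1" using I(2) lead_coeff_mult[of "[:- x, 1:]" q] by (simp add: q)
  have "degree q > 0"
  proof (rule ccontr)
    assume "\<not> degree q > 0"
    then have "q = 1" using lq by (metis degree_eq_zeroE lead_coeff_pCons(2) neq0_conv one_pCons)
    then have "coeff (irr K x) 0 = - x" by (simp add: q)
    then have "- x \<in> K" using I(1) by (metis polysD)
    then show False using x(2) sringD(3)[OF sfieldD(1)[OF K], of "- x"] by simp
  qed
  then obtain x' where x': "poly q x' = 0" using alg_closed_imp_poly_has_root by blast
  have "x' \<noteq> x"
  proof
    assume "x' = x"
    then have "[:- x, 1:] dvd q" using x' by (simp add: poly_eq_0_iff_dvd)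
    then have "[:- x, 1:] ^ 2 dvd irr K x" unfolding q power2_eq_square by (intro mult_dvd_mono) auto
    then show False using x(1) I(7) by blast
  qed
  moreover have r: "poly (irr K x) x' = 0" by (simp add: q x')
  moreover have "poly P x' = 0" if "P \<in> polys K" "poly P x = 0" for P
    using I(6)[OF that] r by (metis dvd_trans poly_eq_0_iff_dvd)
  ultimately show thesis using that[of x'] I(5) by blast
qed

section \<open>Adjunction of one element and extension of embeddings\<close>

lemma field_adjoin_props:
  "sfield (field_adjoin K S)" "K \<subseteq> field_adjoin K S" "S \<subseteq> field_adjoin K (S :: 'a::alg_closed_field set)"
  "sfield E \<Longrightarrow> K \<subseteq> E \<Longrightarrow> S \<subseteq> E \<Longrightarrow> field_adjoin K S \<subseteq> E"
  using field.generate_field_is_subfield[OF field_Dom, of "K \<union> S"] field.generate_field_min_subfield1[OF field_Dom, of "K \<union> S" E]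
  by (auto simp: subfield_Dom intro: generate_field.incl)

lemma poly_in_field_adjoin:
  assumes "P \<in> polys K" shows "poly P u \<in> field_adjoin K {u}"
proof (rule poly_in[OF sfieldD(1)[OF field_adjoin_props(1)]])
  show "P \<in> polys (field_adjoin K {u})" using assms polys_mono[OF field_adjoin_props(2)[of K "{u}"]] by blast
  show "u \<in> field_adjoin K {u}" using field_adjoin_props(3)[of "{u}" K] by blast
qed

lemma simple_extension_Dom:
  fixes K :: "'a::alg_closed_field set"
  assumes "sring K"
  shows "ring.simple_extension Dom K u = (\<lambda>P. poly P u) ` polys K" (is "?A = ?B")
proof -
  have "?A = (\<lambda>p. ring.eval Dom p u) ` carrier (univ_poly Dom K)"
    by (rule D.simple_extension_as_eval_img) auto
  also have "\<dots> = ?B"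
  proof (intro equalityI subsetI)
    fix x assume "x \<in> (\<lambda>p. ring.eval Dom p u) ` carrier (univ_poly Dom K)"
    then obtain p where p: "p \<in> carrier (univ_poly Dom K)" "x = poly (lpoly p) u" by (auto simp: eval_Dom)
    show "x \<in> ?B" unfolding p(2) by (intro imageI lpoly_props(1)[OF p(1)] assms)
  next
    fix x assume "x \<in> ?B"
    then obtain P where "P \<in> polys K" "x = poly P u" by blast
    then show "x \<in> (\<lambda>p. ring.eval Dom p u) ` carrier (univ_poly Dom K)"
      using polyl_carrier[of P K] by (intro image_eqI[of _ _ "polyl P"]) (auto simp: eval_Dom)
  qed
  finally show ?thesis .
qed

lemma simple_extension_sfield:
  fixes K :: "'a::alg_closed_field set"
  assumes "sfield K" "alg K u"
  shows "sfield ((\<lambda>P. poly P u) ` polys K)"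
proof -
  have "subfield (ring.simple_extension Dom K u) Dom"
    using D.simple_extension_is_subfield[of K u] assms by (simp add: subfield_Dom over_def algebraic_Dom sfieldD)
  then show ?thesis using assms by (simp add: subfield_Dom simple_extension_Dom sfieldD)
qed

lemma field_adjoin_alg:
  fixes K :: "'a::alg_closed_field set"
  assumes "sfield K" "alg K u"
  shows "field_adjoin K {u} = (\<lambda>P. poly P u) ` polys K" (is "?A = ?B")
proof
  note S = sringD[OF sfieldD(1)[OF assms(1)]] and PR = polys_pCons[OF sfieldD(1)[OF assms(1)]]
  have "u \<in> ?B" by (rule image_eqI[of _ _ "[:0,1:]"]) (auto simp: PR S sringD sring_polys sfieldD assms)
  moreover have "x \<in> ?B" if "x \<in> K" for x
    by (rule image_eqI[of _ _ "[:x:]"]) (auto simp: PR S sringD sring_polys sfieldD assms that)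
  ultimately show "?A \<subseteq> ?B" by (intro field_adjoin_props(4) simple_extension_sfield assms) auto
  show "?B \<subseteq> ?A"
    using poly_in_field_adjoin by blast
qed

lemma field_adjoin_fractions:
  fixes K :: "'a::alg_closed_field set"
  assumes "sfield K"
  shows "field_adjoin K {u} = {poly P u / poly Q u | P Q. P \<in> polys K \<and> Q \<in> polys K \<and> poly Q u \<noteq> 0}" (is "?A = ?B")
proof
  note R = sfieldD(1)[OF assms]
  note S = sringD[OF R] and PR = polys_pCons[OF R] note T = sringD[OF sring_polys[OF R]]
  have m: "x * y \<in> ?B \<and> x - y \<in> ?B" if xy: "x \<in> ?B" "y \<in> ?B" for x y
  proof -
    obtain P Q P1 Q1 where *: "P \<in> polys K" "Q \<in> polys K" "poly Q u \<noteq> 0" "x = poly P u / poly Q u"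
      "P1 \<in> polys K" "Q1 \<in> polys K" "poly Q1 u \<noteq> 0" "y = poly P1 u / poly Q1 u" using xy by blast
    have "x * y = poly (P * P1) u / poly (Q * Q1) u" "x - y = poly (P * Q1 - P1 * Q) u / poly (Q * Q1) u"
      unfolding *(4,8) using *(3,7) by (simp_all add: diff_frac_eq)
    moreover have "poly (Q * Q1) u \<noteq> 0" using *(3,7) by simp
    moreover have "P * P1 \<in> polys K" "P * Q1 - P1 * Q \<in> polys K" "Q * Q1 \<in> polys K"
      by (intro T *)+
    ultimately show ?thesis by blast
  qed
  have c: "x \<in> ?B" if "x \<in> K" for x
  proof -
    have "x = poly [:x:] u / poly 1 u" "poly 1 u \<noteq> 0" "[:x:] \<in> polys K" using that by (auto simp: polys_const[OF R])
    then show ?thesis using T(2) by blast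
  qed
  have i: "inverse x \<in> ?B" if x: "x \<in> ?B" for x
  proof (cases "x = 0")
    case True then show ?thesis using c[OF S(1)] by simp
  next
    case False
    obtain P Q where *: "P \<in> polys K" "Q \<in> polys K" "poly Q u \<noteq> 0" "x = poly P u / poly Q u" using x by blast
    then have "inverse x = poly Q u / poly P u" "poly P u \<noteq> 0" using False by (auto simp: inverse_divide)
    then show ?thesis using * by blast
  qed
  have "u \<in> ?B"
  proof -
    have "u = poly [:0,1:] u / poly 1 u" "poly 1 u \<noteq> 0" "[:0,1:] \<in> polys K" by (auto simp: PR S T)
    then show ?thesis using T(2) by blast
  qed
  moreover have "sfield ?B" using m i c[OF S(2)] by (simp add: sfield_def sring_def del: mem_Collect_eq)
  ultimately show "?A \<subseteq> ?B" using c by (intro field_adjoin_props(4)) auto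
  show "?B \<subseteq> ?A"
  proof
    fix x assume "x \<in> ?B"
    then obtain P Q where *: "P \<in> polys K" "Q \<in> polys K" "x = poly P u / poly Q u" by blast
    then show "x \<in> ?A" using sfieldD(3)[OF field_adjoin_props(1)] poly_in_field_adjoin by blast
  qed
qed

text \<open>The equivalence \<open>van\<close> says that the evaluations at \<open>u\<close> and
  \<open>u'\<close> have the same kernel. Hence no denominator is lost, and the local ring of
  \<open>lhom_extend\<close> contains the whole field. Transcendental and algebraic \<open>u\<close>
  are treated alike.\<close>

lemma rhom_extend_field:
  fixes E :: "'a::alg_closed_field set" and \<tau> :: "'a \<Rightarrow> 'b::field"
  assumes E: "sfield E" and h: "rhom E \<tau>"
    and van: "\<And>P. P \<in> polys E \<Longrightarrow> poly P u = 0 \<longleftrightarrow> poly (map_poly \<tau> P) u' = 0"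
  obtains \<tau>' where "rhom (field_adjoin E {u}) \<tau>'" "\<And>x. x \<in> E \<Longrightarrow> \<tau>' x = \<tau> x" "\<tau>' u = u'"
proof -
  obtain R' \<tau>' where *: "lhom R' \<tau>'" "E \<subseteq> R'" "u \<in> R'" "\<And>x. x \<in> E \<Longrightarrow> \<tau>' x = \<tau> x" "\<tau>' u = u'"
    and inv: "\<And>Q. Q \<in> polys E \<Longrightarrow> poly (map_poly \<tau> Q) u' \<noteq> 0 \<Longrightarrow> inverse (poly Q u) \<in> R'"
    by (rule lhom_extend[OF lhom_field[OF E h], of u u']) (use van in blast)+
  have rh: "rhom R' \<tau>'" using *(1) by (simp add: lhom_def)
  have "poly P u / poly Q u \<in> R'" if "P \<in> polys E" "Q \<in> polys E" "poly Q u \<noteq> 0" for P Q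
  proof -
    have "poly P u \<in> R'" using that(1) *(2,3) polys_mono[OF *(2)] by (intro poly_in rhomD(1)[OF rh]) auto
    moreover have "inverse (poly Q u) \<in> R'" using inv that van by blast
    ultimately show ?thesis using sringD(6)[OF rhomD(1)[OF rh]] by (simp add: divide_inverse)
  qed
  then have "field_adjoin E {u} \<subseteq> R'" unfolding field_adjoin_fractions[OF E] by blast
  then have "rhom (field_adjoin E {u}) \<tau>'"
    using rhom_subset[OF rh] field_adjoin_props(1) sfieldD(1) by blast
  with * that show thesis by blast
qed

text \<open>For algebraic \<open>u\<close> one implication is enough: \<open>E[u]\<close> is a
  field, so the inverse of a nonzero \<open>P(u)\<close> is some \<open>Q(u)\<close>, and the
  relation \<open>P * Q - 1\<close> is carried over to \<open>u'\<close>.\<close>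

lemma rhom_extend_alg:
  fixes E :: "'a::alg_closed_field set" and \<tau> :: "'a \<Rightarrow> 'b::field"
  assumes E: "sfield E" and h: "rhom E \<tau>" and u: "alg E u"
    and van: "\<And>P. P \<in> polys E \<Longrightarrow> poly P u = 0 \<Longrightarrow> poly (map_poly \<tau> P) u' = 0"
  obtains \<tau>' where "rhom (field_adjoin E {u}) \<tau>'" "\<And>x. x \<in> E \<Longrightarrow> \<tau>' x = \<tau> x" "\<tau>' u = u'"
proof -
  have "poly P u = 0 \<longleftrightarrow> poly (map_poly \<tau> P) u' = 0" if P: "P \<in> polys E" for P
  proof
    assume z: "poly (map_poly \<tau> P) u' = 0"
    show "poly P u = 0"
    proof (rule ccontr)
      assume nz: "poly P u \<noteq> 0"
      have "inverse (poly P u) \<in> (\<lambda>P. poly P u) ` polys E"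
        using sfieldD(2)[OF simple_extension_sfield[OF E u]] P by blast
      then obtain Q where Q: "Q \<in> polys E" "inverse (poly P u) = poly Q u" by blast
      note T = sringD[OF sring_polys[OF rhomD(1)[OF h]]] and m = rhomD[OF map_poly_rhom[OF h]]
      have "P * Q - 1 \<in> polys E" by (intro T P Q)
      moreover have "poly (P * Q - 1) u = 0" using nz by (simp flip: Q(2))
      ultimately have "poly (map_poly \<tau> (P * Q - 1)) u' = 0" by (rule van)
      then show False using z P Q T by (simp add: m)
    qed
  qed (use van P in blast)
  then show thesis using rhom_extend_field[OF E h, of u u'] that by blast
qed

subsection \<open>Galois extensions and group actions\<close>

lemma map_poly_linear_prod:
  assumes h: "rhom M \<theta>" and I: "finite I" "\<And>i. i \<in> I \<Longrightarrow> x i \<in> M"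
    and \<pi>: "bij_betw \<pi> I I" "\<And>i. i \<in> I \<Longrightarrow> \<theta> (x i) = x (\<pi> i)"
  shows "map_poly \<theta> (\<Prod>i\<in>I. [:- x i, 1:]) = (\<Prod>i\<in>I. [:- x i, 1:])"
proof -
  note R = rhomD(1)[OF h]
  have lin: "[:- x i, 1:] \<in> polys M" if "i \<in> I" for i by (rule polys_linear[OF R I(2)[OF that]])
  have "map_poly \<theta> (\<Prod>i\<in>I. [:- x i, 1:]) = (\<Prod>i\<in>I. map_poly \<theta> [:- x i, 1:])"
    by (rule rhom_prod[OF map_poly_rhom[OF h] lin])
  also have "\<dots> = (\<Prod>i\<in>I. [:- x (\<pi> i), 1:])"
    using I(2) \<pi>(2) by (intro prod.cong) (auto simp: map_linear[OF h])
  also have "\<dots> = (\<Prod>i\<in>I. [:- x i, 1:])"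
    by (rule prod.reindex_bij_betw[OF \<pi>(1)])
  finally show ?thesis .
qed

lemma linear_prod_polys:
  "sring M \<Longrightarrow> (\<And>i. i \<in> I \<Longrightarrow> x i \<in> M) \<Longrightarrow> (\<Prod>i\<in>I. [:- x i, 1:]) \<in> polys M"
  by (intro sring_prod[OF sring_polys] polys_linear)

text \<open>Lagrange's formula keeps the coefficients in the subfield \<open>M\<close>, which is
  what the later descent arguments exploit.\<close>

lemma interpolation:
  fixes x y :: "'i \<Rightarrow> 'a::field"
  assumes M: "sfield M" and I: "finite I" "I \<noteq> {}" "inj_on y I"
    and in_M: "\<And>i. i \<in> I \<Longrightarrow> x i \<in> M" "\<And>i. i \<in> I \<Longrightarrow> y i \<in> M"
  obtains h where "h \<in> polys M" "degree h < card I" "\<And>i. i \<in> I \<Longrightarrow> poly h (y i) = x i"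
proof -
  note R = sfieldD(1)[OF M]
  define l where "l i = (\<Prod>j\<in>I - {i}. [:- y j, 1:])" for i
  define c where "c i = x i / poly (l i) (y i)" for i
  define h where "h = (\<Sum>i\<in>I. smult (c i) (l i))"
  have l: "l i \<in> polys M" for i unfolding l_def by (rule linear_prod_polys[OF R]) (use in_M in auto)
  have c: "c i \<in> M" if "i \<in> I" for i
    unfolding c_def by (intro sfieldD(3)[OF M] in_M poly_in[OF R l] that)
  have li: "poly (l i) (y j) = 0 \<longleftrightarrow> i \<noteq> j" if "i \<in> I" "j \<in> I" for i j
    using that I(1,3) by (auto simp: l_def poly_prod prod_zero_iff inj_on_def)
  have "h \<in> polys M" unfolding h_def by (intro sring_sum[OF sring_polys[OF R]] polys_smult[OF R] c l)
  moreover have "degree h < card I" unfolding h_def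
  proof (rule degree_sum_less)
    fix i assume i: "i \<in> I"
    have "degree (l i) = card I - 1" unfolding l_def using i I(1)
      by (subst degree_prod_eq_sum_degree) auto
    then show "degree (smult (c i) (l i)) < card I"
      using i I(1,2) degree_smult_le[of "c i" "l i"] card_gt_0_iff[of I] by linarith
  qed (use I in \<open>simp add: card_gt_0_iff\<close>)
  moreover have "poly h (y j) = x j" if j: "j \<in> I" for j
  proof -
    have "poly h (y j) = (\<Sum>i\<in>I. if i = j then x j else 0)"
      unfolding h_def poly_sum using li j by (intro sum.cong) (auto simp: c_def)
    then show ?thesis using I(1) j by simp
  qed
  ultimately show thesis using that by blast
qed

lemma interpolation_unique:
  fixes p q :: "'a::field poly"
  assumes "finite I" "inj_on y I" "degree p < card I" "degree q < card I"
    and "\<And>i. i \<in> I \<Longrightarrow> poly p (y i) = poly q (y i)"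
  shows "p = q"
proof (rule poly_eqI_degree[of "y ` I"])
  show "poly p v = poly q v" if "v \<in> y ` I" for v using that assms(5) by auto
qed (use assms in \<open>auto simp: card_image\<close>)

text \<open>If \<open>\<theta>\<close> permutes nodes and values by the same \<open>\<pi>\<close>,
  the image of \<open>h\<close> solves the same interpolation problem as \<open>h\<close>, whose
  solution of degree below \<open>card I\<close> is unique.\<close>

lemma map_poly_interpolation:
  fixes x y :: "'i \<Rightarrow> 'a::field"
  assumes \<theta>: "rhom M \<theta>" and I: "finite I" "inj_on y I"
    and in_M: "\<And>i. i \<in> I \<Longrightarrow> y i \<in> M"
    and h: "h \<in> polys M" "degree h < card I" "\<And>i. i \<in> I \<Longrightarrow> poly h (y i) = x i"
    and \<pi>: "bij_betw \<pi> I I" "\<And>i. i \<in> I \<Longrightarrow> \<theta> (y i) = y (\<pi> i)" "\<And>i. i \<in> I \<Longrightarrow> \<theta> (x i) = x (\<pi> i)"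
  shows "map_poly \<theta> h = h"
proof (rule interpolation_unique[of I "\<lambda>i. y (\<pi> i)"])
  show "inj_on (\<lambda>i. y (\<pi> i)) I"
    using comp_inj_on[of \<pi> I y] \<pi>(1) I(2) by (auto simp: bij_betw_def comp_def)
  have "degree (map_poly \<theta> h) \<le> degree h"
    using \<theta> by (intro degree_le) (simp add: coeff_map coeff_eq_0 rhomD)
  then show "degree (map_poly \<theta> h) < card I" using h(2) by linarith
  show "poly (map_poly \<theta> h) (y (\<pi> i)) = poly h (y (\<pi> i))" if i: "i \<in> I" for i
  proof -
    have "\<pi> i \<in> I" using \<pi>(1) i by (auto simp: bij_betw_def)
    then have "poly h (y (\<pi> i)) = \<theta> (x i)" using h(3) \<pi>(3)[OF i] by simp
    also have "\<dots> = poly (map_poly \<theta> h) (\<theta> (y i))" using poly_map[OF \<theta> h(1) in_M[OF i]] h(3)[OF i] by simp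
    finally show ?thesis using \<pi>(2)[OF i] by simp
  qed
qed (use I h in auto)

text \<open>The setting of Artin's theorem: a finite group acting on the field \<open>M\<close> with
  fixed field exactly \<open>E\<close>. Faithfulness enters separately, through an element of
  \<open>M\<close> whose conjugates are all distinct.\<close>

locale galois_action = group G for G :: "('g, 'm) monoid_scheme" (structure) +
  fixes E M :: "'a::alg_closed_field set" and act :: "'g \<Rightarrow> 'a \<Rightarrow> 'a"
  assumes finite_G: "finite (carrier G)"
    and E: "sfield E" and M: "sfield M"
    and act_hom: "g \<in> carrier G \<Longrightarrow> rhom M (act g)"
    and act_closed: "g \<in> carrier G \<Longrightarrow> x \<in> M \<Longrightarrow> act g x \<in> M"
    and act_mult: "g \<in> carrier G \<Longrightarrow> h \<in> carrier G \<Longrightarrow> x \<in> M \<Longrightarrow> act (g \<otimes> h) x = act g (act h x)"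
    and act_fixed: "x \<in> E \<longleftrightarrow> x \<in> M \<and> (\<forall>g\<in>carrier G. act g x = x)"
begin

lemma E_subset: "E \<subseteq> M" using act_fixed by blast
lemma act_E: "g \<in> carrier G \<Longrightarrow> x \<in> E \<Longrightarrow> act g x = x" using act_fixed by blast
lemma act_inj: "g \<in> carrier G \<Longrightarrow> inj_on (act g) M" by (rule rhom_field_inj[OF act_hom M])

text \<open>The multiplication law makes \<open>act \<one>\<close> idempotent, and an injective
  idempotent map is the identity.\<close>

lemma act_one: "x \<in> M \<Longrightarrow> act \<one> x = x"
  using act_mult[of \<one> \<one> x] act_inj[of \<one>] act_closed[of \<one> x] by (auto simp: inj_on_def)

lemma polys_fixed:
  assumes "p \<in> polys M" "\<And>g. g \<in> carrier G \<Longrightarrow> map_poly (act g) p = p"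
  shows "p \<in> polys E"
proof (rule polysI)
  fix i
  have "act g (coeff p i) = coeff p i" if "g \<in> carrier G" for g
    using assms(2)[OF that] coeff_map[OF act_hom[OF that], of p i] by simp
  then show "coeff p i \<in> E" using polysD[OF assms(1)] by (subst act_fixed) blast
qed

lemma map_act_E: "g \<in> carrier G \<Longrightarrow> p \<in> polys E \<Longrightarrow> map_poly (act g) p = p"
  by (rule map_polys_fixed[OF act_hom act_E])

lemma linear_prod_fixed:
  assumes "finite I" "\<And>i. i \<in> I \<Longrightarrow> x i \<in> M"
    and "\<And>g. g \<in> carrier G \<Longrightarrow> \<exists>\<pi>. bij_betw \<pi> I I \<and> (\<forall>i\<in>I. act g (x i) = x (\<pi> i))"
  shows "(\<Prod>i\<in>I. [:- x i, 1:]) \<in> polys E"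
proof (rule polys_fixed)
  show "(\<Prod>i\<in>I. [:- x i, 1:]) \<in> polys M" by (intro linear_prod_polys sfieldD M assms(2))
  fix g assume g: "g \<in> carrier G"
  with assms(3) obtain \<pi> where "bij_betw \<pi> I I" "\<forall>i\<in>I. act g (x i) = x (\<pi> i)" by blast
  then show "map_poly (act g) (\<Prod>i\<in>I. [:- x i, 1:]) = (\<Prod>i\<in>I. [:- x i, 1:])"
    by (intro map_poly_linear_prod[OF act_hom[OF g] assms(1)]) (auto intro: assms(2))
qed

text \<open>\<open>S\<close> is a set, so coinciding conjugates are counted once. The polynomial has
  simple roots, which gives separability for every \<open>x\<close>;
  \<open>conjugates_polynomial\<close> is the version with multiplicities, of degree the order of
  \<open>G\<close>.\<close>

lemma orbit_polynomial:
  assumes x: "x \<in> M" defines "S \<equiv> (\<lambda>g. act g x) ` carrier G"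
  shows "finite S" "x \<in> S" "S \<subseteq> M" "(\<Prod>s\<in>S. [:- s, 1:]) \<in> polys E"
proof -
  show fin: "finite S" unfolding S_def using finite_G by simp
  show "x \<in> S" unfolding S_def using act_one[OF x] by (intro image_eqI[of _ _ \<one>]) auto
  show sub: "S \<subseteq> M" unfolding S_def using act_closed x by auto
  show "(\<Prod>s\<in>S. [:- s, 1:]) \<in> polys E"
  proof (rule linear_prod_fixed[OF fin, of "\<lambda>s. s"])
    fix g assume g: "g \<in> carrier G"
    have "act g ` S \<subseteq> S"
    proof
      fix v assume "v \<in> act g ` S"
      then obtain h where h: "h \<in> carrier G" "v = act g (act h x)" unfolding S_def by blast
      then show "v \<in> S" unfolding S_def using act_mult[OF g h(1) x] g by (intro image_eqI[of _ _ "g \<otimes> h"]) auto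
    qed
    moreover have "inj_on (act g) S" using act_inj[OF g] sub inj_on_subset by blast
    ultimately have "bij_betw (act g) S S" using fin by (simp add: bij_betw_def endo_inj_surj)
    then show "\<exists>\<pi>. bij_betw \<pi> S S \<and> (\<forall>i\<in>S. act g i = \<pi> i)" by blast
  qed (use sub in blast)
qed

lemma alg_E: "x \<in> M \<Longrightarrow> alg E x"
  using separable_overI(1)[OF E orbit_polynomial(1,2,4)] by blast

lemma separable_E: "x \<in> M \<Longrightarrow> separable_over E x"
  using separable_overI(2)[OF E orbit_polynomial(1,2,4)] by blast

lemma normal_E: "x \<in> M \<Longrightarrow> ring.is_root Dom (ring.Irr Dom E x) y \<Longrightarrow> y \<in> M"
  using separable_overI(3)[OF E orbit_polynomial(1,2,4)] orbit_polynomial(3) by blast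

text \<open>The interpolation polynomial is invariant by \<open>map_poly_interpolation\<close>. The
  index set \<open>I\<close> is independent of the acting group, which permits
  \<open>G \<times>\<times> G\<close> to act on a family indexed by \<open>G\<close>.\<close>

lemma interpolation_fixed:
  assumes I: "finite I" "I \<noteq> {}" "inj_on y I" and in_M: "\<And>i. i \<in> I \<Longrightarrow> x i \<in> M" "\<And>i. i \<in> I \<Longrightarrow> y i \<in> M"
    and \<pi>: "\<And>g. g \<in> carrier G \<Longrightarrow> \<exists>\<pi>. bij_betw \<pi> I I \<and> (\<forall>i\<in>I. act g (y i) = y (\<pi> i) \<and> act g (x i) = x (\<pi> i))"
  obtains h where "h \<in> polys E" "degree h < card I" "\<And>i. i \<in> I \<Longrightarrow> poly h (y i) = x i"
proof -
  obtain h where h: "h \<in> polys M" "degree h < card I" "\<And>i. i \<in> I \<Longrightarrow> poly h (y i) = x i"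
    by (rule interpolation[OF M I, of x]) (use in_M in auto)
  have "h \<in> polys E"
  proof (rule polys_fixed[OF h(1)])
    fix g assume g: "g \<in> carrier G"
    with \<pi> obtain \<pi> where p: "bij_betw \<pi> I I" "\<forall>i\<in>I. act g (y i) = y (\<pi> i) \<and> act g (x i) = x (\<pi> i)" by blast
    show "map_poly (act g) h = h"
      by (rule map_poly_interpolation[OF act_hom[OF g] I(1,3) _ h(1,2) _ p(1), of x]) (use p(2) h(3) in_M in auto)
  qed
  with h that show thesis by blast
qed

lemma translation_bij: "g \<in> carrier G \<Longrightarrow> bij_betw (\<lambda>h. g \<otimes> h) (carrier G) (carrier G)"
  by (intro bij_betwI[where g = "\<lambda>h. inv g \<otimes> h"]) (auto simp: m_assoc[symmetric])

lemma conjugates_polynomial: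
  assumes "x \<in> M" shows "(\<Prod>g\<in>carrier G. [:- act g x, 1:]) \<in> polys E"
proof (rule linear_prod_fixed[OF finite_G act_closed[OF _ assms]])
  fix g assume g: "g \<in> carrier G"
  show "\<exists>\<pi>. bij_betw \<pi> (carrier G) (carrier G) \<and> (\<forall>i\<in>carrier G. act g (act i x) = act (\<pi> i) x)"
    using translation_bij[OF g] act_mult[OF g _ assms] by (intro exI[of _ "\<lambda>h. g \<otimes> h"]) auto
qed

lemma primitive_polynomial:
  assumes w: "w \<in> M" "inj_on (\<lambda>g. act g w) (carrier G)" and x: "x \<in> M"
  obtains h where "h \<in> polys E" "degree h < card (carrier G)" "\<And>g. g \<in> carrier G \<Longrightarrow> act g x = poly h (act g w)"
proof (rule interpolation_fixed[OF finite_G _ w(2), of "\<lambda>g. act g x"])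
  fix g assume g: "g \<in> carrier G"
  show "\<exists>\<pi>. bij_betw \<pi> (carrier G) (carrier G) \<and>
    (\<forall>i\<in>carrier G. act g (act i w) = act (\<pi> i) w \<and> act g (act i x) = act (\<pi> i) x)"
    using translation_bij[OF g] act_mult[OF g _ w(1)] act_mult[OF g _ x] by (intro exI[of _ "\<lambda>h. g \<otimes> h"]) auto
qed (use w(1) x act_closed that in auto)

text \<open>Applying the action to the relation produces one root for each group element, more roots
  than the degree allows.\<close>

lemma primitive_degree:
  assumes w: "w \<in> M" "inj_on (\<lambda>g. act g w) (carrier G)"
    and p: "p \<in> polys E" "degree p < card (carrier G)" "poly p w = 0"
  shows "p = 0"
proof (rule interpolation_unique[OF finite_G w(2) p(2)])
  show "poly p (act g w) = poly 0 (act g w)" if g: "g \<in> carrier G" for g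
    using rhom_poly_fixed[OF act_hom[OF g] E_subset w(1) act_E[OF g] p(1)] p(3) rhomD(3)[OF act_hom[OF g]] by simp
qed (use p in auto)

text \<open>For each pair of distinct group elements some element of \<open>M\<close> tells them
  apart. These elements are the coefficients of \<open>P\<close>, and \<open>P(c)\<close> is
  primitive unless \<open>c\<close> is a root of one of finitely many nonzero differences of
  conjugates of \<open>P\<close>.\<close>

lemma primitive_exists:
  assumes inf: "infinite E" and faithful: "\<And>g h. g \<in> carrier G \<Longrightarrow> h \<in> carrier G \<Longrightarrow> g \<noteq> h \<Longrightarrow> \<exists>x\<in>M. act g x \<noteq> act h x"
  obtains w where "w \<in> M" "inj_on (\<lambda>g. act g w) (carrier G)"
proof -
  define D where "D = {(g, h). g \<in> carrier G \<and> h \<in> carrier G \<and> g \<noteq> h}"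
  have finD: "finite D" by (rule finite_subset[of _ "carrier G \<times> carrier G"]) (auto simp: D_def finite_G)
  define x where "x d = (SOME x. x \<in> M \<and> act (fst d) x \<noteq> act (snd d) x)" for d
  have x: "x d \<in> M" "act (fst d) (x d) \<noteq> act (snd d) (x d)" if "d \<in> D" for d
  proof -
    have "\<exists>x. x \<in> M \<and> act (fst d) x \<noteq> act (snd d) x" using that faithful unfolding D_def by (cases d) auto
    from someI_ex[OF this] show "x d \<in> M" "act (fst d) (x d) \<noteq> act (snd d) (x d)" unfolding x_def by auto
  qed
  obtain ds where ds: "set ds = D" using finite_list[OF finD] by blast
  define P where "P = Poly (map x ds)"
  have cP: "coeff P i \<in> insert 0 (x ` D)" for i
    by (auto simp: P_def nth_default_def ds[symmetric])
  have P: "P \<in> polys M"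
  proof (rule polysI)
    fix i show "coeff P i \<in> M" using cP[of i] x(1) sringD(1)[OF sfieldD(1)[OF M]] by auto
  qed
  define bad where "bad d = {c. poly (map_poly (act (fst d)) P - map_poly (act (snd d)) P) c = 0}" for d
  have "finite (bad d)" if d: "d \<in> D" for d
    unfolding bad_def
  proof (rule poly_roots_finite)
    have gh: "fst d \<in> carrier G" "snd d \<in> carrier G" using d by (auto simp: D_def)
    obtain i where i: "i < length ds" "ds ! i = d" using d ds by (metis in_set_conv_nth)
    then have "coeff P i = x d" by (simp add: P_def nth_default_def)
    then have "coeff (map_poly (act (fst d)) P - map_poly (act (snd d)) P) i \<noteq> 0"
      using x(2)[OF d] gh by (simp add: coeff_map[OF act_hom])
    then show "map_poly (act (fst d)) P - map_poly (act (snd d)) P \<noteq> 0" by (metis coeff_0)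
  qed
  then have "finite (\<Union>d\<in>D. bad d)" using finD by blast
  then obtain c where c: "c \<in> E" "c \<notin> (\<Union>d\<in>D. bad d)" using inf by (meson finite_subset subsetI)
  then have cM: "c \<in> M" using E_subset by blast
  have "poly P c \<in> M" by (rule poly_in[OF sfieldD(1)[OF M] P cM])
  moreover have "inj_on (\<lambda>g. act g (poly P c)) (carrier G)"
  proof (rule inj_onI, rule ccontr)
    fix g h assume gh: "g \<in> carrier G" "h \<in> carrier G" "act g (poly P c) = act h (poly P c)" "g \<noteq> h"
    have ev: "act g (poly P c) = poly (map_poly (act g) P) c" if "g \<in> carrier G" for g
      using poly_map[OF act_hom[OF that] P cM] act_E[OF that c(1)] by simp
    have "c \<in> bad (g, h)" using gh ev by (simp add: bad_def)
    moreover have "(g, h) \<in> D" using gh by (simp add: D_def)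
    ultimately show False using c(2) by blast
  qed
  ultimately show thesis using that by blast
qed

end

text \<open>The target is algebraically closed, so the image of the minimal polynomial of each new
  generator has a root there.\<close>

lemma rhom_extend_list:
  fixes E :: "'a::alg_closed_field set" and \<tau> :: "'a \<Rightarrow> 'b::alg_closed_field"
  assumes "sfield E" "rhom E \<tau>" "\<And>x. x \<in> set xs \<Longrightarrow> alg E x"
  shows "\<exists>E' \<tau>'. sfield E' \<and> rhom E' \<tau>' \<and> E \<subseteq> E' \<and> set xs \<subseteq> E' \<and> (\<forall>x\<in>E. \<tau>' x = \<tau> x)"
  using assms
proof (induction xs arbitrary: E \<tau>)
  case Nil then show ?case by auto
next
  case (Cons u xs)
  note h = Cons.prems(2)
  have u: "alg E u" using Cons.prems(3) by simp
  note I = irr_props[OF Cons.prems(1) u]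
  have "degree (irr E u) > 0"
  proof (rule ccontr)
    assume "\<not> degree (irr E u) > 0"
    then obtain a where "irr E u = [:a:]" using degree_eq_zeroE by blast
    then show False using I(2,3) by simp
  qed
  then have "degree (map_poly \<tau> (irr E u)) > 0" using map_monic[OF h I(2)] by simp
  then obtain u' where u': "poly (map_poly \<tau> (irr E u)) u' = 0" using alg_closed_imp_poly_has_root by blast
  have min: "r = 0" if "r \<in> polys E" "degree r < degree (irr E u)" "poly r u = 0" for r
    using I(6)[OF that(1,3)] that(2) dvd_imp_degree_le[of "irr E u" r] by (meson leD)
  obtain \<tau>' where t: "rhom (field_adjoin E {u}) \<tau>'" "\<And>x. x \<in> E \<Longrightarrow> \<tau>' x = \<tau> x"
    by (rule rhom_extend_alg[OF Cons.prems(1) h u, of u'])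
       (use minimal_vanishing[OF h I(1-3) u' min] in blast)+
  have "alg (field_adjoin E {u}) x" if "x \<in> set xs" for x
    using Cons.prems(3)[of x] that alg_mono[OF field_adjoin_props(2)[of E "{u}"]] by simp
  from Cons.IH[OF field_adjoin_props(1) t(1) this]
  obtain E' \<tau>'' where "sfield E'" "rhom E' \<tau>''" "field_adjoin E {u} \<subseteq> E'" "set xs \<subseteq> E'"
    "\<forall>x\<in>field_adjoin E {u}. \<tau>'' x = \<tau>' x" by blast
  moreover have "E \<subseteq> field_adjoin E {u}" "u \<in> field_adjoin E {u}"
    using field_adjoin_props(2,3)[of E "{u}"] field_adjoin_props(3)[of "{u}" E] by blast+
  ultimately have "E \<subseteq> E'" "set (u # xs) \<subseteq> E'" "\<forall>x\<in>E. \<tau>'' x = \<tau> x"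
    using t(2) by (auto simp: subset_iff)
  then show ?case using \<open>sfield E'\<close> \<open>rhom E' \<tau>''\<close> by blast
qed

section \<open>Galois groups and group actions\<close>

lemma galois_group_carrier:
  fixes K L :: "'a::alg_closed_field set"
  assumes L: "sring L"
  shows "\<sigma> \<in> carrier (galois_group K L) \<longleftrightarrow>
    \<sigma> \<in> extensional L \<and> bij_betw \<sigma> L L \<and> rhom L \<sigma> \<and> (\<forall>x\<in>K. \<sigma> x = x)"
proof -
  note S = sringD[OF L]
  have "\<sigma> \<in> ring_hom (Dom\<lparr>carrier := L\<rparr>) (Dom\<lparr>carrier := L\<rparr>) \<longleftrightarrow>
      \<sigma> ` L \<subseteq> L \<and> \<sigma> 1 = 1 \<and> (\<forall>x\<in>L. \<forall>y\<in>L. \<sigma> (x * y) = \<sigma> x * \<sigma> y \<and> \<sigma> (x + y) = \<sigma> x + \<sigma> y)"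
    by (auto simp: ring_hom_def ring_of_type_algebra_def)
  moreover have "rhom L \<sigma> \<longleftrightarrow>
    \<sigma> 1 = 1 \<and> (\<forall>x\<in>L. \<forall>y\<in>L. \<sigma> (x * y) = \<sigma> x * \<sigma> y \<and> \<sigma> (x + y) = \<sigma> x + \<sigma> y)" (is "_ \<longleftrightarrow> ?R")
  proof
    assume "rhom L \<sigma>" then show ?R by (simp add: rhomD)
  next
    assume R: ?R
    have "\<sigma> (x - y) = \<sigma> x - \<sigma> y" if "x \<in> L" "y \<in> L" for x y
    proof -
      have "\<sigma> (x - y + y) = \<sigma> (x - y) + \<sigma> y" using R that S(5) by blast
      then show ?thesis by (simp add: algebra_simps)
    qed
    then show "rhom L \<sigma>" using R L by (simp add: rhom_def)
  qed
  ultimately show ?thesis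
    by (auto simp: galois_group_def Bij_def bij_betw_def)
qed

lemma galois_group_mult:
  assumes "sring L" "\<sigma> \<in> carrier (galois_group K L)" "\<rho> \<in> carrier (galois_group K L)"
  shows "\<sigma> \<otimes>\<^bsub>galois_group K L\<^esub> \<rho> = compose L \<sigma> \<rho>"
  using assms by (simp add: galois_group_def BijGroup_def)

text \<open>An embedding sending \<open>x\<close> to another conjugate is extended to generators of
  \<open>L\<close> with values anywhere in the universal domain; normality then forces the image of
  \<open>L\<close> back into \<open>L\<close>.\<close>

lemma galois_group_moves:
  fixes K L :: "'a::alg_closed_field set"
  assumes gal: "finite_galois_extension K L" and x: "x \<in> L" "x \<notin> K"
  obtains \<sigma> where "\<sigma> \<in> carrier (galois_group K L)" "\<sigma> x \<noteq> x"
proof -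
  have K: "sfield K" and L: "sfield L" and KL: "K \<subseteq> L" and sep: "\<And>v. v \<in> L \<Longrightarrow> separable_over K v"
    and nrm: "\<And>v y. v \<in> L \<Longrightarrow> ring.is_root Dom (ring.Irr Dom K v) y \<Longrightarrow> y \<in> L"
    and fd: "ring.finite_dimension Dom K L"
    using gal unfolding finite_galois_extension_def separable_algebraic_extension_def normal_extension_def
      field_extension_def subfield_Dom by auto
  have alg: "alg K v" if "v \<in> L" for v
    using sep[OF that] algebraic_Dom[OF sfieldD(1)[OF K]] by (simp add: separable_over_def)
  obtain x' where x': "x' \<noteq> x" "\<And>P. P \<in> polys K \<Longrightarrow> poly P x = 0 \<Longrightarrow> poly P x' = 0"
    using separable_conjugate[OF K sep[OF x(1)] x(2)] by blast
  have idK: "rhom K (\<lambda>x. x)" by (rule rhom_id[OF sfieldD(1)[OF K]])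
  have "map_poly (\<lambda>x. x) P = P" for P :: "'a poly" by (rule map_poly_fixed) auto
  then obtain \<tau> where \<tau>: "rhom (field_adjoin K {x}) \<tau>" "\<And>v. v \<in> K \<Longrightarrow> \<tau> v = v" "\<tau> x = x'"
    using rhom_extend_alg[OF K idK alg[OF x(1)], of x'] x'(2) by metis
  \<comment> \<open>Finite dimension provides a finite list \<open>Vs\<close> of generators.\<close>
  obtain n where "ring.dimension Dom n K L" using fd unfolding D.finite_dimension_def by blast
  then obtain Vs where Vs: "ring.independent Dom K Vs" "ring.Span Dom K Vs = L"
    using D.exists_base[of K n L] K by (auto simp: subfield_Dom)
  have VsL: "set Vs \<subseteq> L"
    using D.Span_base_incl[of K Vs] K Vs by (simp add: subfield_Dom)
  have "alg (field_adjoin K {x}) v" if "v \<in> set Vs" for v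
    using alg_mono[OF field_adjoin_props(2) alg] VsL that by blast
  then obtain E' \<tau>' where E': "sfield E'" "rhom E' \<tau>'" "field_adjoin K {x} \<subseteq> E'" "set Vs \<subseteq> E'"
    "\<forall>v\<in>field_adjoin K {x}. \<tau>' v = \<tau> v"
    using rhom_extend_list[OF field_adjoin_props(1) \<tau>(1)] by blast
  have KE: "K \<subseteq> E'" and xE: "x \<in> field_adjoin K {x}"
    using E'(3) field_adjoin_props(2)[of K "{x}"] field_adjoin_props(3)[of "{x}" K] by auto
  have fix': "\<tau>' v = v" if "v \<in> K" for v
    using \<tau>(2)[OF that] E'(5) field_adjoin_props(2)[of K "{x}"] that by auto
  have LE: "L \<subseteq> E'"
  proof
    fix v assume "v \<in> L"
    then obtain ks where "set ks \<subseteq> K" "v = ring.combine Dom ks Vs"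
      using D.Span_eq_combine_set[of K Vs] K Vs(2) by (auto simp: subfield_Dom)
    moreover have "ring.combine Dom ks us \<in> E'" if "set ks \<subseteq> E'" "set us \<subseteq> E'" for ks us
      using that by (induction ks us rule: D.combine.induct) (auto simp: sringD[OF sfieldD(1)[OF E'(1)]])
    ultimately show "v \<in> E'" using KE E'(4) by blast
  qed
  have root: "poly P (\<tau>' v) = 0" if "P \<in> polys K" "v \<in> L" "poly P v = 0" for P v
    using rhom_poly_fixed[OF E'(2) KE _ fix' that(1), of v] that(2,3) LE rhomD(3)[OF E'(2)] by auto
  have inL: "y \<in> L" if "v \<in> L" "poly (irr K v) y = 0" for v y
    using nrm[OF that(1)] that(2) irr_props(5)[OF K alg[OF that(1)]] by blast
  have cl: "\<tau>' v \<in> L" if v: "v \<in> L" for v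
    by (rule inL[OF v root[OF irr_props(1)[OF K alg[OF v]] v irr_props(3)[OF K alg[OF v]]]])
  have inj: "inj_on \<tau>' L" using rhom_field_inj[OF E'(2,1)] LE inj_on_subset by blast
  \<comment> \<open>Surjectivity: the injective map permutes the finite root set of each minimal
    polynomial.\<close>
  have "L \<subseteq> \<tau>' ` L"
  proof
    fix v assume v: "v \<in> L"
    note I = irr_props[OF K alg[OF v]]
    define S where "S = {y. poly (irr K v) y = 0}"
    have "finite S" unfolding S_def by (rule poly_roots_finite[OF I(4)])
    moreover have S: "S \<subseteq> L" unfolding S_def using inL[OF v] by blast
    moreover have "\<tau>' ` S \<subseteq> S" using root[OF I(1)] S unfolding S_def by blast
    ultimately have "\<tau>' ` S = S" using inj by (meson endo_inj_surj inj_on_subset)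
    moreover have "v \<in> S" using I(3) by (simp add: S_def)
    ultimately show "v \<in> \<tau>' ` L" using S by blast
  qed
  then have bij: "bij_betw \<tau>' L L" using inj cl by (auto simp: bij_betw_def)
  have "restrict \<tau>' L \<in> carrier (galois_group K L)"
    unfolding galois_group_carrier[OF sfieldD(1)[OF L]]
  proof (intro conjI)
    show "bij_betw (restrict \<tau>' L) L L" using bij by (subst bij_betw_cong[of L _ \<tau>']) auto
    show "rhom L (restrict \<tau>' L)"
      by (rule rhom_cong[OF rhom_subset[OF E'(2) sfieldD(1)[OF L] LE]]) simp
    show "\<forall>v\<in>K. restrict \<tau>' L v = v" using fix' KL by auto
  qed simp
  moreover have "restrict \<tau>' L x \<noteq> x" using x(1) E'(5) xE \<tau>(3) x'(1) by auto
  ultimately show thesis by (rule that)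
qed

lemma galois_action_of_extension:
  fixes G :: "('g, 'm) monoid_scheme"
  assumes G: "group G" "finite (carrier G)" and gal: "finite_galois_extension K L" and iso: "G \<cong> galois_group K L"
  obtains act where "galois_action G K L act"
    "\<And>g h. g \<in> carrier G \<Longrightarrow> h \<in> carrier G \<Longrightarrow> g \<noteq> h \<Longrightarrow> \<exists>x\<in>L. act g x \<noteq> act h x"
proof -
  have K: "sfield K" and L: "sfield L" and KL: "K \<subseteq> L"
    using gal unfolding finite_galois_extension_def separable_algebraic_extension_def
      field_extension_def subfield_Dom by auto
  obtain \<phi> where \<phi>: "\<phi> \<in> hom G (galois_group K L)" "bij_betw \<phi> (carrier G) (carrier (galois_group K L))"
    using iso unfolding is_iso_def iso_def by blast
  note car = galois_group_carrier[OF sfieldD(1)[OF L], of _ K]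
  have p: "\<phi> g \<in> carrier (galois_group K L)" if "g \<in> carrier G" for g
    using \<phi>(1) that by (auto simp: hom_def)
  have "galois_action G K L \<phi>"
  proof (intro galois_action.intro galois_action_axioms.intro)
    fix g assume g: "g \<in> carrier G"
    show "rhom L (\<phi> g)" using p[OF g] car by blast
    show "\<phi> g x \<in> L" if "x \<in> L" for x using p[OF g] car that by (auto simp: bij_betw_def)
    show "\<phi> (g \<otimes>\<^bsub>G\<^esub> h) x = \<phi> g (\<phi> h x)" if "h \<in> carrier G" "x \<in> L" for h x
      using hom_mult[OF \<phi>(1) g that(1)] galois_group_mult[OF sfieldD(1)[OF L] p[OF g] p[OF that(1)]] that(2)
      by (simp add: compose_def)
  next
    fix x
    show "x \<in> K \<longleftrightarrow> x \<in> L \<and> (\<forall>g\<in>carrier G. \<phi> g x = x)"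
    proof
      assume "x \<in> K" then show "x \<in> L \<and> (\<forall>g\<in>carrier G. \<phi> g x = x)" using KL p car by blast
    next
      assume x: "x \<in> L \<and> (\<forall>g\<in>carrier G. \<phi> g x = x)"
      show "x \<in> K"
      proof (rule ccontr)
        assume "x \<notin> K"
        then obtain \<sigma> where "\<sigma> \<in> carrier (galois_group K L)" "\<sigma> x \<noteq> x" using galois_group_moves[OF gal] x by blast
        moreover from this obtain g where "g \<in> carrier G" "\<sigma> = \<phi> g" using \<phi>(2) unfolding bij_betw_def by blast
        ultimately show False using x by blast
      qed
    qed
  qed (use G K L in auto)
  moreover have "\<exists>x\<in>L. \<phi> g x \<noteq> \<phi> h x" if gh: "g \<in> carrier G" "h \<in> carrier G" "g \<noteq> h" for g h
  proof (rule ccontr)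
    assume "\<not> (\<exists>x\<in>L. \<phi> g x \<noteq> \<phi> h x)"
    then have "\<phi> g = \<phi> h" using p[OF gh(1)] p[OF gh(2)] car by (intro extensionalityI[of _ L]) auto
    then show False using gh \<phi>(2) by (auto simp: bij_betw_def inj_on_def)
  qed
  ultimately show thesis by (rule that)
qed

text \<open>Artin's theorem. Since \<open>M\<close> is generated by \<open>w\<close>, an
  automorphism over \<open>E\<close> is determined by the image of \<open>w\<close>, and this image
  is a root of the polynomial with roots \<open>act g w\<close>.\<close>

lemma (in galois_action) extension_of_action:
  assumes w: "w \<in> M" "inj_on (\<lambda>g. act g w) (carrier G)"
  shows "finite_galois_extension E M" "G \<cong> galois_group E M"
proof -
  have M_eq: "M = (\<lambda>P. poly P w) ` polys E"
  proof
    show "M \<subseteq> (\<lambda>P. poly P w) ` polys E"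
    proof
      fix x assume x: "x \<in> M"
      obtain h where "h \<in> polys E" "\<And>g. g \<in> carrier G \<Longrightarrow> act g x = poly h (act g w)"
        using primitive_polynomial[OF w x] by blast
      from this(1) this(2)[OF one_closed] show "x \<in> (\<lambda>P. poly P w) ` polys E" using act_one x w(1) by auto
    qed
    show "(\<lambda>P. poly P w) ` polys E \<subseteq> M"
      using poly_in[OF sfieldD(1)[OF M] _ w(1)] polys_mono[OF E_subset] by blast
  qed
  have "ring.finite_dimension Dom E (ring.simple_extension Dom E w)"
    using D.finite_dimension_simple_extension[of E w] alg_E[OF w(1)] E
    by (simp add: subfield_Dom over_def algebraic_Dom sfieldD)
  then have "ring.finite_dimension Dom E M" using M_eq E by (simp add: simple_extension_Dom sfieldD)
  then show "finite_galois_extension E M"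
    unfolding finite_galois_extension_def separable_algebraic_extension_def normal_extension_def
      field_extension_def subfield_Dom
    using E M E_subset separable_E normal_E alg_E algebraic_Dom[OF sfieldD(1)[OF E]] by blast
  note car = galois_group_carrier[OF sfieldD(1)[OF M], of _ E]
  define \<phi> where "\<phi> g = restrict (act g) M" for g
  have p: "\<phi> g \<in> carrier (galois_group E M)" if g: "g \<in> carrier G" for g
    unfolding car
  proof (intro conjI)
    have "act g (act (inv g) x) = x" if "x \<in> M" for x
      using act_mult[of g "inv g" x] act_one that g by simp
    then have "M \<subseteq> act g ` M" using act_closed[of "inv g"] g by (metis image_eqI inv_closed subsetI)
    then have "bij_betw (act g) M M" using act_inj[OF g] act_closed[OF g] by (auto simp: bij_betw_def)
    then show "bij_betw (\<phi> g) M M" unfolding \<phi>_def by (subst bij_betw_cong[of M _ "act g"]) auto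
    show "rhom M (\<phi> g)" unfolding \<phi>_def by (rule rhom_cong[OF act_hom[OF g]]) simp
    show "\<forall>x\<in>E. \<phi> g x = x" unfolding \<phi>_def using act_E[OF g] E_subset by auto
  qed (simp add: \<phi>_def)
  have "\<phi> \<in> hom G (galois_group E M)"
  proof (rule homI)
    fix g h assume g: "g \<in> carrier G" and h: "h \<in> carrier G"
    show "\<phi> (g \<otimes> h) = \<phi> g \<otimes>\<^bsub>galois_group E M\<^esub> \<phi> h"
      unfolding galois_group_mult[OF sfieldD(1)[OF M] p[OF g] p[OF h]]
      using act_mult[OF g h] act_closed[OF h] by (auto simp: \<phi>_def compose_def)
  qed (rule p)
  moreover have "bij_betw \<phi> (carrier G) (carrier (galois_group E M))"
  proof (rule bij_betwI')
    fix g h assume gh: "g \<in> carrier G" "h \<in> carrier G"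
    show "\<phi> g = \<phi> h \<longleftrightarrow> g = h"
    proof
      assume "\<phi> g = \<phi> h"
      then have "\<phi> g w = \<phi> h w" by simp
      then show "g = h" using w gh by (auto simp: \<phi>_def inj_on_def)
    qed simp
  next
    fix \<sigma> assume "\<sigma> \<in> carrier (galois_group E M)"
    then have s: "\<sigma> \<in> extensional M" "bij_betw \<sigma> M M" "rhom M \<sigma>" "\<forall>x\<in>E. \<sigma> x = x" unfolding car by auto
    have ev: "\<sigma> (poly P w) = poly P (\<sigma> w)" if P: "P \<in> polys E" for P
      by (rule rhom_poly_fixed[OF s(3) E_subset w(1) _ P]) (use s(4) in blast)
    have "poly (\<Prod>g\<in>carrier G. [:- act g w, 1:]) w = 0"
      using finite_G act_one[OF w(1)] by (auto simp: poly_prod prod_zero_iff intro!: bexI[of _ \<one>])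
    then have "poly (\<Prod>g\<in>carrier G. [:- act g w, 1:]) (\<sigma> w) = 0"
      using ev[OF conjugates_polynomial[OF w(1)]] rhomD(3)[OF s(3)] by simp
    then obtain g where g: "g \<in> carrier G" "\<sigma> w = act g w" using finite_G by (auto simp: poly_prod prod_zero_iff)
    have "\<sigma> x = \<phi> g x" if x: "x \<in> M" for x
    proof -
      obtain P where P: "P \<in> polys E" "x = poly P w" using x M_eq by blast
      have "act g x = poly P (act g w)"
        unfolding P(2) by (rule rhom_poly_fixed[OF act_hom[OF g(1)] E_subset w(1) act_E[OF g(1)] P(1)])
      then show ?thesis using ev[OF P(1)] P(2) g(2) x by (simp add: \<phi>_def)
    qed
    then have "\<sigma> = \<phi> g" using s(1) by (intro extensionalityI[of _ M]) (auto simp: \<phi>_def)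
    then show "\<exists>g\<in>carrier G. \<sigma> = \<phi> g" using g by blast
  qed (use p in auto)
  ultimately show "G \<cong> galois_group E M" by (auto simp: is_iso_def iso_def)
qed

section \<open>Relative algebraic closure and linear disjointness\<close>

lemma sfield_algebraics:
  fixes K :: "'a::alg_closed_field set"
  assumes "sfield K" shows "sfield {x. alg K x}" "K \<subseteq> {x. alg K x}"
proof -
  have "{x \<in> carrier Dom. (ring.algebraic Dom over K) x} = {x. alg K x}"
    using algebraic_Dom[OF sfieldD(1)[OF assms]] by (simp add: over_def)
  then show "sfield {x. alg K x}"
    using field.subfield_of_algebraics[OF field_Dom, of K] assms by (simp add: subfield_Dom)
  show "K \<subseteq> {x. alg K x}" using alg_self[OF sfieldD(1)[OF assms]] by blast
qed

text \<open>The coefficients of \<open>p\<close> generate a finite extension of \<open>K\<close>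
  over which \<open>x\<close> is algebraic, and finite dimension is transitive.\<close>

lemma alg_trans:
  fixes K :: "'a::alg_closed_field set"
  assumes K: "sfield K" and x: "alg {x. alg K x} x" shows "alg K x"
proof -
  obtain p where p: "p \<in> polys {x. alg K x}" "p \<noteq> 0" "poly p x = 0" using x unfolding alg_def by blast
  define cs where "cs = coeffs p"
  have cs: "alg K c" if "c \<in> set cs" for c using that polysD[OF p(1)] by (auto simp: cs_def coeffs_def split: if_splits)
  have Kf: "subfield K Dom" using K by (simp add: subfield_Dom)
  have cs': "(ring.algebraic Dom over K) c" if "c \<in> set cs" for c
    using cs[OF that] algebraic_Dom[OF sfieldD(1)[OF K]] by (simp add: over_def)
  define E where "E = ring.finite_extension Dom K cs"
  have E: "subfield E Dom" "ring.finite_dimension Dom K E" "set cs \<subseteq> E"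
    unfolding E_def using D.finite_extension_is_subfield[OF Kf _ cs'] D.finite_extension_finite_dimension(1)[OF Kf _ cs']
      D.finite_extension_mem[OF subfieldE(1)[OF Kf], of cs] by auto
  have Es: "sfield E" using E(1) by (simp add: subfield_Dom)
  have "coeff p i \<in> E" for i
    using E(3) sringD(1)[OF sfieldD(1)[OF Es]] coeff_in_coeffs[OF p(2), of i]
    by (cases "i \<le> degree p") (auto simp: cs_def coeff_eq_0)
  then have "alg E x" using p by (intro algI[of p] polysI) auto
  then have aE: "(ring.algebraic Dom over E) x" using algebraic_Dom[OF sfieldD(1)[OF Es]] by (simp add: over_def)
  have "ring.finite_dimension Dom E (ring.simple_extension Dom E x)"
    using D.finite_dimension_simple_extension[OF E(1), of x] aE by simp
  then have "ring.finite_dimension Dom K (ring.simple_extension Dom E x)"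
    using D.telescopic_base_dim(1)[OF Kf E(1,2)] by blast
  moreover have "subring (ring.simple_extension Dom E x) Dom"
    using D.simple_extension_is_subring[OF subfieldE(1)[OF E(1)], of x] by simp
  moreover have "x \<in> ring.simple_extension Dom E x"
    using D.simple_extension_mem[OF subfieldE(1)[OF E(1)], of x] by simp
  ultimately have "(ring.algebraic Dom over K) x" using D.finite_dimension_imp_algebraic[OF Kf] by blast
  then show "alg K x" using algebraic_Dom[OF sfieldD(1)[OF K]] by (simp add: over_def)
qed

lemma combine_Dom:
  "length ks = length us \<Longrightarrow> ring.combine Dom ks us = (\<Sum>i<length us. ks ! i * (us ! i :: 'a::alg_closed_field))"
  by (induction ks us rule: list_induct2) (auto simp: sum.lessThan_Suc_shift simp del: sum.lessThan_Suc)

lemma combine_truncate: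
  "ring.combine Dom ks us = (\<Sum>i<length us. (if i < length ks then ks ! i else 0) * (us ! i :: 'a::alg_closed_field))"
  by (induction ks us rule: D.combine.induct)
    (auto simp: sum.lessThan_Suc_shift simp del: sum.lessThan_Suc intro!: sum.cong)

text \<open>Restates linear disjointness for indexed families: \<open>ind\<close> is independence
  over \<open>K\<close>, the conclusion is independence over \<open>C\<close>. The index set will be
  a set of exponent pairs of monomials.\<close>

lemma linearly_disjoint_family:
  fixes v :: "'i \<Rightarrow> 'a::alg_closed_field"
  assumes disj: "linearly_disjoint K F C" and K: "sfield K" and C: "sfield C"
    and I: "finite I" "v ` I \<subseteq> F"
    and ind: "\<And>c. c ` I \<subseteq> K \<Longrightarrow> (\<Sum>i\<in>I. c i * v i) = 0 \<Longrightarrow> \<forall>i\<in>I. c i = 0"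
    and c: "c ` I \<subseteq> C" "(\<Sum>i\<in>I. c i * v i) = 0" "i \<in> I"
  shows "c i = 0"
proof -
  obtain xs where xs: "set xs = I" "distinct xs" using finite_distinct_list[OF I(1)] by blast
  have reindex: "(\<Sum>j<length xs. f (xs ! j)) = sum f I" for f :: "'i \<Rightarrow> 'a"
    using xs sum.reindex_bij_betw[OF bij_betw_nth[OF xs(2) refl xs(1)[symmetric]], of f] by (simp add: lessThan_atLeast0)
  have "ring.independent Dom K (map v xs)"
  proof (rule D.trivial_combine_imp_independent)
    show "subfield K Dom" using K by (simp add: subfield_Dom)
    fix ks assume ks: "set ks \<subseteq> K" "ring.combine Dom ks (map v xs) = ring.zero Dom"
    \<comment> \<open>The criterion for independence admits coefficient lists of any length; missing
      coefficients count as 0, as in \<open>combine_truncate\<close>.\<close>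
    define e where "e j = (if j < length ks then ks ! j else 0)" for j
    define d where "d x = e (THE j. j < length xs \<and> xs ! j = x)" for x
    have d: "d (xs ! j) = e j" if "j < length xs" for j
      unfolding d_def by (rule arg_cong[of _ _ e], rule the_equality)
        (use that xs(2) nth_eq_iff_index_eq in auto)
    have eK: "e j \<in> K" for j using ks(1) sringD(1)[OF sfieldD(1)[OF K]] by (auto simp: e_def)
    have "(\<Sum>i\<in>I. d i * v i) = (\<Sum>j<length xs. e j * v (xs ! j))"
      unfolding reindex[symmetric] by (intro sum.cong) (auto simp: d)
    also have "\<dots> = 0" using ks(2) by (simp add: combine_truncate e_def)
    finally have "\<forall>i\<in>I. d i = 0" using eK by (intro ind) (auto simp: d_def)
    then have "e j = 0" if "j < length xs" for j using d[OF that] that xs(1) by fastforce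
    then have "ks ! j = 0" if "j < length xs" "j < length ks" for j using that(2) e_def[of j] that(1) by simp
    then show "set (take (length (map v xs)) ks) \<subseteq> {ring.zero Dom}"
      by (auto simp: in_set_conv_nth)
  qed simp
  then have ind': "ring.independent Dom C (map v xs)"
    using disj I(2) xs(1) unfolding linearly_disjoint_def by auto
  have C': "subfield C Dom" using C by (simp add: subfield_Dom)
  have "ring.combine Dom (map c xs) (map v xs) = (\<Sum>j<length xs. c (xs ! j) * v (xs ! j))"
    by (subst combine_Dom) auto
  then have "ring.combine Dom (map c xs) (map v xs) = ring.zero Dom"
    using c(2) reindex[of "\<lambda>i. c i * v i"] by simp
  moreover have "set (map c xs) \<subseteq> C" using c(1) xs(1) by auto
  ultimately have "set (take (length (map v xs)) (map c xs)) \<subseteq> {ring.zero Dom}"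
    using D.independent_imp_trivial_combine[OF C' ind'] by blast
  then show ?thesis using c(3) xs(1) by auto
qed

subsection \<open>Plane curves\<close>

text \<open>In \<open>P(T, Y)\<close> the inner variable of the polynomial is \<open>T\<close>, and \<open>spec a P\<close> is \<open>P(a, Y)\<close>.\<close>

abbreviation spec :: "'a::comm_ring_1 \<Rightarrow> 'a poly poly \<Rightarrow> 'a poly" where
  "spec a \<equiv> map_poly (\<lambda>p. poly p a)"

lemma rhom_eval: "rhom UNIV (\<lambda>p. poly p (a::'a::comm_ring_1))"
  by (simp add: rhom_def sring_UNIV)

lemma rhom_spec: "rhom UNIV (spec a)"
  using map_poly_rhom[OF rhom_eval, of a] by simp

lemmas spec_simps = rhomD(2-)[OF rhom_spec, simplified]

lemma coeff_spec: "coeff (spec a P) i = poly (coeff P i) a"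
  by (rule coeff_map[OF rhom_eval])

lemma spec_smult: "spec a (smult c P) = smult (poly c a) (spec a P)"
  by (rule poly_eqI) (simp add: coeff_spec)

lemma spec_pCons: "spec a (pCons p P) = pCons (poly p a) (spec a P)"
  by (rule map_pCons[OF rhom_eval])

lemma spec_monic: "lead_coeff F = 1 \<Longrightarrow> degree (spec a F) = degree F" "lead_coeff F = 1 \<Longrightarrow> lead_coeff (spec a F) = 1"
  using map_monic[OF rhom_eval, of F a] by blast+

lemma spec_in: "sring R \<Longrightarrow> P \<in> polys (polys R) \<Longrightarrow> a \<in> R \<Longrightarrow> spec a P \<in> polys R"
  by (intro polysI) (simp add: coeff_spec poly_in polysD)

lemma degree_spec_le: "degree (spec a P) \<le> degree P"
  by (intro degree_le) (simp add: coeff_spec coeff_eq_0)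

lemma poly_spec_sum: "poly (spec a P) b = (\<Sum>i\<le>degree P. poly (coeff P i) a * b ^ i)"
proof -
  have "poly (spec a P) b = (\<Sum>i\<le>degree (spec a P). coeff (spec a P) i * b ^ i)" by (rule poly_altdef)
  also have "\<dots> = (\<Sum>i\<le>degree P. coeff (spec a P) i * b ^ i)"
    by (intro sum.mono_neutral_left) (use degree_spec_le[of a P] in \<open>auto simp: coeff_eq_0\<close>)
  finally show ?thesis by (simp add: coeff_spec)
qed

lemma poly_spec_reflect:
  fixes b :: "'a::field"
  assumes "b \<noteq> 0"
  shows "poly (spec a (reflect_poly P)) b = b ^ degree P * poly (spec a P) (inverse b)"
proof -
  let ?n = "degree P"
  have "poly (spec a (reflect_poly P)) b = (\<Sum>i\<le>degree (reflect_poly P). poly (coeff (reflect_poly P) i) a * b ^ i)"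
    by (rule poly_spec_sum)
  also have "\<dots> = (\<Sum>i\<le>?n. poly (coeff (reflect_poly P) i) a * b ^ i)"
    by (intro sum.mono_neutral_left) (use degree_reflect_poly_le[of P] in \<open>auto simp: coeff_eq_0\<close>)
  also have "\<dots> = (\<Sum>i\<le>?n. poly (coeff P (?n - i)) a * b ^ i)"
    by (intro sum.cong) (auto simp: coeff_reflect_poly)
  also have "\<dots> = (\<Sum>i\<le>?n. poly (coeff P i) a * b ^ (?n - i))"
    by (rule sum.reindex_bij_witness[of _ "\<lambda>i. ?n - i" "\<lambda>i. ?n - i"]) auto
  also have "\<dots> = (\<Sum>i\<le>?n. b ^ ?n * (poly (coeff P i) a * inverse b ^ i))"
    using assms by (intro sum.cong) (auto simp: power_diff field_simps)
  finally show ?thesis by (simp add: poly_spec_sum sum_distrib_left)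
qed

lemma reflect_polys: "sring R \<Longrightarrow> P \<in> polys R \<Longrightarrow> reflect_poly P \<in> polys R"
  by (intro polysI) (auto simp: coeff_reflect_poly sringD polysD)

text \<open>Reversing coefficients is multiplicative, and an involution where the constant
  coefficient is nonzero, so a factorization of \<open>reflect_poly F\<close> is carried to one of
  \<open>F\<close>. The leading coefficient 1 of \<open>F\<close> makes the constant coefficients of
  both factors nonzero. Irreducible elements are prime because \<open>'a poly poly\<close> has
  unique factorization, which the sort of \<open>'a\<close> ensures.\<close>

lemma prime_reflect:
  fixes F :: "'a::{alg_closed_field, factorial_ring_gcd, semiring_gcd_mult_normalize} poly poly"
  assumes "irreducible F" "coeff F 0 \<noteq> 0" "lead_coeff F = 1" "degree F > 0"
  shows "prime_elem (reflect_poly F)"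
proof (rule irreducible_imp_prime_elem, rule irreducibleI)
  show "reflect_poly F \<noteq> 0" using assms(2) by auto
  have "degree (reflect_poly F) > 0" using assms(2,4) by simp
  then show "\<not> is_unit (reflect_poly F)"
    by (metis is_unit_polyE degree_pCons_0 less_irrefl)
  fix A B assume AB: "reflect_poly F = A * B"
  have "coeff A 0 * coeff B 0 = 1" using arg_cong[OF AB, of "\<lambda>p. coeff p 0"] assms(3) by (simp add: coeff_mult)
  then have nz: "coeff A 0 \<noteq> 0" "coeff B 0 \<noteq> 0" by auto
  have "F = reflect_poly A * reflect_poly B"
    using AB assms(2) by (metis reflect_poly_mult reflect_poly_reflect_poly)
  then have "is_unit (reflect_poly A) \<or> is_unit (reflect_poly B)" using assms(1) by (simp add: irreducible_def)
  moreover have "is_unit Y" if Y: "is_unit (reflect_poly Y)" "coeff Y 0 \<noteq> 0" for Y :: "'a poly poly"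
  proof -
    obtain c where "reflect_poly Y = [:c:]" using is_unit_polyE[OF Y(1)] by blast
    then have "Y = [:c:]" using reflect_poly_reflect_poly[OF Y(2)] by simp
    then show ?thesis using Y(1) by simp
  qed
  ultimately show "is_unit A \<or> is_unit B" using nz by blast
qed

text \<open>An element of least degree in the ideal \<open>(g, P)\<close> divides \<open>g\<close> and \<open>P\<close> up to leading coefficients.
  If \<open>g\<close> does not divide \<open>P\<close>, then it is constant in the second variable and vanishes at infinitely
  many values of the first.\<close>

lemma vanishing_imp_dvd:
  fixes g P :: "'a::field poly poly"
  assumes g: "prime_elem g" "degree g > 0"
    and inf: "infinite {a. \<exists>b. poly (spec a g) b = 0}"
    and P: "\<And>a b. poly (spec a g) b = 0 \<Longrightarrow> poly (spec a P) b = 0"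
  shows "g dvd P"
proof -
  define I where "I = {h. h \<noteq> 0 \<and> (\<exists>A B. h = g * A + P * B)}"
  have "g = g * 1 + P * 0" "g \<noteq> 0" using g by auto
  then have "g \<in> I" unfolding I_def by blast
  then obtain h where h: "h \<in> I" "\<And>h'. h' \<in> I \<Longrightarrow> degree h \<le> degree h'"
    using arg_min_natI[of "\<lambda>h. h \<in> I" g degree] arg_min_nat_le[of "\<lambda>h. h \<in> I" _ degree] by blast
  obtain A B where hAB: "h = g * A + P * B" and h0: "h \<noteq> 0" using h(1) unfolding I_def by blast
  have div: "\<exists>k q. smult (lead_coeff h ^ k) Y = h * q" if Y: "Y = g * A' + P * B'" for Y A' B'
  proof -
    obtain k q r where r: "smult (lead_coeff h ^ k) Y = h * q + r" "r = 0 \<or> degree r < degree h"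
      using pseudo_division[OF sring_UNIV _ h0, of Y] by auto
    have "r = g * (smult (lead_coeff h ^ k) A' - A * q) + P * (smult (lead_coeff h ^ k) B' - B * q)"
      using r(1) unfolding Y hAB by (simp add: algebra_simps smult_add_right)
    then have "r = 0" using r(2) h(2)[of r] unfolding I_def by (metis (mono_tags, lifting) leD mem_Collect_eq)
    then show ?thesis using r(1) by auto
  qed
  have lc: "lead_coeff h ^ k \<noteq> 0" for k using h0 by simp
  have ndvd: "\<not> g dvd [:c:]" if "c \<noteq> 0" for c
    using dvd_imp_degree_le[of g "[:c:]"] that g(2) by auto
  obtain k q where kq: "smult (lead_coeff h ^ k) g = h * q" using div[of g 1 0] by auto
  obtain m q' where mq: "smult (lead_coeff h ^ m) P = h * q'" using div[of P 0 1] by auto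
  have "g dvd h * q" unfolding kq[symmetric] by (simp add: dvd_smult)
  then have "g dvd h \<or> g dvd q" using prime_elem_dvd_multD[OF g(1)] by blast
  then show ?thesis
  proof
    assume "g dvd h"
    then have "g dvd smult (lead_coeff h ^ m) P" unfolding mq by simp
    then have "g dvd [:lead_coeff h ^ m:] * P" by simp
    then show ?thesis using prime_elem_dvd_multD[OF g(1)] ndvd[OF lc] by blast
  next
    assume "g dvd q"
    then obtain s where s: "q = g * s" by (rule dvdE)
    have "g * [:lead_coeff h ^ k:] = g * (h * s)" using kq unfolding s by (simp add: algebra_simps)
    then have "[:lead_coeff h ^ k:] = h * s" using g by (subst (asm) mult_left_cancel) auto
    then have "degree (h * s) = 0" "h * s \<noteq> 0" using lc by (metis degree_pCons_0, metis pCons_eq_0_iff)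
    then have "degree h = 0" by (simp add: degree_mult_eq)
    then obtain e where e: "h = [:e:]" using degree_eq_zeroE by blast
    have "poly e a = 0" if ab: "poly (spec a g) b = 0" for a b
    proof -
      have "poly (spec a h) b = 0" unfolding hAB using ab P[OF ab] by (simp add: spec_simps)
      then show ?thesis by (simp add: e spec_pCons spec_simps)
    qed
    then have "e = 0" using poly_zero_on_infinite[OF inf, of e] by blast
    then show ?thesis using h0 e by simp
  qed
qed

section \<open>Multivariate polynomials, and those in one or two variables\<close>

definition mmon :: "(nat \<Rightarrow>\<^sub>0 nat) \<Rightarrow> (nat \<Rightarrow> 'a::comm_ring_1) \<Rightarrow> 'a" where
  "mmon m x = (\<Prod>i\<in>Poly_Mapping.keys m. x i ^ Poly_Mapping.lookup m i)"

lemma mmon_superset: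
  assumes "finite A" "Poly_Mapping.keys m \<subseteq> A" shows "mmon m x = (\<Prod>i\<in>A. x i ^ Poly_Mapping.lookup m i)"
  unfolding mmon_def by (intro prod.mono_neutral_left) (use assms in \<open>auto simp: in_keys_iff\<close>)

lemma mmon_add: "mmon (m + m') x = mmon m x * mmon m' x"
proof -
  let ?A = "Poly_Mapping.keys m \<union> Poly_Mapping.keys m'"
  have "mmon (m + m') x = (\<Prod>i\<in>?A. x i ^ Poly_Mapping.lookup (m + m') i)"
    by (rule mmon_superset) (use keys_add[of m m'] in auto)
  also have "\<dots> = mmon m x * mmon m' x"
    by (simp add: mmon_superset[of ?A m] mmon_superset[of ?A m'] lookup_add power_add prod.distrib)
  finally show ?thesis .
qed

lemma mpol_eval_superset:
  assumes "finite A" "Poly_Mapping.keys p \<subseteq> A"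
  shows "mpol_eval p x = (\<Sum>m\<in>A. Poly_Mapping.lookup p m * mmon m x)"
  unfolding mpol_eval_def mmon_def by (intro sum.mono_neutral_left) (use assms in \<open>auto simp: in_keys_iff\<close>)

lemma mpol_eval_add: "mpol_eval (p + q) x = mpol_eval p x + mpol_eval q x"
proof -
  let ?A = "Poly_Mapping.keys p \<union> Poly_Mapping.keys q"
  have "mpol_eval (p + q) x = (\<Sum>m\<in>?A. Poly_Mapping.lookup (p + q) m * mmon m x)"
    by (rule mpol_eval_superset) (use keys_add[of p q] in auto)
  then show ?thesis
    by (simp add: mpol_eval_superset[of ?A p] mpol_eval_superset[of ?A q] lookup_add sum.distrib distrib_right)
qed

lemma mpol_eval_single: "mpol_eval (Poly_Mapping.single m c) x = c * mmon m x"
  by (subst mpol_eval_superset[of "{m}"]) auto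

lemma mpol_eval_0 [simp]: "mpol_eval 0 x = 0" by (simp add: mpol_eval_def)

lemma mpol_eval_sum: "mpol_eval (sum f I) x = (\<Sum>i\<in>I. mpol_eval (f i) x)"
  by (induction I rule: infinite_finite_induct) (auto simp: mpol_eval_add)

lemma mpol_sum_single: "(\<Sum>m\<in>Poly_Mapping.keys p. Poly_Mapping.single m (Poly_Mapping.lookup p m)) = p"
proof (rule poly_mapping_eqI)
  fix k
  have "(\<Sum>m\<in>Poly_Mapping.keys p. Poly_Mapping.lookup (Poly_Mapping.single m (Poly_Mapping.lookup p m)) k) =
      (\<Sum>m\<in>Poly_Mapping.keys p. if m = k then Poly_Mapping.lookup p k else 0)"
    by (intro sum.cong) (auto simp: lookup_single when_def)
  then show "Poly_Mapping.lookup (\<Sum>m\<in>Poly_Mapping.keys p. Poly_Mapping.single m (Poly_Mapping.lookup p m)) k = Poly_Mapping.lookup p k"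
    by (simp add: lookup_sum in_keys_iff)
qed

lemma mpol_mult:
  "p * q = (\<Sum>m\<in>Poly_Mapping.keys p. \<Sum>m'\<in>Poly_Mapping.keys q.
     Poly_Mapping.single (m + m') (Poly_Mapping.lookup p m * Poly_Mapping.lookup q m'))" for p q :: "'a::comm_ring_1 mpol"
proof -
  have "p * q = (\<Sum>m\<in>Poly_Mapping.keys p. Poly_Mapping.single m (Poly_Mapping.lookup p m)) *
    (\<Sum>m\<in>Poly_Mapping.keys q. Poly_Mapping.single m (Poly_Mapping.lookup q m))" by (simp add: mpol_sum_single)
  then show ?thesis by (simp add: sum_product mult_single)
qed

lemma mpol_eval_mult: "mpol_eval (p * q) x = mpol_eval p x * mpol_eval q x"
proof -
  have "mpol_eval (p * q) x = (\<Sum>m\<in>Poly_Mapping.keys p. \<Sum>m'\<in>Poly_Mapping.keys q.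
     (Poly_Mapping.lookup p m * mmon m x) * (Poly_Mapping.lookup q m' * mmon m' x))"
    by (subst mpol_mult) (simp add: mpol_eval_sum mpol_eval_single mmon_add algebra_simps)
  then show ?thesis
    by (simp add: sum_product[symmetric] mpol_eval_superset[of "Poly_Mapping.keys p" p] mpol_eval_superset[of "Poly_Mapping.keys q" q])
qed

lemma sring_mpols:
  assumes K: "sring (K :: 'a::comm_ring_1 set)" shows "sring (mpols K n)"
proof -
  note S = sringD[OF K]
  have look: "Poly_Mapping.lookup p m \<in> K" if "p \<in> mpols K n" for p m
    using that S(1) by (cases "m \<in> Poly_Mapping.keys p") (auto simp: mpols_def in_keys_iff)
  have ky: "Poly_Mapping.keys m \<subseteq> {..<n}" if "p \<in> mpols K n" "Poly_Mapping.lookup p m \<noteq> 0" for p m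
    using that by (auto simp: mpols_def in_keys_iff)
  have I: "p \<in> mpols K n" if "\<And>m. Poly_Mapping.lookup p m \<in> K" "\<And>m. Poly_Mapping.lookup p m \<noteq> 0 \<Longrightarrow> Poly_Mapping.keys m \<subseteq> {..<n}" for p
    using that by (auto simp: mpols_def in_keys_iff)
  have plus: "p + q \<in> mpols K n" if "p \<in> mpols K n" "q \<in> mpols K n" for p q
  proof (rule I)
    show "Poly_Mapping.lookup (p + q) m \<in> K" for m using look that S by (simp add: lookup_add)
    show "Poly_Mapping.keys m \<subseteq> {..<n}" if "Poly_Mapping.lookup (p + q) m \<noteq> 0" for m
    proof -
      have "Poly_Mapping.lookup p m \<noteq> 0 \<or> Poly_Mapping.lookup q m \<noteq> 0" using that by (auto simp: lookup_add)
      then show ?thesis using ky[of p m] ky[of q m] \<open>p \<in> mpols K n\<close> \<open>q \<in> mpols K n\<close> by blast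
    qed
  qed
  have sum: "sum f A \<in> mpols K n" if "\<And>i. i \<in> A \<Longrightarrow> f i \<in> mpols K n" for f :: "'i \<Rightarrow> 'a mpol" and A
    using that
  proof (induction A rule: infinite_finite_induct)
    case (insert x F) then show ?case using plus by simp
  qed (simp_all add: mpols_def)
  have single: "Poly_Mapping.single m c \<in> mpols K n" if "c \<in> K" "Poly_Mapping.keys m \<subseteq> {..<n}" for m c
    using that S(1) by (auto simp: mpols_def lookup_single when_def split: if_splits)
  have one: "(1::'a mpol) \<in> mpols K n" using single[of 1 0] S(2) by simp
  have mult: "p * q \<in> mpols K n" if pq: "p \<in> mpols K n" "q \<in> mpols K n" for p q
    unfolding mpol_mult
  proof (intro sum single)
    fix m m' assume m: "m \<in> Poly_Mapping.keys p" "m' \<in> Poly_Mapping.keys q"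
    show "Poly_Mapping.lookup p m * Poly_Mapping.lookup q m' \<in> K" by (intro S(6) look pq)
    show "Poly_Mapping.keys (m + m') \<subseteq> {..<n}" using keys_add[of m m'] m pq by (auto simp: mpols_def)
  qed
  have "p - q \<in> mpols K n" if pq: "p \<in> mpols K n" "q \<in> mpols K n" for p q
  proof -
    have "- (1::'a) \<in> K" by (intro S(2,3))
    then have "Poly_Mapping.single 0 (- 1) \<in> mpols K n" by (intro single) auto
    then have "p + Poly_Mapping.single 0 (- 1) * q \<in> mpols K n" using plus mult pq by blast
    moreover have "Poly_Mapping.single 0 (- 1) = (- 1 :: 'a mpol)" by (simp add: single_uminus)
    ultimately show ?thesis by simp
  qed
  with one mult show ?thesis unfolding sring_def by blast
qed

abbreviation mconst :: "'a::comm_ring_1 \<Rightarrow> 'a mpol" where "mconst c \<equiv> Poly_Mapping.single 0 c"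
abbreviation mvar :: "nat \<Rightarrow> 'a::comm_ring_1 mpol" where "mvar i \<equiv> Poly_Mapping.single (Poly_Mapping.single i (Suc 0)) 1"

lemma rhom_mconst: "rhom UNIV (mconst :: 'a::comm_ring_1 \<Rightarrow> 'a mpol)"
  by (simp add: rhom_def sring_UNIV single_diff mult_single)

text \<open>Composing the homomorphisms \<open>map_poly mconst\<close> and evaluation at
  \<open>mvar 0\<close> makes this a ring homomorphism without any computation with
  monomials.\<close>

definition mpol1 :: "'a::comm_ring_1 poly \<Rightarrow> 'a mpol" where
  "mpol1 p = poly (map_poly mconst p) (mvar 0)"

lemma rhom_mpol1: "rhom UNIV mpol1"
  using rhom_comp[OF map_poly_rhom[OF rhom_mconst] rhom_eval] unfolding mpol1_def by simp

lemma mpol1_pCons: "mpol1 (pCons a p) = mconst a + mvar 0 * mpol1 p"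
  by (simp add: mpol1_def map_pCons[OF rhom_mconst])

text \<open>The inner variable becomes \<open>mvar 0\<close> and the outer one
  \<open>mvar 1\<close>, so evaluation at a point is \<open>spec\<close> at its first coordinate
  followed by \<open>poly\<close> at its second.\<close>

definition mpol2 :: "'a::comm_ring_1 poly poly \<Rightarrow> 'a mpol" where
  "mpol2 p = poly (map_poly mpol1 p) (mvar 1)"

lemma rhom_mpol2: "rhom UNIV mpol2"
  using rhom_comp[OF map_poly_rhom[OF rhom_mpol1] rhom_eval] unfolding mpol2_def by simp

lemma mpol2_pCons: "mpol2 (pCons a p) = mpol1 a + mvar 1 * mpol2 p"
  by (simp add: mpol2_def map_pCons[OF rhom_mpol1])

lemma mpol12_0 [simp]: "mpol1 0 = 0" "mpol2 0 = 0"
  using rhomD(3)[OF rhom_mpol1] rhomD(3)[OF rhom_mpol2] by auto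

lemma mmon_var: "mmon (Poly_Mapping.single i (Suc 0)) x = x i" by (simp add: mmon_def)
lemma mmon_0 [simp]: "mmon 0 x = 1" by (simp add: mmon_def)

lemma eval_mpol1: "mpol_eval (mpol1 p) x = poly p (x 0)"
  by (induction p) (simp_all add: mpol1_pCons mpol_eval_add mpol_eval_mult mpol_eval_single mmon_var)

lemma eval_mpol2: "mpol_eval (mpol2 P) x = poly (spec (x 0) P) (x 1)"
  by (induction P)
    (simp_all add: mpol2_pCons mpol_eval_add mpol_eval_mult mpol_eval_single mmon_var eval_mpol1 spec_pCons spec_simps)

lemma mconst_in: "sring K \<Longrightarrow> a \<in> K \<Longrightarrow> mconst a \<in> mpols K n"
  by (auto simp: mpols_def lookup_single when_def)

lemma mvar_in: "sring K \<Longrightarrow> i < n \<Longrightarrow> mvar i \<in> mpols K n"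
  by (auto simp: mpols_def lookup_single when_def sringD)

lemma mpol1_in: "sring K \<Longrightarrow> p \<in> polys K \<Longrightarrow> 0 < n \<Longrightarrow> mpol1 p \<in> mpols K n"
  by (induction p) (auto simp: mpol1_pCons polys_pCons mconst_in mvar_in intro!: sringD(1,4,6) sring_mpols)

lemma mpol2_in: "sring K \<Longrightarrow> P \<in> polys (polys K) \<Longrightarrow> 1 < n \<Longrightarrow> mpol2 P \<in> mpols K n"
  by (induction P) (auto simp: mpol2_pCons polys_pCons sring_polys mpol1_in mvar_in intro!: sringD(1,4,6) sring_mpols)

lemma mvar_power: "mvar i ^ k = Poly_Mapping.single (Poly_Mapping.single i k) (1::'a::comm_ring_1)"
  by (induction k) (simp_all add: mult_single flip: single_add)

lemma mpol1_monom: "mpol1 (monom a i) = Poly_Mapping.single (Poly_Mapping.single 0 i) a"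
  by (simp add: mpol1_def map_poly_monom poly_monom mvar_power mult_single)

lemma mpol2_monom: "mpol2 (monom (monom a i) j) = Poly_Mapping.single (Poly_Mapping.single 0 i + Poly_Mapping.single 1 j) a"
  by (simp add: mpol2_def map_poly_monom poly_monom mvar_power mult_single mpol1_monom del: One_nat_def)

lemma mpols1E:
  assumes K: "sring K" and p: "p \<in> mpols K 1"
  obtains P where "P \<in> polys K" "p = mpol1 P"
proof -
  define P where "P = (\<Sum>m\<in>Poly_Mapping.keys p. monom (Poly_Mapping.lookup p m) (Poly_Mapping.lookup m 0))"
  have m: "m = Poly_Mapping.single 0 (Poly_Mapping.lookup m 0)" if "m \<in> Poly_Mapping.keys p" for m
  proof (rule poly_mapping_eqI)
    fix k
    have "Poly_Mapping.keys m \<subseteq> {..<1}" using p that by (auto simp: mpols_def)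
    then have "Poly_Mapping.lookup m k = 0" if "k \<noteq> 0" using that by (auto simp: in_keys_iff subset_iff)
    then show "Poly_Mapping.lookup m k = Poly_Mapping.lookup (Poly_Mapping.single 0 (Poly_Mapping.lookup m 0)) k"
      by (auto simp: lookup_single when_def)
  qed
  have "mpol1 P = (\<Sum>m\<in>Poly_Mapping.keys p. Poly_Mapping.single (Poly_Mapping.single 0 (Poly_Mapping.lookup m 0)) (Poly_Mapping.lookup p m))"
    unfolding P_def by (subst rhom_sum[OF rhom_mpol1]) (simp_all add: mpol1_monom)
  also have "\<dots> = (\<Sum>m\<in>Poly_Mapping.keys p. Poly_Mapping.single m (Poly_Mapping.lookup p m))"
    by (intro sum.cong refl) (simp only: m[symmetric])
  also have "\<dots> = p" by (rule mpol_sum_single)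
  finally have "p = mpol1 P" ..
  moreover have "P \<in> polys K" unfolding P_def
    by (intro sring_sum[OF sring_polys[OF K]] polys_monom[OF K]) (use p in \<open>auto simp: mpols_def\<close>)
  ultimately show thesis using that by blast
qed

lemma mpols2E:
  assumes K: "sring K" and p: "p \<in> mpols K 2"
  obtains P where "P \<in> polys (polys K)" "p = mpol2 P"
proof -
  define P where "P = (\<Sum>m\<in>Poly_Mapping.keys p. monom (monom (Poly_Mapping.lookup p m) (Poly_Mapping.lookup m 0)) (Poly_Mapping.lookup m 1))"
  have m: "Poly_Mapping.single 0 (Poly_Mapping.lookup m 0) + Poly_Mapping.single 1 (Poly_Mapping.lookup m 1) = m" if "m \<in> Poly_Mapping.keys p" for m
  proof (rule poly_mapping_eqI)
    fix k
    have "Poly_Mapping.keys m \<subseteq> {..<2}" using p that by (auto simp: mpols_def)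
    then have "Poly_Mapping.lookup m k = 0" if "k \<noteq> 0" "k \<noteq> 1" using that by (auto simp: in_keys_iff subset_iff)
    then show "Poly_Mapping.lookup (Poly_Mapping.single 0 (Poly_Mapping.lookup m 0) + Poly_Mapping.single 1 (Poly_Mapping.lookup m 1)) k = Poly_Mapping.lookup m k"
      by (auto simp: lookup_single when_def lookup_add)
  qed
  have "mpol2 P = (\<Sum>m\<in>Poly_Mapping.keys p. Poly_Mapping.single (Poly_Mapping.single 0 (Poly_Mapping.lookup m 0) + Poly_Mapping.single 1 (Poly_Mapping.lookup m 1)) (Poly_Mapping.lookup p m))"
    unfolding P_def by (subst rhom_sum[OF rhom_mpol2]) (simp_all add: mpol2_monom del: One_nat_def)
  also have "\<dots> = (\<Sum>m\<in>Poly_Mapping.keys p. Poly_Mapping.single m (Poly_Mapping.lookup p m))"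
    by (intro sum.cong refl) (simp only: m)
  also have "\<dots> = p" by (rule mpol_sum_single)
  finally have "p = mpol2 P" ..
  moreover have "P \<in> polys (polys K)" unfolding P_def
    by (intro sring_sum[OF sring_polys[OF sring_polys[OF K]]] polys_monom[OF sring_polys[OF K]] polys_monom[OF K]) (use p in \<open>auto simp: mpols_def\<close>)
  ultimately show thesis using that by blast
qed

text \<open>Points of \<open>affine_space\<close> are undefined outside the index range, hence the
  restricted function.\<close>

definition pt :: "'a \<Rightarrow> 'a \<Rightarrow> nat \<Rightarrow> 'a" where
  "pt a b = (\<lambda>i\<in>{..<2}. if i = 0 then a else b)"

lemma pt_simps [simp]: "pt a b 0 = a" "pt a b (Suc 0) = b" "pt a b 1 = b"
  by (simp_all add: pt_def)

lemma pt_image: "pt a b ` {..<2} = {a, b}"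
proof -
  have "{..<2::nat} = {0, 1}" by auto
  then show ?thesis by simp
qed

lemma pt_in: "pt a b \<in> affine_space 2 K \<longleftrightarrow> a \<in> K \<and> b \<in> K"
proof -
  have "pt a b \<in> extensional {..<2}" by (simp add: pt_def)
  then have "pt a b \<in> affine_space 2 K \<longleftrightarrow> pt a b ` {..<2} \<subseteq> K"
    unfolding affine_space_def PiE_iff by blast
  then show ?thesis by (simp add: pt_image)
qed

lemma affine_plane_cases:
  assumes "v \<in> affine_space 2 K" obtains a b where "v = pt a b"
proof
  have ext: "v \<in> extensional {..<2}" using assms unfolding affine_space_def PiE_iff by blast
  show "v = pt (v 0) (v 1)"
  proof (rule extensionalityI[OF ext])
    show "pt (v 0) (v 1) \<in> extensional {..<2}" by (simp add: pt_def)
    fix i :: nat assume "i \<in> {..<2}"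
    then consider "i = 0" | "i = 1" by fastforce
    then show "v i = pt (v 0) (v 1) i" by cases simp_all
  qed
qed

lemma mpol_eval_1 [simp]: "mpol_eval 1 x = 1"
  using mpol_eval_single[of 0 1 x] by simp

lemma mpol_eval_mvar [simp]: "mpol_eval (mvar i) x = x i"
  by (simp add: mpol_eval_single mmon_var)

lemma mpol_eval_diff: "mpol_eval (p - q) x = mpol_eval p x - mpol_eval q x"
  using mpol_eval_add[of "p - q" q x] by simp

text \<open>The curve is given by \<open>g(T, Y) = Y\<^sup>n F(T, 1/Y)\<close>, with generic point \<open>(t, 1/u)\<close>.  As \<open>d\<close> divides all
  coefficients of \<open>F\<close> but the leading one, \<open>g(a, Y) = 1\<close> whenever \<open>d(a) = 0\<close>, so that the curve has no
  points over the zeros of \<open>d\<close>.\<close>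

lemma PAC_curve_point:
  fixes K0 K :: "'a::{alg_closed_field, factorial_ring_gcd, semiring_gcd_mult_normalize} set"
  assumes pac: "PAC_extension K0 K" and t: "\<not> alg K t"
    and F: "F \<in> polys (polys K)" "lead_coeff F = 1" "degree F > 0" "poly (spec t F) u = 0" "irreducible F" and u: "u \<noteq> 0"
    and min: "\<And>r. r \<in> polys (polys K) \<Longrightarrow> degree r < degree F \<Longrightarrow> poly (spec t r) u = 0 \<Longrightarrow> r = 0"
    and d: "\<And>i. i < degree F \<Longrightarrow> d dvd coeff F i"
    and sep: "separable_algebraic_extension (field_adjoin K {t}) (field_adjoin K {t, u})"
  obtains a b where "a \<in> K0" "b \<in> K" "poly d a \<noteq> 0" "poly (spec a F) b = 0"
proof -
  have K: "sfield K" using pac unfolding PAC_extension_def field_extension_def subfield_Dom by blast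
  note R = sfieldD(1)[OF K] note PR = sring_polys[OF R]
  define g where "g = reflect_poly F"
  have gK: "g \<in> polys (polys K)" unfolding g_def by (rule reflect_polys[OF PR F(1)])
  \<comment> \<open>If the constant coefficient were zero, \<open>F\<close> could be divided by its
    outer variable, and as \<open>u\<close> is nonzero the quotient would be a relation of smaller
    degree.\<close>
  have F0: "coeff F 0 \<noteq> 0"
  proof
    assume z: "coeff F 0 = 0"
    obtain c F' where c: "F = pCons c F'" by (cases F)
    then have F': "F = pCons 0 F'" using z by simp
    have "F' \<noteq> 0" using F(3) F' by auto
    then have "degree F' < degree F" using F' by simp
    moreover have "F' \<in> polys (polys K)" using F(1) F' polys_pCons[OF PR] by blast
    moreover have "poly (spec t F') u = 0" using F(4) u by (simp add: F' spec_pCons)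
    ultimately show False using min \<open>F' \<noteq> 0\<close> by blast
  qed
  have g0: "poly (spec a g) 0 = 1" for a
    using F(2) by (simp add: poly_0_coeff_0 coeff_spec g_def)
  have Vchar: "poly (spec a g) b = 0 \<longleftrightarrow> b \<noteq> 0 \<and> poly (spec a F) (inverse b) = 0" for a b
    using g0[of a] poly_spec_reflect[of b a F] by (cases "b = 0") (auto simp: g_def)
  have dnz: "poly d a \<noteq> 0" if r: "poly (spec a F) c = 0" "c \<noteq> 0" for a c
  proof
    assume z: "poly d a = 0"
    have "poly (coeff F i) a = 0" if "i < degree F" for i
      using d[OF that] z by (metis dvd_trans poly_eq_0_iff_dvd)
    then have "poly (spec a F) c = (\<Sum>i\<in>{degree F}. poly (coeff F i) a * c ^ i)"
      unfolding poly_spec_sum by (intro sum.mono_neutral_right) auto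
    then show False using r F(2) by simp
  qed
  have pg: "prime_elem g" unfolding g_def by (rule prime_reflect[OF F(5) F0 F(2,3)])
  have dg: "degree g > 0" using F(3) F0 by (simp add: g_def)
  define A where "A = {a. \<exists>b. poly (spec a g) b = 0}"
  \<comment> \<open>Away from the zeros of \<open>coeff F 0\<close>, every root of
    \<open>spec a F\<close> is nonzero and its reciprocal is a point over \<open>a\<close>.\<close>
  have "\<exists>b. poly (spec a g) b = 0" if a: "poly (coeff F 0) a \<noteq> 0" for a
  proof -
    have "degree (spec a F) > 0" using spec_monic[OF F(2)] F(3) by simp
    then obtain c where c: "poly (spec a F) c = 0" using alg_closed_imp_poly_has_root by blast
    have "c \<noteq> 0" using c a by (auto simp: poly_0_coeff_0 coeff_spec)
    then have "poly (spec a g) (inverse c) = 0" using c by (simp add: Vchar)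
    then show ?thesis by blast
  qed
  then have "UNIV - {a. poly (coeff F 0) a = 0} \<subseteq> A" unfolding A_def by blast
  moreover have "infinite (UNIV - {a. poly (coeff F 0) a = 0})"
    using poly_roots_finite[OF F0] infinite_alg_closed by (rule Diff_infinite_finite)
  ultimately have infA: "infinite A" using finite_subset by blast
  have dvdI: "g dvd P" if "\<And>a b. poly (spec a g) b = 0 \<Longrightarrow> poly (spec a P) b = 0" for P
    by (rule vanishing_imp_dvd[OF pg dg infA[unfolded A_def] that])
  define y where "y = inverse u"
  have gty: "poly (spec t g) y = 0" using u F(4) by (simp add: Vchar y_def)
  \<comment> \<open>Genericity of the point is checked through \<open>F\<close> and
    \<open>u\<close>: since \<open>F\<close> is monic, a reversed relation can be reduced modulo
    \<open>F\<close>, and its remainder vanishes by \<open>min\<close>.\<close>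
  have gen: "poly (spec a P) b = 0" if P: "P \<in> polys (polys K)" "poly (spec t P) y = 0" and ab: "poly (spec a g) b = 0" for P a b
  proof -
    have z: "poly (spec t (reflect_poly P)) u = 0" using poly_spec_reflect[OF u, of t P] P(2) by (simp add: y_def)
    obtain q r where qr: "q \<in> polys (polys K)" "r \<in> polys (polys K)" "reflect_poly P = F * q + r" "r = 0 \<or> degree r < degree F"
      using monic_division[OF PR F(1,2) reflect_polys[OF PR P(1)]] by blast
    have "poly (spec t r) u = 0" using z F(4) by (simp add: qr(3) spec_simps)
    then have "r = 0" using qr(2,4) min by blast
    then have "poly (spec a (reflect_poly P)) (inverse b) = 0"
      using ab by (simp add: qr(3) spec_simps Vchar)
    then show ?thesis using poly_spec_reflect[of "inverse b" a P] ab by (simp add: Vchar)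
  qed
  define V where "V = {v \<in> affine_space 2 UNIV. poly (spec (v 0) g) (v 1) = 0}"
  have ptV: "pt a b \<in> V \<longleftrightarrow> poly (spec a g) b = 0" for a b by (simp add: V_def pt_in)
  have Vpt: "\<exists>a b. v = pt a b \<and> poly (spec a g) b = 0" if v: "v \<in> V" for v
  proof -
    obtain a b where "v = pt a b" using v affine_plane_cases[of v UNIV] unfolding V_def by blast
    then show ?thesis using v ptV by blast
  qed
  have evpt: "mpol_eval (mpol2 P) (pt a b) = poly (spec a P) b" for P and a b :: 'a by (simp add: eval_mpol2)
  have E2: "\<exists>P. p = mpol2 P" if "p \<in> mpols UNIV 2" for p :: "'a mpol"
    using mpols2E[OF sring_UNIV that] by blast
  have closed: "zariski_closed 2 V"
    unfolding zariski_closed_def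
  proof (intro exI conjI)
    show "{mpol2 g} \<subseteq> mpols UNIV 2" using mpol2_in[OF sring_UNIV, of g 2] by simp
    show "V = zero_set 2 {mpol2 g}" by (auto simp: V_def zero_set_def eval_mpol2)
  qed
  have irred: "absolutely_irreducible 2 V"
    unfolding absolutely_irreducible_def
  proof (intro conjI closed allI impI)
    show "V \<noteq> {}" using gty ptV by blast
    fix V1 V2 assume *: "zariski_closed 2 V1 \<and> zariski_closed 2 V2 \<and> V = V1 \<union> V2"
    \<comment> \<open>A proper closed part of \<open>V\<close> yields a polynomial that vanishes on
      it but not on \<open>V\<close>. The product of two such polynomials, for \<open>V1\<close> and
      \<open>V2\<close>, would be divisible by the prime \<open>g\<close>.\<close>
    have sepa: "\<exists>P a b. (\<forall>w\<in>W. mpol_eval (mpol2 P) w = 0) \<and> poly (spec a g) b = 0 \<and> poly (spec a P) b \<noteq> 0"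
      if W: "zariski_closed 2 W" "W \<subseteq> V" "V \<noteq> W" for W
    proof -
      obtain v where v: "v \<in> V" "v \<notin> W" using W by blast
      obtain S where S: "S \<subseteq> mpols UNIV 2" "W = zero_set 2 S" using W(1) unfolding zariski_closed_def by blast
      then obtain p where p: "p \<in> S" "mpol_eval p v \<noteq> 0" using v unfolding zero_set_def V_def by blast
      obtain P where P: "p = mpol2 P" using E2 p(1) S(1) by blast
      obtain a b where "v = pt a b" "poly (spec a g) b = 0" using Vpt[OF v(1)] by blast
      moreover have "\<forall>w\<in>W. mpol_eval (mpol2 P) w = 0" using p(1) S(2) P unfolding zero_set_def by blast
      ultimately show ?thesis using p(2) P evpt by metis
    qed
    show "V = V1 \<or> V = V2"
    proof (rule ccontr)
      assume "\<not> (V = V1 \<or> V = V2)"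
      then obtain P1 a1 b1 P2 a2 b2 where
        P1: "\<forall>w\<in>V1. mpol_eval (mpol2 P1) w = 0" "poly (spec a1 g) b1 = 0" "poly (spec a1 P1) b1 \<noteq> 0" and
        P2: "\<forall>w\<in>V2. mpol_eval (mpol2 P2) w = 0" "poly (spec a2 g) b2 = 0" "poly (spec a2 P2) b2 \<noteq> 0"
        using sepa[of V1] sepa[of V2] * by blast
      have "g dvd P1 * P2"
      proof (rule dvdI)
        fix a b assume "poly (spec a g) b = 0"
        then have "pt a b \<in> V1 \<union> V2" using ptV * by blast
        then have "mpol_eval (mpol2 P1) (pt a b) = 0 \<or> mpol_eval (mpol2 P2) (pt a b) = 0" using P1(1) P2(1) by blast
        then show "poly (spec a (P1 * P2)) b = 0" by (auto simp: evpt spec_simps)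
      qed
      then have "g dvd P1 \<or> g dvd P2" by (rule prime_elem_dvd_multD[OF pg])
      then show False using P1(2,3) P2(2,3) by (auto simp: spec_simps elim!: dvdE)
    qed
  qed
  \<comment> \<open>By \<open>dvdI\<close> the vanishing ideal over the universal domain is
    principal, generated by \<open>g\<close>, whose coefficients lie in \<open>K\<close>.\<close>
  have defd: "defined_over K 2 V" unfolding defined_over_def
  proof
    fix p assume p: "p \<in> vanishing_ideal UNIV 2 V"
    then obtain P where P: "p = mpol2 P" using E2 unfolding vanishing_ideal_def by blast
    have "g dvd P"
    proof (rule dvdI)
      fix a b assume "poly (spec a g) b = 0"
      then show "poly (spec a P) b = 0" using p ptV evpt[of P a b] unfolding vanishing_ideal_def P by auto
    qed
    then obtain H where H: "P = g * H" by (rule dvdE)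
    have "mpol2 g \<in> vanishing_ideal K 2 V"
      using mpol2_in[OF R gK, of 2] by (auto simp: vanishing_ideal_def V_def eval_mpol2)
    moreover have "mpol2 H \<in> mpols UNIV 2" using mpol2_in[OF sring_UNIV, of H 2] by simp
    moreover have "p = mpol2 H * mpol2 g" unfolding P H using rhomD(7)[OF rhom_mpol2, of g H] by (simp add: mult.commute)
    ultimately show "\<exists>Q h. finite Q \<and> Q \<subseteq> vanishing_ideal K 2 V \<and> (\<forall>q\<in>Q. h q \<in> mpols UNIV 2) \<and> p = (\<Sum>q\<in>Q. h q * q)"
      by (intro exI[of _ "{mpol2 g}"] exI[of _ "\<lambda>_. mpol2 H"]) auto
  qed
  define x where "x = pt t y"
  have gen2: "mpol_eval p v = 0" if p: "p \<in> mpols K 2" "mpol_eval p x = 0" and v: "v \<in> V" for p v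
  proof -
    obtain P where P: "P \<in> polys (polys K)" "p = mpol2 P" using mpols2E[OF R p(1)] by blast
    obtain a b where ab: "v = pt a b" "poly (spec a g) b = 0" using Vpt[OF v] by blast
    show ?thesis unfolding P(2) ab(1) evpt
      by (rule gen[OF P(1) _ ab(2)]) (use p(2) in \<open>simp add: P(2) x_def evpt\<close>)
  qed
  have generic: "generic_point K 2 V x"
    unfolding generic_point_def vanishing_ideal_def using gen2 gty ptV by (auto simp: x_def)
  define \<nu> where "\<nu> = (\<lambda>i\<in>{..<1::nat}. t)"
  have \<nu>im: "\<nu> ` {..<1} = {t}" by (auto simp: \<nu>_def)
  have tim: "(\<lambda>_::nat. t) ` {..<1} = {t}" by auto
  have xim: "x ` {..<2} = {t, y}" by (simp add: x_def pt_image)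
  have adj: "field_adjoin K {t, y} = field_adjoin K {t, u}"
  proof
    note a = field_adjoin_props[where K = K and S = "{t, u}"] and b = field_adjoin_props[where K = K and S = "{t, y}"]
    have "u = inverse y" by (simp add: y_def)
    then have "u \<in> field_adjoin K {t, y}" using sfieldD(2)[OF b(1), of y] b(3) by blast
    then show "field_adjoin K {t, u} \<subseteq> field_adjoin K {t, y}" using b(1-3) by (intro a(4)) blast+
    have "y \<in> field_adjoin K {t, u}" using sfieldD(2)[OF a(1), of u] a(3) unfolding y_def by blast
    then show "field_adjoin K {t, y} \<subseteq> field_adjoin K {t, u}" using a(1-3) by (intro b(4)) blast+
  qed
  have tr: "has_transcendence_degree K (field_adjoin_tuple K 2 x) 1"
    unfolding has_transcendence_degree_def
  proof (intro bexI[of _ "\<lambda>_. t"] conjI ballI)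
    show "(\<lambda>_. t) \<in> {..<1} \<rightarrow> field_adjoin_tuple K 2 x"
      unfolding xim using field_adjoin_props(3)[of "{t, y}" K] by auto
    show "algebraically_independent K 1 (\<lambda>_. t)"
      unfolding algebraically_independent_def
    proof (intro ballI impI)
      fix p :: "'a mpol" assume p: "p \<in> mpols K 1" "mpol_eval p (\<lambda>_. t) = 0"
      then obtain P where P: "P \<in> polys K" "p = mpol1 P" using mpols1E[OF R] by blast
      then have "poly P t = 0" using p(2) by (simp add: eval_mpol1)
      then have "P = 0" using t P(1) unfolding alg_def by blast
      then show "p = 0" by (simp add: P(2))
    qed
    fix z assume "z \<in> field_adjoin_tuple K 2 x"
    then have "separable_over (field_adjoin K {t}) z"
      using sep unfolding xim adj separable_algebraic_extension_def by blast
    then show "ring.algebraic Dom (field_adjoin_tuple K 1 (\<lambda>_. t)) z"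
      unfolding tim separable_over_def by blast
  qed
  have rv: "rational_map_value K 2 x 1 \<nu> (pt a b) (\<lambda>i\<in>{..<1}. a)" for a b
  proof -
    have "t = mpol_eval (mvar 0) x / mpol_eval 1 x" "a = mpol_eval (mvar 0) (pt a b) / mpol_eval 1 (pt a b)"
      by (simp_all add: x_def)
    moreover have "mvar 0 \<in> mpols K 2" "1 \<in> mpols K 2" using mvar_in[OF R, of 0 2] sringD(2)[OF sring_mpols[OF R]] by auto
    moreover have "mpol_eval 1 x \<noteq> 0" "mpol_eval 1 (pt a b) \<noteq> 0" by auto
    ultimately have "rational_function_value K 2 x t (pt a b) a" unfolding rational_function_value_def by blast
    then show ?thesis by (auto simp: rational_map_value_def affine_space_def \<nu>_def)
  qed
  have dom: "dominating_map K 2 V x 1 \<nu>"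
    unfolding dominating_map_def
  proof -
    let ?B = "{b. \<exists>a\<in>V. rational_map_value K 2 x 1 \<nu> a b}"
    have B: "(\<lambda>i\<in>{..<1}. a) \<in> ?B" if "a \<in> A" for a
      using that rv ptV unfolding A_def by blast
    \<comment> \<open>The image of the projection contains the infinite set \<open>A\<close>, on
      which only the zero polynomial in one variable vanishes.\<close>
    have cl: "W = affine_space 1 UNIV" if W: "zariski_closed 1 W" "?B \<subseteq> W" for W
    proof -
      obtain S where S: "S \<subseteq> mpols UNIV 1" "W = zero_set 1 S" using W(1) unfolding zariski_closed_def by blast
      have "p = 0" if p: "p \<in> S" for p
      proof -
        obtain P where P: "p = mpol1 P" using mpols1E[OF sring_UNIV, of p] p S(1) by blast
        have "poly P a = 0" if "a \<in> A" for a
        proof -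
          have "(\<lambda>i\<in>{..<1}. a) \<in> W" using B[OF that] W(2) by blast
          then have "mpol_eval p (\<lambda>i\<in>{..<1}. a) = 0" using p unfolding S(2) zero_set_def by blast
          then show ?thesis by (simp add: P eval_mpol1)
        qed
        then have "P = 0" using poly_zero_on_infinite[OF infA] by blast
        then show ?thesis by (simp add: P)
      qed
      then show ?thesis unfolding S(2) zero_set_def by fastforce
    qed
    have "zariski_closed 1 (affine_space 1 (UNIV :: 'a set))"
      unfolding zariski_closed_def by (intro exI[of _ "{}"]) (auto simp: zero_set_def)
    moreover have "?B \<subseteq> affine_space 1 UNIV" by (auto simp: rational_map_value_def)
    ultimately show "zariski_closure 1 ?B = affine_space 1 UNIV"
      unfolding zariski_closure_def using cl by blast
  qed
  have \<nu>in: "\<nu> \<in> affine_space 1 (field_adjoin_tuple K 2 x)"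
    unfolding xim using field_adjoin_props(3)[of "{t, y}" K] by (auto simp: affine_space_def \<nu>_def)
  have sepm: "separable_map K 2 x 1 \<nu>"
    unfolding separable_map_def \<nu>im xim adj by (rule sep)
  obtain v b where v: "v \<in> V" "v \<in> affine_space 2 K" and b: "b \<in> affine_space 1 K0" and rm: "rational_map_value K 2 x 1 \<nu> v b"
    using pac irred defd generic tr \<nu>in dom sepm unfolding PAC_extension_def by (metis Int_iff le_refl)
  obtain a c where ac: "v = pt a c" "poly (spec a g) c = 0" using Vpt[OF v(1)] by blast
  have "rational_function_value K 2 x t v (b 0)" using rm by (auto simp: rational_map_value_def \<nu>_def)
  then obtain p q where pq: "p \<in> mpols K 2" "q \<in> mpols K 2" "mpol_eval q x \<noteq> 0" "t = mpol_eval p x / mpol_eval q x"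
    "mpol_eval q v \<noteq> 0" "b 0 = mpol_eval p v / mpol_eval q v" unfolding rational_function_value_def by blast
  \<comment> \<open>The value \<open>b 0\<close> may come from any fraction representing
    \<open>t\<close>. Clearing it gives a polynomial that vanishes at the generic point, hence on
    \<open>V\<close>, so the value is the first coordinate of \<open>v\<close> after all.\<close>
  have "p - mvar 0 * q \<in> mpols K 2"
    using sring_mpols[OF R, of 2] mvar_in[OF R, of 0 2] pq(1,2) by (simp add: sringD)
  moreover have "mpol_eval (p - mvar 0 * q) x = 0"
  proof -
    have "mpol_eval p x = t * mpol_eval q x" using pq(3,4) by (metis nonzero_eq_divide_eq)
    moreover have "x 0 = t" by (simp add: x_def)
    ultimately show ?thesis by (simp add: mpol_eval_diff mpol_eval_mult)
  qed
  ultimately have "mpol_eval (p - mvar 0 * q) v = 0" using gen2 v(1) by blast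
  moreover have "v 0 = a" by (simp add: ac(1))
  ultimately have "mpol_eval p v = a * mpol_eval q v" by (simp add: mpol_eval_diff mpol_eval_mult)
  then have "b 0 = a" using pq(5,6) by simp
  then have "a \<in> K0" using b by (auto simp: affine_space_def)
  moreover have "c \<in> K" using v(2) unfolding ac(1) pt_in by blast
  moreover have "c \<noteq> 0" "poly (spec a F) (inverse c) = 0" using ac(2) Vchar by auto
  ultimately show thesis using that[of a "inverse c"] dnz[of a "inverse c"] sfieldD(2)[OF K] by auto
qed

subsection \<open>Absolute irreducibility\<close>

lemma irreducible_monic_linear:
  fixes d :: "'a::idom_divide" shows "irreducible [:- d, 1:]"
proof (rule irreducibleI)
  show "\<not> is_unit [:- d, 1:]" by (auto elim!: is_unit_polyE)
  fix A B assume AB: "[:- d, 1:] = A * B"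
  have nz: "A \<noteq> 0" "B \<noteq> 0" using AB by auto
  have deg: "degree A + degree B = 1" using arg_cong[OF AB, of degree] nz by (simp add: degree_mult_eq)
  have lc: "lead_coeff A * lead_coeff B = 1" using arg_cong[OF AB, of lead_coeff] by (simp add: lead_coeff_mult)
  have unit: "is_unit P" if "degree P = 0" "lead_coeff P dvd 1" for P :: "'a poly"
    using that by (metis degree_eq_zeroE lead_coeff_pCons(2) is_unit_const_poly_iff coeff_pCons_0 degree_pCons_0)
  have "degree A = 0 \<or> degree B = 0" using deg by linarith
  then show "is_unit A \<or> is_unit B" using unit lc by (metis dvd_triv_left dvd_triv_right)
qed simp

text \<open>If \<open>K0\<close> were finite, let \<open>d\<close> vanish exactly on
  \<open>K0\<close> and apply \<open>PAC_curve_point\<close> to \<open>F = Y - d(T)\<close> and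
  \<open>u = d(t)\<close>. The point obtained lies over an element of \<open>K0\<close> at which
  \<open>d\<close> does not vanish.\<close>

lemma PAC_infinite:
  fixes K0 K :: "'a::{alg_closed_field, factorial_ring_gcd, semiring_gcd_mult_normalize} set"
  assumes pac: "PAC_extension K0 K" and t: "\<not> alg K t"
  shows "infinite K0"
proof
  assume fin: "finite K0"
  have K: "sfield K" and sub: "K0 \<subseteq> K" using pac unfolding PAC_extension_def field_extension_def subfield_Dom by blast+
  note R = sfieldD(1)[OF K] note PR = sring_polys[OF R]
  define d where "d = (\<Prod>e\<in>K0. [:- e, 1:])"
  have d: "d \<in> polys K" unfolding d_def by (rule linear_prod_polys[OF R]) (use sub in blast)
  have rd: "poly d a = 0 \<longleftrightarrow> a \<in> K0" for a using fin by (auto simp: d_def poly_prod prod_zero_iff)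
  define F where "F = [:- d, 1:]"
  define u where "u = poly d t"
  have tK: "t \<notin> K" using t alg_self[OF R] by blast
  have adj: "field_adjoin K {t, u} = field_adjoin K {t}"
  proof
    have "u \<in> field_adjoin K {t}" unfolding u_def by (rule poly_in_field_adjoin[OF d])
    then show "field_adjoin K {t, u} \<subseteq> field_adjoin K {t}"
      using field_adjoin_props(2,3)[of K "{t}"] field_adjoin_props(3)[of "{t}" K] by (intro field_adjoin_props(4) field_adjoin_props(1)) auto
    show "field_adjoin K {t} \<subseteq> field_adjoin K {t, u}"
      using field_adjoin_props(2)[of K "{t, u}"] field_adjoin_props(3)[of "{t, u}" K] by (intro field_adjoin_props(4) field_adjoin_props(1)) auto
  qed
  have sep: "separable_algebraic_extension (field_adjoin K {t}) (field_adjoin K {t, u})"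
    unfolding separable_algebraic_extension_def field_extension_def subfield_Dom adj
  proof (intro conjI field_adjoin_props(1) order_refl ballI)
    fix x assume x: "x \<in> field_adjoin K {t}"
    note E = field_adjoin_props(1)[of K "{t}"]
    have "(\<Prod>s\<in>{x}. [:- s, 1:]) \<in> polys (field_adjoin K {t})"
      by (rule linear_prod_polys[OF sfieldD(1)[OF E]]) (use x in simp)
    then show "separable_over (field_adjoin K {t}) x" by (intro separable_overI(2)[OF E, of "{x}"]) auto
  qed
  obtain a b where "a \<in> K0" "poly d a \<noteq> 0"
  proof (rule PAC_curve_point[OF pac t, of F u d])
    show "F \<in> polys (polys K)" using d sringD[OF PR] by (simp add: F_def polys_pCons[OF PR] sringD[OF sring_polys[OF PR]])
    show "poly (spec t F) u = 0" by (simp add: F_def spec_pCons u_def spec_simps)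
    show "u \<noteq> 0" using rd[of t] tK sub by (auto simp: u_def)
    show "irreducible F" unfolding F_def by (rule irreducible_monic_linear)
    show "r = 0" if r: "r \<in> polys (polys K)" "degree r < degree F" "poly (spec t r) u = 0" for r
    proof -
      obtain e where e: "r = [:e:]" using r(2) by (metis F_def degree_eq_zeroE degree_pCons_eq degree_pCons_0 less_Suc0 one_neq_zero pCons_eq_0_iff)
      then have "e \<in> polys K" "poly e t = 0" using r by (auto simp: polys_const[OF PR] spec_pCons spec_simps)
      then show ?thesis using t e unfolding alg_def by auto
    qed
    show "d dvd coeff F i" if "i < degree F" for i using that by (auto simp: F_def)
    show "separable_algebraic_extension (field_adjoin K {t}) (field_adjoin K {t, u})" by (rule sep)
  qed (auto simp: F_def)
  then show False using rd by blast
qed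

text \<open>The polynomial is a product of linear factors over the universal domain; they are split
  off one root at a time.\<close>

lemma monic_poly_in:
  fixes q :: "'a::alg_closed_field poly"
  assumes C: "sring C" and q: "lead_coeff q = 1" "\<And>x. poly q x = 0 \<Longrightarrow> x \<in> C"
  shows "q \<in> polys C"
  using q
proof (induction "degree q" arbitrary: q)
  case 0
  then have "q = [:1:]" by (metis degree_eq_zeroE lead_coeff_pCons(2) degree_pCons_0 coeff_pCons_0)
  then show ?case using C by (simp add: polys_const sringD)
next
  case (Suc n)
  then obtain x where x: "poly q x = 0" using alg_closed_imp_poly_has_root[of q] by auto
  then obtain q' where q': "q = [:- x, 1:] * q'" unfolding poly_eq_0_iff_dvd by (rule dvdE)
  have nz: "q' \<noteq> 0" using q' Suc.hyps(2) by auto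
  have "degree q = Suc (degree q')" unfolding q' using nz by (subst degree_mult_eq) auto
  moreover have "lead_coeff q' = 1" using Suc.prems(1) lead_coeff_mult[of "[:- x, 1:]" q'] by (simp add: q')
  ultimately have "q' \<in> polys C" using Suc.hyps Suc.prems(2) by (auto simp: q')
  moreover have "[:- x, 1:] \<in> polys C" using Suc.prems(2)[OF x] C by (simp add: polys_pCons sringD sring_polys)
  ultimately show ?case unfolding q' by (rule sringD(6)[OF sring_polys[OF C], rotated])
qed

text \<open>Interpolation over \<open>C\<close> at \<open>Suc (degree p)\<close> points of
  \<open>C\<close> recovers \<open>p\<close>.\<close>

lemma poly_values_in:
  fixes p :: "'a::field poly"
  assumes C: "sfield C" "infinite C" and p: "\<And>a. a \<in> C \<Longrightarrow> poly p a \<in> C"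
  shows "p \<in> polys C"
proof -
  obtain I where I: "finite I" "card I = Suc (degree p)" "I \<subseteq> C"
    using infinite_arbitrarily_large[OF C(2)] by blast
  obtain h where h: "h \<in> polys C" "degree h < card I" "\<And>i. i \<in> I \<Longrightarrow> poly h i = poly p i"
    by (rule interpolation[OF C(1) I(1), of "\<lambda>i. i" "poly p"]) (use I p in auto)
  have "p = h" by (rule interpolation_unique[OF I(1), of "\<lambda>i. i"]) (use h I in auto)
  then show ?thesis using h by simp
qed

text \<open>A monic factor over the universal domain specializes at every point of \<open>C\<close> to a polynomial
  whose roots are algebraic over \<open>C\<close>, so its coefficients take values in \<open>C\<close> at all points of \<open>C\<close>.\<close>

lemma irreducible_of_minimal:
  fixes F :: "'a::alg_closed_field poly poly"
  assumes C: "sfield C" "infinite C" and closed: "\<And>x. alg C x \<Longrightarrow> x \<in> C"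
    and F: "F \<in> polys (polys C)" "lead_coeff F = 1" "degree F > 0" "poly (spec t F) z = 0"
    and min: "\<And>r. r \<in> polys (polys C) \<Longrightarrow> degree r < degree F \<Longrightarrow> poly (spec t r) z = 0 \<Longrightarrow> r = 0"
  shows "irreducible F"
proof (rule irreducibleI)
  show "F \<noteq> 0" using F(3) by auto
  show "\<not> is_unit F" using F(3) by (metis is_unit_polyE degree_pCons_0 less_irrefl)
  note R = sfieldD(1)[OF C(1)]
  have factor_in: "A \<in> polys (polys C)" if A: "lead_coeff A = 1" "F = A * B" for A B
  proof (rule polysI, rule poly_values_in[OF C])
    fix i a assume a: "a \<in> C"
    have "spec a A \<in> polys C"
    proof (rule monic_poly_in[OF R spec_monic(2)[OF A(1)]])
      fix x assume "poly (spec a A) x = 0"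
      then have "poly (spec a F) x = 0" by (simp add: A(2) spec_simps)
      moreover have "spec a F \<in> polys C" by (rule spec_in[OF R F(1) a])
      moreover have "spec a F \<noteq> 0" using spec_monic(2)[OF F(2), of a] by auto
      ultimately show "x \<in> C" by (intro closed algI)
    qed
    then have "coeff (spec a A) i \<in> C" by (rule polysD)
    then show "poly (coeff A i) a \<in> C" by (simp add: coeff_spec)
  qed
  fix A B assume AB: "F = A * B"
  have lc: "lead_coeff A * lead_coeff B = 1" using arg_cong[OF AB, of lead_coeff] F(2) by (simp add: lead_coeff_mult)
  then obtain \<alpha> \<beta> where ab: "lead_coeff A = [:\<alpha>:]" "lead_coeff B = [:\<beta>:]"
    by (metis dvd_triv_left dvd_triv_right is_unit_polyE)
  have \<alpha>\<beta>: "\<alpha> * \<beta> = 1" using lc unfolding ab by (simp add: one_pCons mult.commute)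
  \<comment> \<open>The leading coefficients are mutually inverse constants, so both factors can be
    made monic.\<close>
  define A' B' where "A' = smult [:\<beta>:] A" and "B' = smult [:\<alpha>:] B"
  have F': "F = A' * B'" "F = B' * A'" using \<alpha>\<beta> by (simp_all add: A'_def B'_def AB mult.commute flip: one_pCons)
  have deg: "degree A' = degree A" "degree B' = degree B" using \<alpha>\<beta> by (auto simp: A'_def B'_def)
  have mon: "lead_coeff A' = 1" "lead_coeff B' = 1"
    using ab \<alpha>\<beta> unfolding A'_def B'_def lead_coeff_smult by (simp_all add: mult.commute one_pCons)
  have in': "A' \<in> polys (polys C)" "B' \<in> polys (polys C)" using factor_in mon F' by blast+
  have nz: "A' \<noteq> 0" "B' \<noteq> 0" using mon by auto
  have dsum: "degree F = degree A' + degree B'" unfolding F'(1) using nz by (rule degree_mult_eq)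
  have "poly (spec t A') z = 0 \<or> poly (spec t B') z = 0" using F(4) by (simp add: F'(1) spec_simps)
  then have "\<not> degree A' < degree F \<or> \<not> degree B' < degree F" using min in' nz by blast
  then have "degree A = 0 \<or> degree B = 0" using dsum deg by linarith
  then show "is_unit A \<or> is_unit B"
  proof
    assume "degree A = 0"
    then have "A = [:lead_coeff A:]" by (metis degree_eq_zeroE degree_pCons_0 coeff_pCons_0)
    moreover have "is_unit (lead_coeff A)" using lc by (metis dvd_triv_left)
    ultimately show ?thesis using is_unit_const_poly_iff by metis
  next
    assume "degree B = 0"
    then have "B = [:lead_coeff B:]" by (metis degree_eq_zeroE degree_pCons_0 coeff_pCons_0)
    moreover have "is_unit (lead_coeff B)" using lc by (metis dvd_triv_right)
    ultimately show ?thesis using is_unit_const_poly_iff by metis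
  qed
qed

text \<open>A relation \<open>h\<close> of least degree pseudo-divides \<open>F\<close>. As
  \<open>F\<close> is prime and of larger degree than \<open>h\<close>, it divides the quotient and
  cancels, so \<open>h\<close> divides a power of its own leading coefficient. Then \<open>h\<close>
  is constant in the outer variable and makes \<open>t\<close> algebraic.\<close>

lemma minimal_of_irreducible:
  fixes F :: "'a::{alg_closed_field, factorial_ring_gcd, semiring_gcd_mult_normalize} poly poly"
  assumes C: "sfield C" and t: "\<not> alg C t" and F: "irreducible F" "F \<in> polys (polys C)" "poly (spec t F) z = 0"
    and r: "r \<in> polys (polys C)" "degree r < degree F" "poly (spec t r) z = 0"
  shows "r = 0"
proof (rule ccontr)
  assume "r \<noteq> 0"
  note PR = sring_polys[OF sfieldD(1)[OF C]]
  define S where "S = {r. r \<noteq> 0 \<and> r \<in> polys (polys C) \<and> degree r < degree F \<and> poly (spec t r) z = 0}"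
  have "r \<in> S" using r \<open>r \<noteq> 0\<close> by (simp add: S_def)
  then obtain h where h: "h \<in> S" "\<And>h'. h' \<in> S \<Longrightarrow> degree h \<le> degree h'"
    using arg_min_natI[of "\<lambda>h. h \<in> S" r degree] arg_min_nat_le[of "\<lambda>h. h \<in> S" _ degree] by blast
  have hS: "h \<noteq> 0" "h \<in> polys (polys C)" "degree h < degree F" "poly (spec t h) z = 0" using h(1) by (auto simp: S_def)
  obtain k q s where q: "s \<in> polys (polys C)" "smult (lead_coeff h ^ k) F = h * q + s" "s = 0 \<or> degree s < degree h"
    using pseudo_division[OF PR hS(2,1) F(2)] by blast
  have "poly (spec t (smult (lead_coeff h ^ k) F)) z = 0"
    using F(3) by (simp add: spec_smult)
  then have "poly (spec t s) z = 0" using hS(4) by (simp add: q(2) spec_simps)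
  then have s: "s = 0" using q(1,3) h(2)[of s] hS(3) unfolding S_def by force
  have pF: "prime_elem F" by (rule irreducible_imp_prime_elem[OF F(1)])
  have "F dvd h * q" using q(2) s by (metis add.right_neutral dvd_smult dvd_refl)
  then have "F dvd h \<or> F dvd q" by (rule prime_elem_dvd_multD[OF pF])
  moreover have "\<not> F dvd h" using dvd_imp_degree_le[of F h] hS by auto
  ultimately obtain v where v: "q = F * v" by (auto elim: dvdE)
  have F0: "F \<noteq> 0" using hS(3) by auto
  have "F * [:lead_coeff h ^ k:] = F * (h * v)" using q(2) s v by (simp add: algebra_simps)
  then have hv: "[:lead_coeff h ^ k:] = h * v" using F0 by (subst (asm) mult_left_cancel) auto
  have "h * v \<noteq> 0" using hS(1) by (auto simp flip: hv)
  moreover have "degree (h * v) = 0" by (simp flip: hv)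
  ultimately have "degree h = 0" by (simp add: degree_mult_eq)
  then obtain e where e: "h = [:e:]" using degree_eq_zeroE by blast
  then have "e \<in> polys C" "poly e t = 0" "e \<noteq> 0" using hS by (auto simp: polys_const[OF PR] spec_pCons spec_simps)
  then show False using t algI by blast
qed

text \<open>For \<open>r = 0\<close> the degree bound alone would only make \<open>P\<close>
  constant in the outer variable; the clause \<open>P = 0\<close> is what carries the bound through
  the step to \<open>pCons\<close>.\<close>

lemma clear_denominators:
  fixes C :: "'a::alg_closed_field set"
  assumes C: "sfield C" and r: "r \<in> polys (field_adjoin C {t})"
  shows "\<exists>q\<in>polys C. poly q t \<noteq> 0 \<and> (\<exists>P\<in>polys (polys C). degree P \<le> degree r \<and> (r = 0 \<longrightarrow> P = 0) \<and> spec t P = smult (poly q t) r)"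
  using r
proof (induction r)
  case 0
  show ?case using sringD[OF sring_polys[OF sfieldD(1)[OF C]]] sringD(1)[OF sring_polys[OF sring_polys[OF sfieldD(1)[OF C]]]]
    by (intro bexI[of _ 1] conjI bexI[of _ 0]) (auto simp: spec_simps)
next
  case (pCons a r)
  note R = sfieldD(1)[OF C] note PR = sring_polys[OF R]
  have a: "a \<in> field_adjoin C {t}" and r: "r \<in> polys (field_adjoin C {t})"
    using pCons.prems polys_pCons[OF sfieldD(1)[OF field_adjoin_props(1)]] by blast+
  from pCons.IH[OF r] obtain q P where q: "q \<in> polys C" "poly q t \<noteq> 0"
    and P: "P \<in> polys (polys C)" "degree P \<le> degree r" "r = 0 \<longrightarrow> P = 0" "spec t P = smult (poly q t) r" by blast
  obtain p1 q1 where a1: "p1 \<in> polys C" "q1 \<in> polys C" "poly q1 t \<noteq> 0" "a = poly p1 t / poly q1 t"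
    using a unfolding field_adjoin_fractions[OF C] by blast
  let ?P = "pCons (p1 * q) (smult q1 P)"
  have "q1 * q \<in> polys C" by (rule sringD(6)[OF PR a1(2) q(1)])
  moreover have "poly (q1 * q) t \<noteq> 0" using q a1 by simp
  moreover have "?P \<in> polys (polys C)"
    using polys_smult[OF PR a1(2) P(1)] sringD(6)[OF PR a1(1) q(1)] by (simp add: polys_pCons[OF PR])
  moreover have "degree ?P \<le> degree (pCons a r)"
  proof (cases "r = 0")
    case False
    have "degree ?P \<le> Suc (degree (smult q1 P))" by (rule degree_pCons_le)
    also have "\<dots> \<le> Suc (degree r)" using P(2) degree_smult_le[of q1 P] by simp
    finally show ?thesis using False by simp
  qed (use P(3) in simp)
  moreover have "pCons a r = 0 \<longrightarrow> ?P = 0" using pCons.hyps by auto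
  moreover have "spec t ?P = smult (poly (q1 * q) t) (pCons a r)"
    using a1(3) by (simp add: spec_pCons spec_smult P(4) a1(4) field_simps)
  ultimately show ?case by blast
qed

lemma clear_denominators_elem:
  fixes C :: "'a::alg_closed_field set"
  assumes C: "sfield C" and x: "x \<in> field_adjoin C {t}"
  obtains p q where "p \<in> polys C" "q \<in> polys C" "poly q t \<noteq> 0" "x = poly p t / poly q t"
  using x unfolding field_adjoin_fractions[OF C] by blast

text \<open>Scaling the roots by \<open>c\<close> multiplies the coefficient of index
  \<open>i\<close> by \<open>c\<close> to the power \<open>card I - i\<close>; the factor
  \<open>c ^ i\<close> on the left replaces the difference of exponents.\<close>

lemma coeff_scaled_linear_prod:
  fixes c :: "'a::comm_ring_1"
  assumes "finite I"
  shows "c ^ i * coeff (\<Prod>j\<in>I. [:- (c * y j), 1:]) i = c ^ card I * coeff (\<Prod>j\<in>I. [:- y j, 1:]) i"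
  using assms
proof (induction I arbitrary: i rule: finite_induct)
  case empty then show ?case by (cases i) auto
next
  case (insert j I)
  define P where "P = (\<Prod>j\<in>I. [:- (c * y j), 1:])"
  define Q where "Q = (\<Prod>j\<in>I. [:- y j, 1:])"
  have IH: "c ^ i * coeff P i = c ^ card I * coeff Q i" for i unfolding P_def Q_def by (rule insert.IH)
  have e: "coeff ([:- b, 1:] * R) i = (case i of 0 \<Rightarrow> 0 | Suc k \<Rightarrow> coeff R k) - b * coeff R i" for b :: 'a and R i
    by (simp add: coeff_pCons)
  have "c ^ i * coeff ([:- (c * y j), 1:] * P) i = c ^ Suc (card I) * coeff ([:- y j, 1:] * Q) i"
  proof (cases i)
    case 0
    then show ?thesis using IH[of 0] unfolding e by (simp add: algebra_simps)
  next
    case (Suc k)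
    have "c ^ i * coeff ([:- (c * y j), 1:] * P) i = c * (c ^ k * coeff P k) - c * y j * (c ^ i * coeff P i)"
      unfolding e Suc by (simp add: algebra_simps)
    also have "\<dots> = c ^ Suc (card I) * coeff ([:- y j, 1:] * Q) i"
      unfolding IH e Suc by (simp add: algebra_simps)
    finally show ?thesis .
  qed
  then show ?case using insert.hyps by (simp add: P_def Q_def del: mult_pCons_left)
qed

text \<open>One factor \<open>d\<close> clears the denominators, the other one makes \<open>d\<close> divide the coefficients.\<close>

lemma integral_scaling:
  fixes C :: "'a::alg_closed_field set"
  assumes C: "sfield C" and I: "finite I"
    and q: "q \<in> polys C" "poly q t \<noteq> 0"
    and P: "P \<in> polys (polys C)" "spec t P = smult (poly q t) (\<Prod>j\<in>I. [:- y j, 1:])"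
    and d: "d = q * e" "e \<in> polys C" "poly d t \<noteq> 0"
  obtains F where "F \<in> polys (polys C)" "lead_coeff F = 1" "degree F = card I"
    "spec t F = (\<Prod>j\<in>I. [:- (poly d t ^ 2 * y j), 1:])" "\<And>i. i < card I \<Longrightarrow> d dvd coeff F i"
proof -
  note R = sfieldD(1)[OF C] note PR = sring_polys[OF R]
  let ?n = "card I"
  \<comment> \<open>With \<open>d = q * e\<close>, the factor \<open>q\<close> contained in the
    value of \<open>coeff P i\<close> at \<open>t\<close> combines with \<open>d * e\<close> to
    \<open>d ^ 2\<close>. The total exponent of \<open>d\<close> is then
    \<open>2 * (?n - i)\<close>, as scaling the roots by \<open>d ^ 2\<close> demands, while one
    factor \<open>d\<close> remains visible.\<close>
  define c where "c i = (if i < ?n then coeff P i * (d * e * (d ^ 2) ^ (?n - i - 1)) else if i = ?n then 1 else 0)" for i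
  define F where "F = (\<Sum>i\<le>?n. monom (c i) i)"
  have cF: "coeff F i = c i" for i
    by (auto simp: F_def coeff_sum coeff_monom c_def)
  have dC: "d \<in> polys C" using d(1,2) q(1) sringD(6)[OF PR] by simp
  have cC: "c i \<in> polys C" for i
    using polysD[OF P(1), of i] dC d(2) sring_power[OF PR] by (simp add: c_def sringD[OF PR])
  have FC: "F \<in> polys (polys C)" by (rule polysI) (simp add: cF cC)
  have deg: "degree F = ?n"
    by (rule antisym, rule degree_le, simp add: cF c_def, rule le_degree, simp add: cF c_def)
  define D where "D = poly d t ^ 2"
  have D0: "D \<noteq> 0" using d(3) by (simp add: D_def)
  have degy: "degree (\<Prod>j\<in>I. [:- v j, 1:]) = ?n" for v :: "'b \<Rightarrow> 'a"
    using I by (subst degree_prod_eq_sum_degree) auto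
  have leady: "coeff (\<Prod>j\<in>I. [:- v j, 1:]) ?n = 1" for v :: "'b \<Rightarrow> 'a"
    using lead_coeff_prod[of "\<lambda>j. [:- v j, 1:]" I] degy[of v] by simp
  have "spec t F = (\<Prod>j\<in>I. [:- (D * y j), 1:])"
  proof (rule poly_eqI)
    fix i
    consider "i < ?n" | "i = ?n" | "i > ?n" by linarith
    then show "coeff (spec t F) i = coeff (\<Prod>j\<in>I. [:- (D * y j), 1:]) i"
    proof cases
      case 1
      have "poly (coeff P i) t = poly q t * coeff (\<Prod>j\<in>I. [:- y j, 1:]) i"
        using arg_cong[OF P(2), of "\<lambda>p. coeff p i"] by (simp add: coeff_spec)
      then have "coeff (spec t F) i = D * D ^ (?n - i - 1) * coeff (\<Prod>j\<in>I. [:- y j, 1:]) i"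
        using 1 by (simp add: coeff_spec cF c_def D_def d(1) power2_eq_square algebra_simps)
      also have "D * D ^ (?n - i - 1) = D ^ (?n - i)" using 1 by (metis Suc_diff_Suc diff_Suc_eq_diff_pred diff_commute power_Suc diff_diff_left plus_1_eq_Suc add.commute)
      finally have "D ^ i * coeff (spec t F) i = D ^ ?n * coeff (\<Prod>j\<in>I. [:- y j, 1:]) i"
        using 1 by (simp add: mult.assoc[symmetric] flip: power_add)
      also have "\<dots> = D ^ i * coeff (\<Prod>j\<in>I. [:- (D * y j), 1:]) i"
        by (rule coeff_scaled_linear_prod[OF I, symmetric])
      finally show ?thesis using D0 by simp
    next
      case 2 then show ?thesis using leady by (simp add: coeff_spec cF c_def)
    next
      case 3 then show ?thesis using degy[of "\<lambda>j. D * y j"] by (simp add: coeff_spec cF c_def coeff_eq_0)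
    qed
  qed
  moreover have "d dvd coeff F i" if "i < ?n" for i using that by (simp add: cF c_def)
  moreover have "lead_coeff F = 1" by (simp add: deg cF c_def)
  ultimately show thesis using that FC deg unfolding D_def by blast
qed

section \<open>Tools for fixed fields and linear systems\<close>

lemma sfield_equalizer:
  fixes \<alpha> \<beta> :: "'a::field \<Rightarrow> 'b::field"
  assumes "sfield M" "rhom M \<alpha>" "rhom M \<beta>" shows "sfield {x \<in> M. \<alpha> x = \<beta> x}"
  using assms sringD[OF sfieldD(1)[OF assms(1)]] sfieldD(2)[OF assms(1)]
  by (auto simp: sfield_def sring_def rhomD[OF assms(2)] rhomD[OF assms(3)] rhom_inverse[OF assms(2)] rhom_inverse[OF assms(3)])

lemma sfield_vimage:
  fixes \<alpha> :: "'a::field \<Rightarrow> 'b::field"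
  assumes "sfield M" "rhom M \<alpha>" "sfield N" shows "sfield {x \<in> M. \<alpha> x \<in> N}"
  using assms sringD[OF sfieldD(1)[OF assms(1)]] sfieldD(2)[OF assms(1)] sringD[OF sfieldD(1)[OF assms(3)]] sfieldD(2)[OF assms(3)]
  by (auto simp: sfield_def sring_def rhomD[OF assms(2)] rhom_inverse[OF assms(2)])

text \<open>Write \<open>x\<close> as \<open>r (v i0)\<close> with \<open>r\<close> over
  \<open>E\<close> of degree below \<open>card I\<close>. The given maps show that \<open>r\<close>
  takes the value \<open>x\<close> at all \<open>card I\<close> distinct nodes, so \<open>r\<close>
  is constant and its coefficient \<open>x\<close> lies in \<open>E\<close>.\<close>

lemma fixed_by_conjugations:
  fixes E :: "'a::alg_closed_field set"
  assumes E: "sfield E" and I: "finite I" "inj_on v I" "i0 \<in> I" and prod: "(\<Prod>i\<in>I. [:- v i, 1:]) \<in> polys E"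
    and x: "x \<in> field_adjoin E {v i0}"
    and \<theta>: "\<And>i. i \<in> I \<Longrightarrow> \<exists>N \<theta>. rhom N \<theta> \<and> E \<subseteq> N \<and> v i0 \<in> N \<and> (\<forall>e\<in>E. \<theta> e = e) \<and> \<theta> (v i0) = v i \<and> \<theta> x = x"
  shows "x \<in> E"
proof -
  let ?f = "\<Prod>i\<in>I. [:- v i, 1:]"
  note R = sfieldD(1)[OF E]
  have f0: "poly ?f (v i0) = 0" using I by (auto simp: poly_prod prod_zero_iff)
  have lead: "lead_coeff ?f = 1" by (simp add: lead_coeff_prod)
  have deg: "degree ?f = card I" using I(1) by (subst degree_prod_eq_sum_degree) auto
  have "alg E (v i0)" using prod f0 lead by (intro algI[of ?f]) auto
  then obtain P where P: "P \<in> polys E" "x = poly P (v i0)" using x field_adjoin_alg[OF E] by blast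
  obtain q r where qr: "r \<in> polys E" "P = ?f * q + r" "r = 0 \<or> degree r < degree ?f"
    using monic_division[OF R prod lead P(1)] by blast
  have xr: "x = poly r (v i0)" using P(2) qr(2) f0 by simp
  have card: "card I > 0" using I by (auto simp: card_gt_0_iff)
  have "r = [:x:]"
  proof (rule interpolation_unique[OF I(1,2)])
    show "degree r < card I" using qr(3) deg card by auto
    show "degree [:x:] < card I" using card by simp
    fix i assume "i \<in> I"
    then obtain N \<theta>' where N: "rhom N \<theta>'" "E \<subseteq> N" "v i0 \<in> N" "\<forall>e\<in>E. \<theta>' e = e" "\<theta>' (v i0) = v i" "\<theta>' x = x"
      using \<theta> by blast
    have "\<theta>' (poly r (v i0)) = poly r (\<theta>' (v i0))"
      by (rule rhom_poly_fixed[OF N(1,2,3) _ qr(1)]) (use N(4) in blast)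
    then show "poly r (v i) = poly [:x:] (v i)" using xr N(5,6) by simp
  qed
  then show ?thesis using qr(1) polys_const[OF R] by simp
qed

text \<open>Weighting the equations with the coefficients of the Lagrange polynomial for
  \<open>g\<close> isolates \<open>D g\<close>, so no determinant has to be computed.\<close>

lemma vandermonde_trivial:
  fixes v D :: "'i \<Rightarrow> 'a::field"
  assumes I: "finite I" "inj_on v I" and z: "\<And>i. i < card I \<Longrightarrow> (\<Sum>g\<in>I. v g ^ i * D g) = 0" and g: "g \<in> I"
  shows "D g = 0"
proof -
  obtain l where l: "degree l < card I" "\<And>h. h \<in> I \<Longrightarrow> poly l (v h) = (if h = g then 1 else 0)"
    using interpolation[of UNIV I v "\<lambda>h. if h = g then 1 else 0"] I g by (auto simp: sfield_def sring_UNIV)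
  have "0 = (\<Sum>i\<le>degree l. coeff l i * (\<Sum>h\<in>I. v h ^ i * D h))" using z l(1) by (intro sum.neutral[symmetric]) auto
  also have "\<dots> = (\<Sum>h\<in>I. poly l (v h) * D h)"
    unfolding poly_altdef sum_distrib_left sum_distrib_right by (subst sum.swap) (simp add: mult.assoc)
  also have "\<dots> = (\<Sum>h\<in>I. if h = g then D g else 0)" using l(2) by (intro sum.cong) auto
  also have "\<dots> = D g" using I(1) g by simp
  finally show ?thesis by simp
qed

subsection \<open>The field crossing argument\<close>

lemma spec_field_adjoin: "P \<in> polys (polys C) \<Longrightarrow> spec t P \<in> polys (field_adjoin C {t})"
  by (rule polysI) (simp only: coeff_spec poly_in_field_adjoin[OF polysD])

lemma map_spec_fixed:
  assumes \<theta>: "rhom N \<theta>" and C: "C \<subseteq> N" "t \<in> N" "\<And>x. x \<in> C \<Longrightarrow> \<theta> x = x" and P: "P \<in> polys (polys C)"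
  shows "map_poly \<theta> (spec t P) = spec (\<theta> t) P"
proof (rule poly_eqI)
  fix i
  have "\<theta> (poly (coeff P i) t) = poly (coeff P i) (\<theta> t)" by (rule rhom_poly_fixed[OF \<theta> C polysD[OF P]])
  then show "coeff (map_poly \<theta> (spec t P)) i = coeff (spec (\<theta> t) P) i"
    by (simp add: coeff_map[OF \<theta>] coeff_spec)
qed

text \<open>The regular extension is present only through polynomial identities over
  \<open>K0\<close>, because these survive specialization. \<open>H g\<close>, with common
  denominator \<open>\<delta>\<close>, expresses \<open>Z (h \<otimes> g)\<close> by
  \<open>Z h\<close> with the same formula for every \<open>h\<close>; this encodes that the Galois
  group acts on the indices by left translation.\<close>

locale field_crossing = L: galois_action G K L \<tau>
  for G :: "('g, 'm) monoid_scheme" (structure)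
    and K L :: "'a::{alg_closed_field, factorial_ring_gcd, semiring_gcd_mult_normalize} set" and \<tau> +
  fixes K0 :: "'a set" and t w :: 'a and Z :: "'g \<Rightarrow> 'a" and f :: "'a poly poly"
    and \<delta> :: "'a poly" and H :: "'g \<Rightarrow> 'a poly poly"
  assumes K0: "sfield K0" "K0 \<subseteq> K" "infinite K0" and t: "\<not> alg K t"
    and w: "w \<in> L" "inj_on (\<lambda>g. \<tau> g w) (carrier G)"
    and Z: "inj_on Z (carrier G)" "\<And>g. g \<in> carrier G \<Longrightarrow> Z g \<noteq> 0"
    and f: "f \<in> polys (polys K0)" "lead_coeff f = 1" "irreducible f" "spec t f = (\<Prod>g\<in>carrier G. [:- Z g, 1:])"
    and \<delta>: "\<delta> \<in> polys K0" "\<delta> \<noteq> 0"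
    and H: "\<And>g. g \<in> carrier G \<Longrightarrow> H g \<in> polys (polys K0)"
      "\<And>g h. g \<in> carrier G \<Longrightarrow> h \<in> carrier G \<Longrightarrow> poly \<delta> t * Z (h \<otimes> g) = poly (spec t (H g)) (Z h)"
begin

section \<open>Conjugations over \<open>K0(t)\<close>\<close>

abbreviation "n \<equiv> card (carrier G)"
abbreviation "Kbar \<equiv> {x. alg K x}"

lemma n_pos: "n > 0" using L.finite_G L.one_closed by (auto simp: card_gt_0_iff)

lemma Kbar: "sfield Kbar" "K \<subseteq> Kbar" using sfield_algebraics[OF L.E] by auto

lemma L_Kbar: "L \<subseteq> Kbar" using L.alg_E by blast

lemma t_Kbar: "\<not> alg Kbar t" using alg_trans[OF L.E] t by blast

lemma t_sub: "C \<subseteq> Kbar \<Longrightarrow> \<not> alg C t" using alg_mono t_Kbar by blast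

lemma degree_f: "degree f = n"
proof -
  have "degree f = degree (spec t f)" using spec_monic[OF f(2)] by simp
  then show ?thesis unfolding f(4) using L.finite_G by (subst (asm) degree_prod_eq_sum_degree) auto
qed

lemma f_root: "g \<in> carrier G \<Longrightarrow> poly (spec t f) (Z g) = 0"
  unfolding f(4) using L.finite_G by (auto simp: poly_prod prod_zero_iff)

lemma \<delta>_nz: "poly \<delta> t \<noteq> 0" using t algI[of \<delta> K t] \<delta> polys_mono[OF K0(2)] by blast

text \<open>Irreducibility over the universal domain keeps the degree of each \<open>Z g\<close>
  equal to \<open>n\<close> even over \<open>Kbar(t)\<close>.\<close>

lemma f_minimal:
  assumes "r \<in> polys (polys Kbar)" "degree r < n" "g \<in> carrier G" "poly (spec t r) (Z g) = 0"
  shows "r = 0"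
proof (rule minimal_of_irreducible[OF Kbar(1) t_Kbar f(3) _ f_root[OF assms(3)] assms(1) _ assms(4)])
  show "f \<in> polys (polys Kbar)" using f(1) polys_mono[OF polys_mono[of K0 Kbar]] K0(2) Kbar(2) by blast
  show "degree r < degree f" using assms(2) degree_f by simp
qed

abbreviation N :: "'a set \<Rightarrow> 'a set" where "N C \<equiv> field_adjoin (field_adjoin C {t}) {Z \<one>}"

lemma N_props:
  "sfield (N C)" "C \<subseteq> N C" "t \<in> N C" "Z \<one> \<in> N C" "field_adjoin C {t} \<subseteq> N C"
  "sfield E \<Longrightarrow> C \<subseteq> E \<Longrightarrow> t \<in> E \<Longrightarrow> Z \<one> \<in> E \<Longrightarrow> N C \<subseteq> E"
proof -
  note a = field_adjoin_props[where K = C and S = "{t}"]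
  note b = field_adjoin_props[where K = "field_adjoin C {t}" and S = "{Z \<one>}"]
  show "sfield (N C)" by (rule b(1))
  show s: "field_adjoin C {t} \<subseteq> N C" by (rule b(2))
  show "C \<subseteq> N C" using a(2) s by (rule subset_trans)
  show "t \<in> N C" using a(3) s by blast
  show "Z \<one> \<in> N C" using b(3) by blast
  show "N C \<subseteq> E" if "sfield E" "C \<subseteq> E" "t \<in> E" "Z \<one> \<in> E"
    using that by (intro b(4) a(4)) auto
qed

lemma Z_eq:
  assumes "g \<in> carrier G" "h \<in> carrier G" shows "Z (h \<otimes> g) = poly (spec t (H g)) (Z h) / poly \<delta> t"
  using H(2)[OF assms] \<delta>_nz by (simp add: field_simps)

lemma Z_in_N:
  assumes "K0 \<subseteq> C" "g \<in> carrier G" shows "Z g \<in> N C"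
proof -
  have "spec t (H g) \<in> polys (field_adjoin C {t})"
    using spec_field_adjoin H(1)[OF assms(2)] polys_mono[OF polys_mono[OF assms(1)]] by blast
  then have "poly (spec t (H g)) (Z \<one>) \<in> N C" by (rule poly_in_field_adjoin)
  moreover have "poly \<delta> t \<in> N C"
    using poly_in_field_adjoin[of \<delta> C t] \<delta>(1) polys_mono[OF assms(1)] N_props(5) by blast
  ultimately show ?thesis using Z_eq[OF assms(2) L.one_closed] assms(2) sfieldD(3)[OF N_props(1)] by simp
qed

text \<open>The coefficients of \<open>spec t (H g)\<close> are fixed by \<open>\<theta>\<close>, so
  the formula for \<open>Z g\<close> in terms of \<open>Z \<one>\<close> is carried to the formula
  for \<open>Z (h \<otimes> g)\<close> in terms of \<open>Z h\<close>. Elements of \<open>C\<close>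
  outside \<open>K0\<close> may be moved.\<close>

lemma conjugate_Z:
  assumes \<theta>: "rhom (N C) \<theta>" "\<And>x. x \<in> K0 \<Longrightarrow> \<theta> x = x" "\<theta> t = t" "\<theta> (Z \<one>) = Z h"
    and C: "K0 \<subseteq> C" and g: "g \<in> carrier G" and h: "h \<in> carrier G"
  shows "\<theta> (Z g) = Z (h \<otimes> g)"
proof -
  have sub: "K0 \<subseteq> N C" using C N_props(2) by blast
  have m: "map_poly \<theta> (spec t P) = spec t P" if "P \<in> polys (polys K0)" for P
    using map_spec_fixed[OF \<theta>(1) sub N_props(3) \<theta>(2) that] \<theta>(3) by simp
  have "spec t (H g) \<in> polys (N C)"
    using spec_field_adjoin[of "H g" C t] H(1)[OF g] polys_mono[OF polys_mono[OF C]] polys_mono[OF N_props(5)] by blast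
  then have "\<theta> (poly (spec t (H g)) (Z \<one>)) = poly (spec t (H g)) (Z h)"
    using poly_map[OF \<theta>(1) _ N_props(4), of "spec t (H g)"] m[OF H(1)[OF g]] \<theta>(4) by simp
  moreover have d: "\<theta> (poly \<delta> t) = poly \<delta> t"
    using rhom_poly_fixed[OF \<theta>(1) sub N_props(3) \<theta>(2) \<delta>(1)] \<theta>(3) by simp
  moreover have dN: "poly \<delta> t \<in> N C"
    using poly_in_field_adjoin[of \<delta> C t] \<delta>(1) polys_mono[OF C] N_props(5) by blast
  moreover have "poly \<delta> t * Z g = poly (spec t (H g)) (Z \<one>)" using H(2)[OF g L.one_closed] g by simp
  ultimately have "poly \<delta> t * \<theta> (Z g) = poly (spec t (H g)) (Z h)"
    using rhomD(7)[OF \<theta>(1) dN Z_in_N[OF C g]] by simp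
  then show ?thesis using H(2)[OF g h] \<delta>_nz by (metis mult_left_cancel)
qed

text \<open>\<open>C\<close> and the \<open>Z g\<close> move independently: \<open>\<rho>\<close>
  extends to \<open>C(t)\<close> because \<open>t\<close> is transcendental over
  \<open>Kbar\<close>, and \<open>f(t, -)\<close>, which the extension fixes, is still of least
  degree for \<open>Z \<one>\<close>, so any root may be its image. This is used for
  \<open>\<tau> k\<close> on \<open>L\<close> and for the identity on \<open>Kbar\<close>.\<close>

lemma conjugation_exists:
  assumes C: "sfield C" "K0 \<subseteq> C" "C \<subseteq> Kbar" and \<rho>: "rhom C \<rho>" "\<rho> ` C \<subseteq> Kbar" "\<And>x. x \<in> K0 \<Longrightarrow> \<rho> x = x"
    and h: "h \<in> carrier G"
  shows "\<exists>\<theta>. rhom (N C) \<theta> \<and> (\<forall>x\<in>C. \<theta> x = \<rho> x) \<and> \<theta> t = t \<and> \<theta> (Z \<one>) = Z h"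
proof -
  have "poly P t = 0 \<longleftrightarrow> poly (map_poly \<rho> P) t = 0" if P: "P \<in> polys C" for P
  proof -
    have "poly P t = 0 \<longleftrightarrow> P = 0" using t_sub[OF C(3)] P unfolding alg_def by auto
    moreover have "poly (map_poly \<rho> P) t = 0 \<longleftrightarrow> map_poly \<rho> P = 0"
      using t_Kbar map_poly_polys[OF \<rho>(1) P \<rho>(2)] unfolding alg_def by auto
    moreover have "map_poly \<rho> P = 0 \<longleftrightarrow> P = 0"
    proof
      assume "map_poly \<rho> P = 0"
      then have "\<rho> (coeff P i) = 0" for i using coeff_map[OF \<rho>(1), of P i] by simp
      then show "P = 0" using rhom_field_nz[OF \<rho>(1) C(1) polysD[OF P]] by (intro poly_eqI) auto
    qed simp
    ultimately show ?thesis by blast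
  qed
  then obtain \<rho>1 where \<rho>1: "rhom (field_adjoin C {t}) \<rho>1" "\<And>x. x \<in> C \<Longrightarrow> \<rho>1 x = \<rho> x" "\<rho>1 t = t"
    using rhom_extend_field[OF C(1) \<rho>(1), of t t] by metis
  note a = field_adjoin_props[where K = C and S = "{t}"]
  have tC: "t \<in> field_adjoin C {t}" using a(3) by blast
  have fC: "f \<in> polys (polys C)" using f(1) polys_mono[OF polys_mono[OF C(2)]] by blast
  have sf: "spec t f \<in> polys (field_adjoin C {t})" by (rule spec_field_adjoin[OF fC])
  have sub: "K0 \<subseteq> field_adjoin C {t}" using C(2) a(2) by (rule subset_trans)
  have fix1: "\<rho>1 x = x" if "x \<in> K0" for x
    using \<rho>1(2)[of x] \<rho>(3)[OF that] that C(2) by (simp add: subset_iff)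
  have mf: "map_poly \<rho>1 (spec t f) = spec t f"
    using map_spec_fixed[OF \<rho>1(1) sub tC fix1 f(1)] \<rho>1(3) by simp
  have lead: "lead_coeff (spec t f) = 1" by (rule spec_monic(2)[OF f(2)])
  have deg: "degree (spec t f) = n" using spec_monic(1)[OF f(2)] degree_f by simp
  have min: "r = 0" if r: "r \<in> polys (field_adjoin C {t})" "degree r < degree (spec t f)" "poly r (Z \<one>) = 0" for r
  proof -
    obtain q P where q: "q \<in> polys C" "poly q t \<noteq> 0" and P: "P \<in> polys (polys C)" "degree P \<le> degree r" "spec t P = smult (poly q t) r"
      using clear_denominators[OF C(1) r(1)] by blast
    have "P = 0"
    proof (rule f_minimal[OF _ _ L.one_closed])
      show "P \<in> polys (polys Kbar)" using P(1) polys_mono[OF polys_mono[OF C(3)]] by blast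
      show "degree P < n" using P(2) r(2) deg by simp
      show "poly (spec t P) (Z \<one>) = 0" using r(3) by (simp add: P(3))
    qed
    then show "r = 0" using P(3) q(2) by (simp add: spec_simps)
  qed
  have al: "alg (field_adjoin C {t}) (Z \<one>)" using sf lead f_root[OF L.one_closed] by (intro algI[of "spec t f"]) auto
  have "poly (map_poly \<rho>1 P) (Z h) = 0" if "P \<in> polys (field_adjoin C {t})" "poly P (Z \<one>) = 0" for P
    by (rule minimal_vanishing[OF \<rho>1(1) sf lead f_root[OF L.one_closed] _ min that]) (use mf f_root[OF h] in simp)
  then obtain \<theta> where "rhom (N C) \<theta>" "\<And>x. x \<in> field_adjoin C {t} \<Longrightarrow> \<theta> x = \<rho>1 x" "\<theta> (Z \<one>) = Z h"
    using rhom_extend_alg[OF a(1) \<rho>1(1) al, of "Z h"] by metis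
  moreover have "C \<subseteq> field_adjoin C {t}" by (rule a(2))
  ultimately show ?thesis using \<rho>1(2,3) tC by (intro exI[of _ \<theta>]) auto
qed

section \<open>The action of two copies of \<open>G\<close>\<close>

abbreviation "M \<equiv> N L"

text \<open>The first component translates the \<open>Z g\<close>, the second acts on
  \<open>L\<close> by \<open>\<tau>\<close>. By \<open>M_agree\<close> these data determine the
  chosen map on \<open>M\<close>.\<close>

definition act :: "'g \<times> 'g \<Rightarrow> 'a \<Rightarrow> 'a" where
  "act p = (SOME \<theta>. rhom M \<theta> \<and> (\<forall>x\<in>L. \<theta> x = \<tau> (snd p) x) \<and> \<theta> t = t \<and> \<theta> (Z \<one>) = Z (fst p))"

lemma K0L: "K0 \<subseteq> L" using K0(2) L.E_subset by blast

lemma act_props: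
  assumes h: "h \<in> carrier G" and k: "k \<in> carrier G"
  shows "rhom M (act (h, k))" "x \<in> L \<Longrightarrow> act (h, k) x = \<tau> k x" "act (h, k) t = t"
    "g \<in> carrier G \<Longrightarrow> act (h, k) (Z g) = Z (h \<otimes> g)"
proof -
  have "\<exists>\<theta>. rhom M \<theta> \<and> (\<forall>x\<in>L. \<theta> x = \<tau> k x) \<and> \<theta> t = t \<and> \<theta> (Z \<one>) = Z h"
  proof (rule conjugation_exists[OF L.M K0L L_Kbar L.act_hom[OF k] _ _ h])
    show "\<tau> k ` L \<subseteq> Kbar" using L.act_closed[OF k] L_Kbar by blast
    show "\<tau> k x = x" if "x \<in> K0" for x using L.act_E[OF k] K0(2) that by blast
  qed
  from someI_ex[OF this] have *: "rhom M (act (h, k)) \<and> (\<forall>x\<in>L. act (h, k) x = \<tau> k x) \<and> act (h, k) t = t \<and> act (h, k) (Z \<one>) = Z h"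
    unfolding act_def by simp
  then show a: "rhom M (act (h, k))" "act (h, k) t = t" and b: "x \<in> L \<Longrightarrow> act (h, k) x = \<tau> k x" by auto
  show "act (h, k) (Z g) = Z (h \<otimes> g)" if "g \<in> carrier G"
  proof (rule conjugate_Z[OF a(1) _ a(2) _ K0L that h])
    fix x assume x: "x \<in> K0"
    then have "x \<in> L" using K0L by blast
    moreover have "\<tau> k x = x" using L.act_E[OF k] K0(2) x by blast
    ultimately show "act (h, k) x = x" using * by metis
  qed (use * in simp)
qed

lemma M_agree:
  fixes \<alpha> \<beta> :: "'a \<Rightarrow> 'a"
  assumes "rhom M \<alpha>" "rhom M \<beta>" "\<And>x. x \<in> L \<Longrightarrow> \<alpha> x = \<beta> x" "\<alpha> t = \<beta> t" "\<alpha> (Z \<one>) = \<beta> (Z \<one>)" "x \<in> M"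
  shows "\<alpha> x = \<beta> x"
proof -
  have "M \<subseteq> {x \<in> M. \<alpha> x = \<beta> x}"
  proof (rule N_props(6)[OF sfield_equalizer[OF N_props(1) assms(1,2)]])
    show "L \<subseteq> {x \<in> M. \<alpha> x = \<beta> x}" using assms(3) N_props(2)[of L] by blast
    show "t \<in> {x \<in> M. \<alpha> x = \<beta> x}" using assms(4) N_props(3) by blast
    show "Z \<one> \<in> {x \<in> M. \<alpha> x = \<beta> x}" using assms(5) N_props(4) by blast
  qed
  then show ?thesis using assms(6) by blast
qed

lemma act_fixes:
  assumes hk: "h \<in> carrier G" "k \<in> carrier G" and C: "C \<subseteq> L" "\<And>x. x \<in> C \<Longrightarrow> \<tau> k x = x" and x: "x \<in> field_adjoin C {t}"
  shows "act (h, k) x = x"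
proof -
  have "field_adjoin C {t} \<subseteq> {x \<in> M. act (h, k) x = x}"
  proof (rule field_adjoin_props(4))
    show "sfield {x \<in> M. act (h, k) x = x}"
      by (rule sfield_equalizer[OF N_props(1) act_props(1)[OF hk] rhom_id[OF sfieldD(1)[OF N_props(1)]]])
    show "C \<subseteq> {x \<in> M. act (h, k) x = x}"
    proof
      fix x assume "x \<in> C"
      then have "x \<in> L" "x \<in> M" "\<tau> k x = x" using C N_props(2)[of L] by auto
      then show "x \<in> {x \<in> M. act (h, k) x = x}" using act_props(2)[OF hk] by simp
    qed
    show "{t} \<subseteq> {x \<in> M. act (h, k) x = x}" using act_props(3)[OF hk] N_props(3) by blast
  qed
  then show ?thesis using x by blast
qed

text \<open>The laws are checked on the generators \<open>L\<close>, \<open>t\<close> and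
  \<open>Z \<one>\<close> of \<open>M\<close>. An element fixed by all pairs is brought down first
  to \<open>L(t)\<close> by the pairs \<open>(g, \<one>)\<close>, then to \<open>K(t)\<close> by the
  pairs \<open>(\<one>, g)\<close>, each time with \<open>fixed_by_conjugations\<close>.\<close>

sublocale A: galois_action "G \<times>\<times> G" "field_adjoin K {t}" M act
proof (intro galois_action.intro galois_action_axioms.intro)
  show "group (G \<times>\<times> G)" by (rule DirProd_group[OF L.is_group L.is_group])
  show "finite (carrier (G \<times>\<times> G))" using L.finite_G by simp
  show "sfield (field_adjoin K {t})" by (rule field_adjoin_props(1))
  show "sfield M" by (rule N_props(1))
  show "rhom M (act p)" if "p \<in> carrier (G \<times>\<times> G)" for p using that act_props(1) by auto
  show cl: "act p x \<in> M" if p: "p \<in> carrier (G \<times>\<times> G)" and x: "x \<in> M" for p x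
  proof -
    obtain h k where hk: "p = (h, k)" "h \<in> carrier G" "k \<in> carrier G" using p by auto
    have "M \<subseteq> {x \<in> M. act p x \<in> M}"
    proof (rule N_props(6))
      show "sfield {x \<in> M. act p x \<in> M}"
        unfolding hk(1) by (rule sfield_vimage[OF N_props(1) act_props(1)[OF hk(2,3)] N_props(1)])
      show "L \<subseteq> {x \<in> M. act p x \<in> M}"
        using act_props(2)[OF hk(2,3)] L.act_closed[OF hk(3)] N_props(2)[of L] unfolding hk(1) by auto
      show "t \<in> {x \<in> M. act p x \<in> M}" using act_props(3)[OF hk(2,3)] N_props(3) unfolding hk(1) by simp
      show "Z \<one> \<in> {x \<in> M. act p x \<in> M}"
        using act_props(4)[OF hk(2,3) L.one_closed] N_props(4) Z_in_N[OF K0L hk(2)] hk(2) unfolding hk(1) by simp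
    qed
    then show ?thesis using x by blast
  qed
  show "act (p \<otimes>\<^bsub>G \<times>\<times> G\<^esub> q) x = act p (act q x)" if p: "p \<in> carrier (G \<times>\<times> G)" and q: "q \<in> carrier (G \<times>\<times> G)" and x: "x \<in> M" for p q x
  proof -
    obtain h k where hk: "p = (h, k)" "h \<in> carrier G" "k \<in> carrier G" using p by auto
    obtain h' k' where hk': "q = (h', k')" "h' \<in> carrier G" "k' \<in> carrier G" using q by auto
    have m: "p \<otimes>\<^bsub>G \<times>\<times> G\<^esub> q = (h \<otimes> h', k \<otimes> k')" by (simp add: hk hk')
    note hh = L.m_closed[OF hk(2) hk'(2)] L.m_closed[OF hk(3) hk'(3)]
    note P1 = act_props[OF hh] and P2 = act_props[OF hk(2,3)] and P3 = act_props[OF hk'(2,3)]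
    show ?thesis unfolding m
    proof (rule M_agree[OF P1(1) _ _ _ _ x])
      show "rhom M (\<lambda>x. act p (act q x))"
        using rhom_comp[OF P3(1) P2(1)] cl[OF q] unfolding hk(1) hk'(1) by auto
      show "act (h \<otimes> h', k \<otimes> k') x = act p (act q x)" if "x \<in> L" for x
        using that P1(2) P2(2) P3(2) L.act_mult[OF hk(3) hk'(3)] L.act_closed[OF hk'(3)] unfolding hk(1) hk'(1) by simp
      show "act (h \<otimes> h', k \<otimes> k') t = act p (act q t)" using P1(3) P2(3) P3(3) unfolding hk(1) hk'(1) by simp
      show "act (h \<otimes> h', k \<otimes> k') (Z \<one>) = act p (act q (Z \<one>))"
        using P1(4)[OF L.one_closed] P2(4)[OF hk'(2)] P3(4)[OF L.one_closed] hk(2) hk'(2) unfolding hk(1) hk'(1) by simp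
    qed
  qed
  fix x
  note b = field_adjoin_props[where K = K and S = "{t}"]
  show "x \<in> field_adjoin K {t} \<longleftrightarrow> x \<in> M \<and> (\<forall>p\<in>carrier (G \<times>\<times> G). act p x = x)"
  proof (intro iffI conjI ballI)
    assume x: "x \<in> field_adjoin K {t}"
    have "K \<subseteq> M" using L.E_subset N_props(2)[of L] by blast
    then have "field_adjoin K {t} \<subseteq> M" using N_props(3)[of L] by (intro b(4) N_props(1)) auto
    then show "x \<in> M" using x by blast
    fix p assume "p \<in> carrier (G \<times>\<times> G)"
    then show "act p x = x" using act_fixes[OF _ _ L.E_subset _ x] L.act_E by auto
  next
    assume "x \<in> M \<and> (\<forall>p\<in>carrier (G \<times>\<times> G). act p x = x)"
    then have x: "x \<in> M" and fx: "\<And>h k. h \<in> carrier G \<Longrightarrow> k \<in> carrier G \<Longrightarrow> act (h, k) x = x" by auto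
    have xL: "x \<in> field_adjoin L {t}"
    proof (rule fixed_by_conjugations[OF field_adjoin_props(1) L.finite_G Z(1) L.one_closed _ x])
      show "(\<Prod>g\<in>carrier G. [:- Z g, 1:]) \<in> polys (field_adjoin L {t})"
        unfolding f(4)[symmetric] using spec_field_adjoin f(1) polys_mono[OF polys_mono[OF K0L]] by blast
      fix g assume g: "g \<in> carrier G"
      have "\<forall>e\<in>field_adjoin L {t}. act (g, \<one>) e = e"
        using act_fixes[OF g L.one_closed subset_refl] L.act_one by blast
      moreover have "act (g, \<one>) (Z \<one>) = Z g" using act_props(4)[OF g L.one_closed L.one_closed] g by simp
      ultimately show "\<exists>Na \<theta>. rhom Na \<theta> \<and> field_adjoin L {t} \<subseteq> Na \<and> Z \<one> \<in> Na \<and> (\<forall>e\<in>field_adjoin L {t}. \<theta> e = e) \<and> \<theta> (Z \<one>) = Z g \<and> \<theta> x = x"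
        using act_props(1)[OF g L.one_closed] N_props(4,5) fx[OF g L.one_closed] by blast
    qed
    let ?E = "field_adjoin K {t}"
    note c = field_adjoin_props[where K = ?E and S = "{w}"]
    have KE: "K \<subseteq> ?E" by (rule b(2))
    have sub: "field_adjoin L {t} \<subseteq> field_adjoin ?E {w}"
    proof (rule field_adjoin_props(4)[OF c(1)])
      show "L \<subseteq> field_adjoin ?E {w}"
      proof
        fix v assume v: "v \<in> L"
        obtain h where "h \<in> polys K" "\<And>g. g \<in> carrier G \<Longrightarrow> \<tau> g v = poly h (\<tau> g w)"
          using L.primitive_polynomial[OF w v] by blast
        from this(1) this(2)[OF L.one_closed] have "h \<in> polys ?E" "v = poly h w"
          using L.act_one v w(1) polys_mono[OF KE] by auto
        then show "v \<in> field_adjoin ?E {w}" using poly_in_field_adjoin[of h ?E w] by simp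
      qed
      show "{t} \<subseteq> field_adjoin ?E {w}" using b(3) c(2) by blast
    qed
    have w1: "\<tau> \<one> w = w" by (rule L.act_one[OF w(1)])
    show "x \<in> ?E"
    proof (rule fixed_by_conjugations[OF b(1) L.finite_G w(2) L.one_closed])
      show "(\<Prod>g\<in>carrier G. [:- \<tau> g w, 1:]) \<in> polys ?E"
        using L.conjugates_polynomial[OF w(1)] polys_mono[OF KE] by blast
      show "x \<in> field_adjoin ?E {\<tau> \<one> w}" unfolding w1 using sub xL by blast
      fix g assume g: "g \<in> carrier G"
      have "\<forall>e\<in>?E. act (\<one>, g) e = e" using act_fixes[OF L.one_closed g L.E_subset] L.act_E[OF g] by blast
      moreover have "act (\<one>, g) w = \<tau> g w" using act_props(2)[OF L.one_closed g w(1)] .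
      moreover have "?E \<subseteq> M" using L.E_subset N_props(2,3)[of L] by (intro b(4) N_props(1)) auto
      moreover have "w \<in> M" using w(1) N_props(2)[of L] by blast
      ultimately show "\<exists>Na \<theta>. rhom Na \<theta> \<and> ?E \<subseteq> Na \<and> \<tau> \<one> w \<in> Na \<and> (\<forall>e\<in>?E. \<theta> e = e) \<and> \<theta> (\<tau> \<one> w) = \<tau> g w \<and> \<theta> x = x"
        unfolding w1 using act_props(1)[OF L.one_closed g] fx[OF L.one_closed g] by blast
    qed
  qed
qed

text \<open>For \<open>j = 1\<close> these are the elements fixed by the diagonal.\<close>

definition Y :: "'a \<Rightarrow> 'g \<Rightarrow> 'a" where
  "Y \<gamma> j = (\<Sum>g\<in>carrier G. \<tau> g \<gamma> * Z (j \<otimes> g))"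

lemma L_M: "x \<in> L \<Longrightarrow> x \<in> M" using N_props(2)[of L] by blast

lemma Y_in: "\<gamma> \<in> L \<Longrightarrow> j \<in> carrier G \<Longrightarrow> Y \<gamma> j \<in> M"
  unfolding Y_def
  by (intro sring_sum[OF sfieldD(1)[OF N_props(1)]] sringD(6)[OF sfieldD(1)[OF N_props(1)]] L_M L.act_closed Z_in_N[OF K0L] L.m_closed)

text \<open>The sum is reindexed by translation with \<open>k\<close>. The stabilizer of the index
  \<open>\<one>\<close> is the diagonal, and the action on indices is transitive, so the
  \<open>Y \<gamma> j\<close> are all the conjugates of \<open>Y \<gamma> \<one>\<close> over
  \<open>K(t)\<close>.\<close>

lemma act_Y:
  assumes \<gamma>: "\<gamma> \<in> L" and j: "j \<in> carrier G" and h: "h \<in> carrier G" and k: "k \<in> carrier G"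
  shows "act (h, k) (Y \<gamma> j) = Y \<gamma> (h \<otimes> j \<otimes> inv k)"
proof -
  note S = sringD[OF sfieldD(1)[OF N_props(1)]]
  have i: "\<tau> g \<gamma> \<in> M" "Z (j \<otimes> g) \<in> M" if "g \<in> carrier G" for g
    using that L_M L.act_closed[OF that \<gamma>] Z_in_N[OF K0L] j by auto
  have "act (h, k) (Y \<gamma> j) = (\<Sum>g\<in>carrier G. act (h, k) (\<tau> g \<gamma> * Z (j \<otimes> g)))"
    unfolding Y_def by (intro rhom_sum[OF act_props(1)[OF h k]] S(6) i)
  also have "\<dots> = (\<Sum>g\<in>carrier G. \<tau> (k \<otimes> g) \<gamma> * Z (h \<otimes> j \<otimes> inv k \<otimes> (k \<otimes> g)))"
  proof (intro sum.cong refl)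
    fix g assume g: "g \<in> carrier G"
    have "h \<otimes> j \<otimes> inv k \<otimes> (k \<otimes> g) = h \<otimes> (j \<otimes> g)"
      using g h j k by (simp add: L.m_assoc) (simp add: L.m_assoc[symmetric])
    then show "act (h, k) (\<tau> g \<gamma> * Z (j \<otimes> g)) = \<tau> (k \<otimes> g) \<gamma> * Z (h \<otimes> j \<otimes> inv k \<otimes> (k \<otimes> g))"
      using rhomD(7)[OF act_props(1)[OF h k] i[OF g]] act_props(2)[OF h k L.act_closed[OF g \<gamma>]]
        act_props(4)[OF h k L.m_closed[OF j g]] L.act_mult[OF k g \<gamma>] by simp
  qed
  also have "\<dots> = Y \<gamma> (h \<otimes> j \<otimes> inv k)"
    unfolding Y_def by (rule sum.reindex_bij_betw[OF L.translation_bij[OF k]])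
  finally show ?thesis .
qed

lemma twist_bij:
  assumes "h \<in> carrier G" "k \<in> carrier G"
  shows "bij_betw (\<lambda>j. h \<otimes> j \<otimes> inv k) (carrier G) (carrier G)"
  using assms by (intro bij_betwI[where g = "\<lambda>j. inv h \<otimes> j \<otimes> k"]) (auto simp: L.m_assoc, auto simp: L.m_assoc[symmetric])

lemma Y_perm:
  assumes "p \<in> carrier (G \<times>\<times> G)"
  shows "\<exists>\<pi>. bij_betw \<pi> (carrier G) (carrier G) \<and> (\<forall>\<gamma>\<in>L. \<forall>j\<in>carrier G. act p (Y \<gamma> j) = Y \<gamma> (\<pi> j))"
proof -
  obtain h k where hk: "p = (h, k)" "h \<in> carrier G" "k \<in> carrier G" using assms by auto
  then show ?thesis using twist_bij[OF hk(2,3)] act_Y[OF _ _ hk(2,3)] by blast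
qed

lemma Y_power: "Y (w ^ i) j = (\<Sum>g\<in>carrier G. \<tau> g w ^ i * Z (j \<otimes> g))"
  unfolding Y_def using rhom_power[OF L.act_hom w(1)] by (intro sum.cong) auto

text \<open>For \<open>\<gamma>\<close> a polynomial in \<open>w\<close> with coefficients
  \<open>c ^ i\<close>, the value \<open>Y \<gamma> j\<close> is \<open>P j\<close> evaluated at
  \<open>c\<close>. By Vandermonde the \<open>P j\<close> are nonzero and distinct because the
  \<open>Z g\<close> are, so all but finitely many \<open>c\<close> in \<open>K0\<close> are
  suitable.\<close>

lemma primitive_twist:
  obtains \<gamma> where "\<gamma> \<in> L" "inj_on (Y \<gamma>) (carrier G)" "\<And>j. j \<in> carrier G \<Longrightarrow> Y \<gamma> j \<noteq> 0"
proof -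
  define P where "P h = (\<Sum>i<n. monom (Y (w ^ i) h) i)" for h
  have cP: "coeff (P h) i = Y (w ^ i) h" if "i < n" for h i
    using that by (simp add: P_def coeff_sum)
  have nz: "P h \<noteq> 0" if h: "h \<in> carrier G" for h
  proof
    assume "P h = 0"
    then have "(\<Sum>g\<in>carrier G. \<tau> g w ^ i * Z (h \<otimes> g)) = 0" if "i < n" for i using cP[OF that, of h] by (simp add: Y_power)
    then have "Z (h \<otimes> \<one>) = 0" by (rule vandermonde_trivial[OF L.finite_G w(2) _ L.one_closed])
    then show False using Z(2) h by simp
  qed
  have ne: "P h - P k \<noteq> 0" if hk: "h \<in> carrier G" "k \<in> carrier G" "h \<noteq> k" for h k
  proof
    assume "P h - P k = 0"
    then have "Y (w ^ i) h = Y (w ^ i) k" if "i < n" for i using cP[OF that, of h] cP[OF that, of k] by simp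
    then have "(\<Sum>g\<in>carrier G. \<tau> g w ^ i * (Z (h \<otimes> g) - Z (k \<otimes> g))) = 0" if "i < n" for i
      using that by (simp add: Y_power right_diff_distrib sum_subtractf)
    then have "Z (h \<otimes> \<one>) - Z (k \<otimes> \<one>) = 0" by (rule vandermonde_trivial[OF L.finite_G w(2) _ L.one_closed])
    then show False using hk Z(1) by (auto simp: inj_on_def)
  qed
  define D where "D = {(h, k). h \<in> carrier G \<and> k \<in> carrier G \<and> h \<noteq> k}"
  have finD: "finite D" by (rule finite_subset[of _ "carrier G \<times> carrier G"]) (auto simp: D_def L.finite_G)
  define bad where "bad = (\<Union>h\<in>carrier G. {c. poly (P h) c = 0}) \<union> (\<Union>d\<in>D. {c. poly (P (fst d) - P (snd d)) c = 0})"
  have "finite bad" unfolding bad_def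
    by (intro finite_UnI finite_UN_I L.finite_G finD poly_roots_finite nz) (use ne in \<open>auto simp: D_def\<close>)
  then obtain c where c: "c \<in> K0" "c \<notin> bad" using K0(3) by (meson finite_subset subsetI)
  have cL: "c \<in> L" using c K0L by blast
  note S = sringD[OF sfieldD(1)[OF L.M]]
  define \<gamma> where "\<gamma> = (\<Sum>i<n. c ^ i * w ^ i)"
  have tm: "c ^ i * w ^ i \<in> L" for i by (intro S(6) sring_power[OF sfieldD(1)[OF L.M]] cL w(1))
  have \<gamma>L: "\<gamma> \<in> L" unfolding \<gamma>_def by (intro sring_sum[OF sfieldD(1)[OF L.M]] tm)
  have tau: "\<tau> g \<gamma> = (\<Sum>i<n. c ^ i * \<tau> g w ^ i)" if g: "g \<in> carrier G" for g
  proof -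
    have "\<tau> g \<gamma> = (\<Sum>i<n. \<tau> g (c ^ i * w ^ i))" unfolding \<gamma>_def by (rule rhom_sum[OF L.act_hom[OF g] tm])
    also have "\<dots> = (\<Sum>i<n. c ^ i * \<tau> g w ^ i)"
    proof (intro sum.cong refl)
      fix i
      have "\<tau> g c = c" using L.act_E[OF g] K0(2) c(1) by blast
      then show "\<tau> g (c ^ i * w ^ i) = c ^ i * \<tau> g w ^ i"
        using rhomD(7)[OF L.act_hom[OF g], of "c ^ i" "w ^ i"] rhom_power[OF L.act_hom[OF g]] cL w(1)
          sring_power[OF sfieldD(1)[OF L.M]] by simp
    qed
    finally show ?thesis .
  qed
  have Yc: "Y \<gamma> j = poly (P j) c" for j
  proof -
    have "poly (P j) c = (\<Sum>i<n. \<Sum>g\<in>carrier G. c ^ i * \<tau> g w ^ i * Z (j \<otimes> g))"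
      unfolding P_def poly_sum Y_power by (intro sum.cong refl) (simp add: poly_monom sum_distrib_right sum_distrib_left mult_ac)
    also have "\<dots> = (\<Sum>g\<in>carrier G. \<Sum>i<n. c ^ i * \<tau> g w ^ i * Z (j \<otimes> g))" by (rule sum.swap)
    also have "\<dots> = Y \<gamma> j" unfolding Y_def by (intro sum.cong refl) (simp add: tau sum_distrib_right)
    finally show ?thesis by simp
  qed
  have "inj_on (Y \<gamma>) (carrier G)"
  proof (rule inj_onI, rule ccontr)
    fix h k assume hk: "h \<in> carrier G" "k \<in> carrier G" "Y \<gamma> h = Y \<gamma> k" "h \<noteq> k"
    then have "c \<in> {c. poly (P (fst (h, k)) - P (snd (h, k))) c = 0}" "(h, k) \<in> D" by (auto simp: Yc D_def)
    then show False using c(2) unfolding bad_def by blast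
  qed
  moreover have "Y \<gamma> j \<noteq> 0" if "j \<in> carrier G" for j using that c(2) unfolding bad_def Yc by blast
  ultimately show thesis using that \<gamma>L by blast
qed

lemma separable_adjoin:
  assumes "u \<in> M" shows "separable_algebraic_extension (field_adjoin K {t}) (field_adjoin K {t, u})"
proof -
  note a = field_adjoin_props[where K = K and S = "{t, u}"] and b = field_adjoin_props[where K = K and S = "{t}"]
  have "K \<subseteq> M" using L.E_subset N_props(2)[of L] by blast
  then have "field_adjoin K {t, u} \<subseteq> M" using N_props(3)[of L] assms by (intro a(4) N_props(1)) auto
  moreover have "field_adjoin K {t} \<subseteq> field_adjoin K {t, u}" using a(1-3) by (intro b(4)) auto
  ultimately show ?thesis
    unfolding separable_algebraic_extension_def field_extension_def subfield_Dom
    using a(1) b(1) A.separable_E by blast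
qed

text \<open>The product runs over ordered pairs, so translations permute its factors without
  introducing a sign.\<close>

lemma discriminant_in: "(\<Prod>(i, j)\<in>{(i, j). i \<in> carrier G \<and> j \<in> carrier G \<and> i \<noteq> j}. Z i - Z j) \<in> field_adjoin K {t}"
proof -
  let ?D = "{(i, j). i \<in> carrier G \<and> j \<in> carrier G \<and> i \<noteq> j}"
  have i: "(case d of (i, j) \<Rightarrow> Z i - Z j) \<in> M" if "d \<in> ?D" for d
    using that Z_in_N[OF K0L] sringD(5)[OF sfieldD(1)[OF N_props(1)]] by auto
  have "act p (\<Prod>(i, j)\<in>?D. Z i - Z j) = (\<Prod>(i, j)\<in>?D. Z i - Z j)" if p: "p \<in> carrier (G \<times>\<times> G)" for p
  proof -
    obtain h k where hk: "p = (h, k)" "h \<in> carrier G" "k \<in> carrier G" using p by auto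
    note a = act_props[OF hk(2,3)]
    have "act p (\<Prod>(i, j)\<in>?D. Z i - Z j) = (\<Prod>d\<in>?D. act p (case d of (i, j) \<Rightarrow> Z i - Z j))"
      unfolding hk(1) by (rule rhom_prod[OF a(1) i])
    also have "\<dots> = (\<Prod>d\<in>?D. case (h \<otimes> fst d, h \<otimes> snd d) of (i, j) \<Rightarrow> Z i - Z j)"
      using rhomD(6)[OF a(1)] Z_in_N[OF K0L] a(4) unfolding hk(1) by (intro prod.cong) auto
    also have "\<dots> = (\<Prod>(i, j)\<in>?D. Z i - Z j)"
    proof (rule prod.reindex_bij_betw)
      show "bij_betw (\<lambda>d. (h \<otimes> fst d, h \<otimes> snd d)) ?D ?D"
        using hk by (intro bij_betwI[where g = "\<lambda>d. (inv h \<otimes> fst d, inv h \<otimes> snd d)"]) (auto simp: L.m_assoc[symmetric])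
    qed
    finally show ?thesis .
  qed
  moreover have "(\<Prod>(i, j)\<in>?D. Z i - Z j) \<in> M" by (rule sring_prod[OF sfieldD(1)[OF N_props(1)] i])
  ultimately show ?thesis using A.act_fixed by blast
qed

end

section \<open>Regularity of the diagonal field, and specialization\<close>

context field_crossing
begin

text \<open>This is the regularity of the diagonal field. The maps \<open>act\<close> only control
  \<open>L\<close>, so maps fixing all of \<open>Kbar\<close> are used: sending
  \<open>Z \<one>\<close> to \<open>Z j\<close> carries \<open>Y \<gamma> \<one>\<close> to
  \<open>Y \<gamma> j\<close>, and a relation over \<open>Kbar\<close> acquires \<open>n\<close>
  distinct roots. The factor \<open>c\<close> accounts for the later scaling.\<close>

lemma twist_minimal:
  assumes \<gamma>: "\<gamma> \<in> L" "inj_on (Y \<gamma>) (carrier G)" and c: "c \<in> polys K" "poly c t \<noteq> 0"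
    and r: "r \<in> polys (polys Kbar)" "degree r < n" "poly (spec t r) (poly c t * Y \<gamma> \<one>) = 0"
  shows "r = 0"
proof -
  have K0b: "K0 \<subseteq> Kbar" using K0(2) Kbar(2) by blast
  have "spec t r = 0"
  proof (rule interpolation_unique[OF L.finite_G, of "\<lambda>j. poly c t * Y \<gamma> j"])
    show "inj_on (\<lambda>j. poly c t * Y \<gamma> j) (carrier G)" using \<gamma>(2) c(2) by (auto simp: inj_on_def)
    show "degree (spec t r) < n" using degree_spec_le[of t r] r(2) by simp
    show "degree (0 :: 'a poly) < n" using n_pos by simp
    fix j assume j: "j \<in> carrier G"
    have "\<exists>\<theta>. rhom (N Kbar) \<theta> \<and> (\<forall>x\<in>Kbar. \<theta> x = x) \<and> \<theta> t = t \<and> \<theta> (Z \<one>) = Z j"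
      by (rule conjugation_exists[OF Kbar(1) K0b subset_refl rhom_id[OF sfieldD(1)[OF Kbar(1)]] _ _ j]) auto
    then obtain \<theta> where \<theta>: "rhom (N Kbar) \<theta>" "\<And>x. x \<in> Kbar \<Longrightarrow> \<theta> x = x" "\<theta> t = t" "\<theta> (Z \<one>) = Z j" by blast
    have \<theta>Z: "\<theta> (Z g) = Z (j \<otimes> g)" if "g \<in> carrier G" for g
      by (rule conjugate_Z[OF \<theta>(1) _ \<theta>(3,4) K0b that j]) (use \<theta>(2) K0b in blast)
    have LN: "x \<in> N Kbar" if "x \<in> L" for x using that L_Kbar N_props(2)[of Kbar] by blast
    have tm: "\<tau> g \<gamma> * Z (\<one> \<otimes> g) \<in> N Kbar" if "g \<in> carrier G" for g
      by (rule sringD(6)[OF sfieldD(1)[OF N_props(1)] LN[OF L.act_closed[OF that \<gamma>(1)]] Z_in_N[OF K0b]]) (use that in simp)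
    have YN: "Y \<gamma> \<one> \<in> N Kbar" unfolding Y_def by (rule sring_sum[OF sfieldD(1)[OF N_props(1)] tm])
    have "\<theta> (Y \<gamma> \<one>) = (\<Sum>g\<in>carrier G. \<theta> (\<tau> g \<gamma> * Z (\<one> \<otimes> g)))" unfolding Y_def by (rule rhom_sum[OF \<theta>(1) tm])
    also have "\<dots> = Y \<gamma> j" unfolding Y_def
    proof (intro sum.cong refl)
      fix g assume g: "g \<in> carrier G"
      have "\<tau> g \<gamma> \<in> L" by (rule L.act_closed[OF g \<gamma>(1)])
      then have "\<theta> (\<tau> g \<gamma>) = \<tau> g \<gamma>" "\<tau> g \<gamma> \<in> N Kbar" using \<theta>(2) L_Kbar LN by blast+
      then show "\<theta> (\<tau> g \<gamma> * Z (\<one> \<otimes> g)) = \<tau> g \<gamma> * Z (j \<otimes> g)"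
        using rhomD(7)[OF \<theta>(1) _ Z_in_N[OF K0b g]] \<theta>Z[OF g] g by simp
    qed
    finally have \<theta>Y: "\<theta> (Y \<gamma> \<one>) = Y \<gamma> j" .
    have cN: "poly c t \<in> N Kbar"
      using c(1) polys_mono[OF subset_trans[OF Kbar(2) N_props(2)]] by (intro poly_in[OF sfieldD(1)[OF N_props(1)] _ N_props(3)]) blast
    have "\<theta> (poly c t) = poly c t"
      using rhom_poly_fixed[OF \<theta>(1) N_props(2,3) \<theta>(2), of c] c(1) polys_mono[OF Kbar(2)] \<theta>(3) by auto
    then have "\<theta> (poly c t * Y \<gamma> \<one>) = poly c t * Y \<gamma> j" using rhomD(7)[OF \<theta>(1) cN YN] \<theta>Y by simp
    moreover have "map_poly \<theta> (spec t r) = spec t r"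
      using map_spec_fixed[OF \<theta>(1) N_props(2,3) \<theta>(2) r(1)] \<theta>(3) by simp
    moreover have "spec t r \<in> polys (N Kbar)"
      using spec_field_adjoin[OF r(1)] polys_mono[OF N_props(5)] by blast
    moreover have "poly c t * Y \<gamma> \<one> \<in> N Kbar" by (rule sringD(6)[OF sfieldD(1)[OF N_props(1)] cN YN])
    ultimately have "poly (spec t r) (poly c t * Y \<gamma> j) = \<theta> (poly (spec t r) (poly c t * Y \<gamma> \<one>))"
      using poly_map[OF \<theta>(1), of "spec t r" "poly c t * Y \<gamma> \<one>"] by simp
    then show "poly (spec t r) (poly c t * Y \<gamma> j) = poly 0 (poly c t * Y \<gamma> j)" using r(3) rhomD(3)[OF \<theta>(1)] by simp
  qed
  show "r = 0"
  proof (rule poly_eqI)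
    fix i
    have "poly (coeff r i) t = 0" using arg_cong[OF \<open>spec t r = 0\<close>, of "\<lambda>p. coeff p i"] by (simp add: coeff_spec)
    then show "coeff r i = coeff 0 i" using t_Kbar polysD[OF r(1), of i] unfolding alg_def by auto
  qed
qed

text \<open>Each condition guards one step: \<open>\<delta>\<close> nonzero at
  \<open>\<phi> t\<close> keeps all specialized roots in the field that one of them generates over
  \<open>K0\<close>, \<open>disc\<close> keeps them distinct, and \<open>YR\<close> lets the Galois
  group of \<open>L\<close> over \<open>K\<close> permute them.\<close>

lemma occurs_of_point:
  assumes R: "rhom R \<phi>" "L \<subseteq> R" "t \<in> R" "\<And>x. x \<in> L \<Longrightarrow> \<phi> x = x"
    and a: "\<phi> t \<in> K0" "poly \<delta> (\<phi> t) \<noteq> 0"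
    and YR: "\<And>i. i < n \<Longrightarrow> Y (w ^ i) \<one> \<in> R" "\<And>i. i < n \<Longrightarrow> \<phi> (Y (w ^ i) \<one>) \<in> K"
    and disc: "\<phi> (\<Prod>(i, j)\<in>{(i, j). i \<in> carrier G \<and> j \<in> carrier G \<and> i \<noteq> j}. Z i - Z j) \<noteq> 0"
  shows "occurs_as_galois_group G K0"
proof -
  note S = rhomD(1)[OF R(1)]
  define zb where "zb g = \<phi> (Z g)" for g
  have K0R: "K0 \<subseteq> R" using K0L R(2) by blast
  have Z1: "Y (w ^ i) \<one> = (\<Sum>g\<in>carrier G. \<tau> g w ^ i * Z g)" for i
    unfolding Y_power by (intro sum.cong) auto
  have ZR: "Z g \<in> R \<and> zb g \<in> L" if g: "g \<in> carrier G" for g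
  proof -
    \<comment> \<open>The coefficients of \<open>l\<close> form a row of the inverse Vandermonde
      matrix: they recover \<open>Z g\<close> as an \<open>L\<close>-combination of the sums
      \<open>Y (w ^ i) \<one>\<close>.\<close>
    obtain l where l: "l \<in> polys L" "degree l < n" "\<And>h. h \<in> carrier G \<Longrightarrow> poly l (\<tau> h w) = (if h = g then 1 else 0)"
    proof (rule interpolation[OF L.M L.finite_G _ w(2), of "\<lambda>h. if h = g then 1 else 0"])
      show "(if h = g then 1 else 0) \<in> L" for h using sringD[OF sfieldD(1)[OF L.M]] by simp
    qed (use g L.act_closed w(1) in auto)
    have "(\<Sum>i\<le>degree l. coeff l i * Y (w ^ i) \<one>) = (\<Sum>h\<in>carrier G. poly l (\<tau> h w) * Z h)"
      unfolding Z1 poly_altdef sum_distrib_left sum_distrib_right by (subst sum.swap) (simp add: mult.assoc)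
    also have "\<dots> = (\<Sum>h\<in>carrier G. if h = g then Z g else 0)" using l(3) by (intro sum.cong) auto
    also have "\<dots> = Z g" using L.finite_G g by simp
    finally have Zg: "Z g = (\<Sum>i\<le>degree l. coeff l i * Y (w ^ i) \<one>)" ..
    have cl: "coeff l i \<in> R" for i using polysD[OF l(1)] R(2) by blast
    have lt: "i < n" if "i \<in> {..degree l}" for i using that l(2) by simp
    have tm: "coeff l i * Y (w ^ i) \<one> \<in> R" if "i \<in> {..degree l}" for i by (rule sringD(6)[OF S cl YR(1)[OF lt[OF that]]])
    have "Z g \<in> R" unfolding Zg by (rule sring_sum[OF S tm])
    moreover have "zb g = (\<Sum>i\<le>degree l. coeff l i * \<phi> (Y (w ^ i) \<one>))"
    proof -
      have "zb g = (\<Sum>i\<le>degree l. \<phi> (coeff l i * Y (w ^ i) \<one>))" unfolding zb_def Zg by (rule rhom_sum[OF R(1) tm])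
      also have "\<dots> = (\<Sum>i\<le>degree l. coeff l i * \<phi> (Y (w ^ i) \<one>))"
        by (intro sum.cong refl) (simp only: rhomD(7)[OF R(1) cl YR(1)[OF lt]] R(4)[OF polysD[OF l(1)]])
      finally show ?thesis .
    qed
    moreover have "\<dots> \<in> L"
    proof (intro sring_sum[OF sfieldD(1)[OF L.M]] sringD(6)[OF sfieldD(1)[OF L.M]] polysD[OF l(1)])
      show "\<phi> (Y (w ^ i) \<one>) \<in> L" if "i \<in> {..degree l}" for i using L.E_subset YR(2)[OF lt[OF that]] by blast
    qed
    ultimately show ?thesis by simp
  qed
  then have ZR: "Z g \<in> R" and zbL: "zb g \<in> L" if "g \<in> carrier G" for g using that by auto
  have pwL: "\<tau> g w ^ i \<in> L" if "g \<in> carrier G" for g i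
    by (rule sring_power[OF sfieldD(1)[OF L.M] L.act_closed[OF that w(1)]])
  have vand: "(\<Sum>g\<in>carrier G. \<tau> g w ^ i * zb g) = \<phi> (Y (w ^ i) \<one>)" for i
  proof -
    have tm: "\<tau> g w ^ i * Z g \<in> R" if "g \<in> carrier G" for g
      using sringD(6)[OF S _ ZR[OF that]] pwL[OF that] R(2) by blast
    have "\<phi> (Y (w ^ i) \<one>) = (\<Sum>g\<in>carrier G. \<phi> (\<tau> g w ^ i * Z g))" unfolding Z1 by (rule rhom_sum[OF R(1) tm])
    also have "\<dots> = (\<Sum>g\<in>carrier G. \<tau> g w ^ i * zb g)"
      using rhomD(7)[OF R(1) _ ZR] pwL R(2,4) unfolding zb_def by (intro sum.cong) (auto simp: subset_iff)
    finally show ?thesis by simp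
  qed
  \<comment> \<open>The values of the sums in \<open>vand\<close> lie in \<open>K\<close>, so \<open>\<tau> h\<close> maps the unique solution of this linear
    system to the solution of the system with permuted coefficients.\<close>
  have \<tau>zb: "\<tau> h (zb g) = zb (h \<otimes> g)" if h: "h \<in> carrier G" and g: "g \<in> carrier G" for g h
  proof -
    have "\<tau> h (zb g) - zb (h \<otimes> g) = 0"
    proof (rule vandermonde_trivial[OF L.finite_G, of "\<lambda>g. \<tau> (h \<otimes> g) w" "\<lambda>g. \<tau> h (zb g) - zb (h \<otimes> g)", OF _ _ g])
      show "inj_on (\<lambda>g. \<tau> (h \<otimes> g) w) (carrier G)"
        using comp_inj_on[of "\<lambda>g. h \<otimes> g" "carrier G" "\<lambda>g. \<tau> g w"] L.translation_bij[OF h] w(2)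
        by (auto simp: bij_betw_def comp_def)
      fix i assume i: "i < n"
      have tm: "\<tau> g w ^ i * zb g \<in> L" if "g \<in> carrier G" for g
        by (rule sringD(6)[OF sfieldD(1)[OF L.M] pwL[OF that] zbL[OF that]])
      have ht: "\<tau> h (\<tau> g w ^ i * zb g) = \<tau> (h \<otimes> g) w ^ i * \<tau> h (zb g)" if "g \<in> carrier G" for g
        using rhomD(7)[OF L.act_hom[OF h] pwL[OF that] zbL[OF that]] rhom_power[OF L.act_hom[OF h] L.act_closed[OF that w(1)]]
          L.act_mult[OF h that w(1)] by simp
      have "(\<Sum>g\<in>carrier G. \<tau> (h \<otimes> g) w ^ i * \<tau> h (zb g)) = \<tau> h (\<Sum>g\<in>carrier G. \<tau> g w ^ i * zb g)"
        using rhom_sum[OF L.act_hom[OF h], of "carrier G" "\<lambda>g. \<tau> g w ^ i * zb g"] tm ht by simp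
      also have "\<dots> = \<phi> (Y (w ^ i) \<one>)" unfolding vand by (rule L.act_E[OF h YR(2)[OF i]])
      also have "\<dots> = (\<Sum>g\<in>carrier G. \<tau> (h \<otimes> g) w ^ i * zb (h \<otimes> g))"
        unfolding vand[symmetric] by (rule sum.reindex_bij_betw[OF L.translation_bij[OF h], symmetric])
      finally show "(\<Sum>g\<in>carrier G. \<tau> (h \<otimes> g) w ^ i * (\<tau> h (zb g) - zb (h \<otimes> g))) = 0"
        by (simp add: right_diff_distrib sum_subtractf)
    qed
    then show ?thesis by simp
  qed
  have inj: "inj_on zb (carrier G)"
  proof (rule inj_onI, rule ccontr)
    let ?D = "{(i, j). i \<in> carrier G \<and> j \<in> carrier G \<and> i \<noteq> j}"
    fix g h assume gh: "g \<in> carrier G" "h \<in> carrier G" "zb g = zb h" "g \<noteq> h"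
    have fin: "finite ?D" by (rule finite_subset[of _ "carrier G \<times> carrier G"]) (auto simp: L.finite_G)
    have "\<phi> (case (g, h) of (i, j) \<Rightarrow> Z i - Z j) = 0" using gh rhomD(6)[OF R(1) ZR ZR] by (simp add: zb_def)
    then have "(\<Prod>d\<in>?D. \<phi> (case d of (i, j) \<Rightarrow> Z i - Z j)) = 0"
      using gh fin by (intro prod_zero) auto
    moreover have "\<phi> (\<Prod>(i, j)\<in>?D. Z i - Z j) = (\<Prod>d\<in>?D. \<phi> (case d of (i, j) \<Rightarrow> Z i - Z j))"
      by (rule rhom_prod[OF R(1)]) (use ZR sringD(5)[OF S] in auto)
    ultimately show False using disc by simp
  qed
  have fixK0: "\<phi> x = x" if "x \<in> K0" for x using R(4) K0L that by blast
  have mspec: "map_poly \<phi> (spec t P) = spec (\<phi> t) P" if "P \<in> polys (polys K0)" for P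
    by (rule map_spec_fixed[OF R(1) K0R R(3) fixK0 that])
  have specR: "spec t P \<in> polys R" if "P \<in> polys (polys K0)" for P
  proof -
    have "P \<in> polys (polys R)" using that polys_mono[OF polys_mono[OF K0R]] by blast
    then show ?thesis by (rule spec_in[OF S _ R(3)])
  qed
  have zb_rel: "poly \<delta> (\<phi> t) * zb (h \<otimes> g) = poly (spec (\<phi> t) (H g)) (zb h)" if g: "g \<in> carrier G" and h: "h \<in> carrier G" for g h
  proof -
    have "poly \<delta> t \<in> R" using poly_in[OF S _ R(3), of \<delta>] \<delta>(1) polys_mono[OF K0R] by blast
    then have "\<phi> (poly \<delta> t * Z (h \<otimes> g)) = \<phi> (poly \<delta> t) * zb (h \<otimes> g)"
      using rhomD(7)[OF R(1)] ZR[OF L.m_closed[OF h g]] by (simp add: zb_def)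
    moreover have "\<phi> (poly \<delta> t) = poly \<delta> (\<phi> t)" by (rule rhom_poly_fixed[OF R(1) K0R R(3) fixK0 \<delta>(1)])
    moreover have "\<phi> (poly (spec t (H g)) (Z h)) = poly (spec (\<phi> t) (H g)) (zb h)"
      using poly_map[OF R(1) specR[OF H(1)[OF g]] ZR[OF h]] mspec[OF H(1)[OF g]] by (simp add: zb_def)
    ultimately show ?thesis using H(2)[OF g h] by simp
  qed
  have prod: "(\<Prod>g\<in>carrier G. [:- zb g, 1:]) \<in> polys K0"
  proof -
    have lin: "[:- Z g, 1:] \<in> polys R" if "g \<in> carrier G" for g by (rule polys_linear[OF S ZR[OF that]])
    have "(\<Prod>g\<in>carrier G. [:- zb g, 1:]) = (\<Prod>g\<in>carrier G. map_poly \<phi> [:- Z g, 1:])"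
      unfolding zb_def by (intro prod.cong refl map_linear[OF R(1) ZR, symmetric])
    also have "\<dots> = map_poly \<phi> (\<Prod>g\<in>carrier G. [:- Z g, 1:])" by (rule rhom_prod[OF map_poly_rhom[OF R(1)] lin, symmetric])
    also have "\<dots> = spec (\<phi> t) f" unfolding f(4)[symmetric] by (rule mspec[OF f(1)])
    finally show ?thesis using spec_in[OF sfieldD(1)[OF K0(1)] f(1) a(1)] by simp
  qed
  \<comment> \<open>The wanted extension is a subfield of \<open>L\<close>, and \<open>G\<close>
    acts on it by restricting \<open>\<tau>\<close>.\<close>
  define L0 where "L0 = field_adjoin K0 {zb \<one>}"
  note b = field_adjoin_props[where K = K0 and S = "{zb \<one>}", folded L0_def]
  have L0L: "L0 \<subseteq> L" by (rule b(4)[OF L.M K0L]) (use zbL in simp)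
  have zb0: "zb g \<in> L0" if g: "g \<in> carrier G" for g
  proof -
    have "poly (spec (\<phi> t) (H g)) (zb \<one>) \<in> L0"
      unfolding L0_def by (rule poly_in_field_adjoin[OF spec_in[OF sfieldD(1)[OF K0(1)] H(1)[OF g] a(1)]])
    moreover have "poly \<delta> (\<phi> t) \<in> L0" using poly_in[OF sfieldD(1)[OF K0(1)] \<delta>(1) a(1)] b(2) by blast
    moreover have "zb g = poly (spec (\<phi> t) (H g)) (zb \<one>) / poly \<delta> (\<phi> t)"
      using zb_rel[OF g L.one_closed] g a(2) by (simp add: field_simps)
    ultimately show ?thesis using sfieldD(3)[OF b(1)] by simp
  qed
  have hom0: "rhom L0 (\<tau> g)" if "g \<in> carrier G" for g
    by (rule rhom_subset[OF L.act_hom[OF that] sfieldD(1)[OF b(1)] L0L])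
  have fix0: "\<tau> g x = x" if "g \<in> carrier G" "x \<in> K0" for g x using L.act_E[OF that(1)] K0(2) that(2) by blast
  have act0: "galois_action G K0 L0 \<tau>"
  proof (intro galois_action.intro galois_action_axioms.intro)
    show "group G" by (rule L.is_group)
    show "finite (carrier G)" by (rule L.finite_G)
    show "sfield K0" by (rule K0(1))
    show "sfield L0" by (rule b(1))
    fix g assume g: "g \<in> carrier G"
    show "rhom L0 (\<tau> g)" by (rule hom0[OF g])
    have "L0 \<subseteq> {x \<in> L0. \<tau> g x \<in> L0}"
    proof (rule b(4)[OF sfield_vimage[OF b(1) hom0[OF g] b(1)]])
      show "K0 \<subseteq> {x \<in> L0. \<tau> g x \<in> L0}" using b(2) fix0[OF g] by auto
      show "{zb \<one>} \<subseteq> {x \<in> L0. \<tau> g x \<in> L0}" using zb0[OF L.one_closed] \<tau>zb[OF g L.one_closed] zb0[OF g] g by simp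
    qed
    then show "\<tau> g x \<in> L0" if "x \<in> L0" for x using that by blast
    show "\<tau> (g \<otimes> h) x = \<tau> g (\<tau> h x)" if "h \<in> carrier G" "x \<in> L0" for h x
      using L.act_mult[OF g that(1)] that(2) L0L by blast
  next
    fix x
    show "x \<in> K0 \<longleftrightarrow> x \<in> L0 \<and> (\<forall>g\<in>carrier G. \<tau> g x = x)"
    proof
      assume "x \<in> K0" then show "x \<in> L0 \<and> (\<forall>g\<in>carrier G. \<tau> g x = x)" using b(2) fix0 by blast
    next
      assume x: "x \<in> L0 \<and> (\<forall>g\<in>carrier G. \<tau> g x = x)"
      show "x \<in> K0"
      proof (rule fixed_by_conjugations[OF K0(1) L.finite_G inj L.one_closed prod])
        show "x \<in> field_adjoin K0 {zb \<one>}" using x by (simp only: L0_def)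
        fix g assume g: "g \<in> carrier G"
        have "\<tau> g (zb \<one>) = zb g" using \<tau>zb[OF g L.one_closed] g by simp
        then show "\<exists>N \<theta>. rhom N \<theta> \<and> K0 \<subseteq> N \<and> zb \<one> \<in> N \<and> (\<forall>e\<in>K0. \<theta> e = e) \<and> \<theta> (zb \<one>) = zb g \<and> \<theta> x = x"
          using hom0[OF g] b(2) zb0[OF L.one_closed] fix0[OF g] x g by blast
      qed
    qed
  qed
  have "inj_on (\<lambda>g. \<tau> g (zb \<one>)) (carrier G)"
    using inj \<tau>zb[OF _ L.one_closed] by (auto simp: inj_on_def)
  then show ?thesis
    unfolding occurs_as_galois_group_def
    using galois_action.extension_of_action[OF act0 zb0[OF L.one_closed]] by blast
qed

theorem occurs_over_base:
  assumes pac: "PAC_extension K0 K"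
  shows "occurs_as_galois_group G K0"
proof -
  note PK = sring_polys[OF sfieldD(1)[OF L.E]]
  obtain \<gamma> where \<gamma>: "\<gamma> \<in> L" "inj_on (Y \<gamma>) (carrier G)" "\<And>j. j \<in> carrier G \<Longrightarrow> Y \<gamma> j \<noteq> 0"
    using primitive_twist by blast
  have wL: "w ^ i \<in> L" for i by (rule sring_power[OF sfieldD(1)[OF L.M] w(1)])
  have "(\<Prod>j\<in>carrier G. [:- Y \<gamma> j, 1:]) \<in> polys (field_adjoin K {t})"
    by (rule A.linear_prod_fixed[OF L.finite_G Y_in[OF \<gamma>(1)]]) (use Y_perm \<gamma>(1) in blast)+
  then obtain qF PF where qF: "qF \<in> polys K" "poly qF t \<noteq> 0"
    and PF: "PF \<in> polys (polys K)" "spec t PF = smult (poly qF t) (\<Prod>j\<in>carrier G. [:- Y \<gamma> j, 1:])"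
    using clear_denominators[OF L.E] by blast
  \<comment> \<open>The families \<open>Y (w ^ i)\<close> and \<open>Y \<gamma>\<close> are permuted
    alike, so interpolation expresses the first by the second over \<open>K(t)\<close>. Specializing
    the single element \<open>Y \<gamma> \<one>\<close> thus controls all the sums.\<close>
  have "\<exists>h q P. poly h (Y \<gamma> \<one>) = Y (w ^ i) \<one> \<and> q \<in> polys K \<and> poly q t \<noteq> 0 \<and> P \<in> polys (polys K) \<and> spec t P = smult (poly q t) h" for i
  proof -
    obtain h where h: "h \<in> polys (field_adjoin K {t})" "\<And>j. j \<in> carrier G \<Longrightarrow> poly h (Y \<gamma> j) = Y (w ^ i) j"
    proof (rule A.interpolation_fixed[OF L.finite_G _ \<gamma>(2), of "Y (w ^ i)"])
      show "\<exists>\<pi>. bij_betw \<pi> (carrier G) (carrier G) \<and> (\<forall>j\<in>carrier G. act p (Y \<gamma> j) = Y \<gamma> (\<pi> j) \<and> act p (Y (w ^ i) j) = Y (w ^ i) (\<pi> j))"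
        if "p \<in> carrier (G \<times>\<times> G)" for p using Y_perm[OF that] \<gamma>(1) wL by blast
    qed (use L.one_closed Y_in[OF wL] Y_in[OF \<gamma>(1)] in auto)
    then show ?thesis using clear_denominators[OF L.E h(1)] h(2)[OF L.one_closed] by blast
  qed
  then obtain hh qq PP where hh: "\<And>i. poly (hh i) (Y \<gamma> \<one>) = Y (w ^ i) \<one>"
    and qq: "\<And>i. qq i \<in> polys K" "\<And>i. poly (qq i) t \<noteq> 0"
    and PP: "\<And>i. PP i \<in> polys (polys K)" "\<And>i. spec t (PP i) = smult (poly (qq i) t) (hh i)"
    by metis
  define \<Delta> where "\<Delta> = (\<Prod>(i, j)\<in>{(i, j). i \<in> carrier G \<and> j \<in> carrier G \<and> i \<noteq> j}. Z i - Z j)"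
  have "finite {(i, j). i \<in> carrier G \<and> j \<in> carrier G \<and> i \<noteq> j}"
    by (rule finite_subset[of _ "carrier G \<times> carrier G"]) (auto simp: L.finite_G)
  then have \<Delta>0: "\<Delta> \<noteq> 0" unfolding \<Delta>_def using Z(1) by (auto simp: inj_on_def)
  obtain num den where nd: "num \<in> polys K" "den \<in> polys K" "poly den t \<noteq> 0" "\<Delta> = poly num t / poly den t"
    using clear_denominators_elem[OF L.E discriminant_in] unfolding \<Delta>_def by blast
  have num0: "poly num t \<noteq> 0" using nd(4) \<Delta>0 by auto
  have \<delta>K: "\<delta> \<in> polys K" using \<delta>(1) polys_mono[OF K0(2)] by blast
  \<comment> \<open>Together with \<open>qF\<close>, the denominator of the polynomial of the
    \<open>Y \<gamma> j\<close>, this collects every polynomial that must not vanish at the value of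
    \<open>t\<close>.\<close>
  define e where "e = \<delta> * num * den * (\<Prod>i<n. qq i)"
  define d where "d = qF * e"
  have e: "e \<in> polys K" unfolding e_def by (intro sringD(6)[OF PK] sring_prod[OF PK] \<delta>K nd qq)
  have dK: "d \<in> polys K" unfolding d_def by (rule sringD(6)[OF PK qF(1) e])
  have d0: "poly d t \<noteq> 0" using \<delta>_nz num0 nd(3) qq(2) qF(2) by (simp add: d_def e_def poly_prod prod_zero_iff)
  obtain F where F: "F \<in> polys (polys K)" "lead_coeff F = 1" "degree F = n"
    "spec t F = (\<Prod>j\<in>carrier G. [:- (poly d t ^ 2 * Y \<gamma> j), 1:])" and dF: "\<And>i. i < n \<Longrightarrow> d dvd coeff F i"
    using integral_scaling[OF L.E L.finite_G qF PF d_def e d0] by blast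
  define u where "u = poly d t ^ 2 * Y \<gamma> \<one>"
  have u': "u = poly (d ^ 2) t * Y \<gamma> \<one>" by (simp add: u_def)
  have d2: "d ^ 2 \<in> polys K" "poly (d ^ 2) t \<noteq> 0" using sring_power[OF PK dK] d0 by auto
  have u0: "u \<noteq> 0" using d0 \<gamma>(3)[OF L.one_closed] by (simp add: u_def)
  have Fu: "poly (spec t F) u = 0"
    unfolding F(4) u_def using L.finite_G L.one_closed by (auto simp: poly_prod prod_zero_iff)
  have min: "r = 0" if "r \<in> polys (polys Kbar)" "degree r < n" "poly (spec t r) u = 0" for r
    by (rule twist_minimal[OF \<gamma>(1,2) d2 that(1,2)]) (use that(3) u' in simp)
  have FKbar: "F \<in> polys (polys Kbar)" using F(1) polys_mono[OF polys_mono[OF Kbar(2)]] by blast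
  have irrF: "irreducible F"
  proof (rule irreducible_of_minimal[OF Kbar(1) _ _ FKbar F(2) _ Fu])
    show "infinite Kbar" using K0(3) K0(2) Kbar(2) by (meson finite_subset subset_trans)
    show "x \<in> Kbar" if "alg Kbar x" for x using alg_trans[OF L.E that] by simp
  qed (use min F(3) n_pos in auto)
  have uM: "u \<in> M"
  proof -
    have "d ^ 2 \<in> polys M" using d2(1) polys_mono[OF subset_trans[OF L.E_subset N_props(2)]] by blast
    then have "poly (d ^ 2) t \<in> M" by (rule poly_in[OF sfieldD(1)[OF N_props(1)] _ N_props(3)])
    then show ?thesis unfolding u' by (rule sringD(6)[OF sfieldD(1)[OF N_props(1)] _ Y_in[OF \<gamma>(1) L.one_closed]])
  qed
  obtain a b where ab: "a \<in> K0" "b \<in> K" "poly d a \<noteq> 0" "poly (spec a F) b = 0"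
  proof (rule PAC_curve_point[OF pac t F(1,2) _ Fu irrF u0 _ _ separable_adjoin[OF uM], of d])
    show "r = 0" if "r \<in> polys (polys K)" "degree r < degree F" "poly (spec t r) u = 0" for r
      using min[of r] that F(3) polys_mono[OF polys_mono[OF Kbar(2)]] by auto
  qed (use F(3) n_pos dF in auto)
  have nz: "poly qF a \<noteq> 0" "poly \<delta> a \<noteq> 0" "poly num a \<noteq> 0" "poly den a \<noteq> 0" "\<And>i. i < n \<Longrightarrow> poly (qq i) a \<noteq> 0"
    using ab(3) by (auto simp: d_def e_def poly_prod prod_zero_iff)
  have tL: "\<not> alg L t" by (rule t_sub[OF L_Kbar])
  note RL = sfieldD(1)[OF L.M]
  \<comment> \<open>As \<open>t\<close> is transcendental over \<open>L\<close>, there are no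
    relations to respect, and \<open>t\<close> may take the value \<open>a\<close>.\<close>
  have "poly (map_poly (\<lambda>x. x) P) a = 0" if "P \<in> polys L" "poly P t = 0" for P
    using tL that unfolding alg_def by auto
  then obtain R1 \<phi>1 where R1: "lhom R1 \<phi>1" "L \<subseteq> R1" "t \<in> R1" "\<And>x. x \<in> L \<Longrightarrow> \<phi>1 x = x" "\<phi>1 t = a"
    and fr: "\<And>x. x \<in> R1 \<Longrightarrow> \<exists>P\<in>polys L. \<exists>Q\<in>polys L. poly Q t \<noteq> 0 \<and> x = poly P t / poly Q t"
    by (rule lhom_extend[OF lhom_field[OF L.M rhom_id[OF RL]], of t a]) blast+
  have h1: "rhom R1 \<phi>1" using R1(1) by (simp add: lhom_def)
  have R1sub: "R1 \<subseteq> field_adjoin L {t}" using fr unfolding field_adjoin_fractions[OF L.M] by blast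
  have KR1: "K \<subseteq> R1" using L.E_subset R1(2) by blast
  have fixK1: "\<phi>1 x = x" if "x \<in> K" for x using that L.E_subset R1(4) by blast
  have sF: "spec t F \<in> polys R1"
    using F(1) polys_mono[OF polys_mono[OF KR1]] by (intro spec_in[OF rhomD(1)[OF h1] _ R1(3)]) blast
  have mF: "map_poly \<phi>1 (spec t F) = spec a F"
    using map_spec_fixed[OF h1 KR1 R1(3) fixK1 F(1)] R1(5) by simp
  have lF: "lead_coeff (spec t F) = 1" and dgF: "degree (spec t F) = n" using spec_monic[OF F(2)] F(3) by auto
  \<comment> \<open>Elements of \<open>R1\<close> are fractions in \<open>L(t)\<close>. Clearing
    denominators turns a relation of \<open>u\<close> over \<open>R1\<close> into one over
    \<open>Kbar\<close>, which \<open>min\<close> excludes; hence \<open>u\<close> may take the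
    value \<open>b\<close>.\<close>
  have minR: "r = 0" if r: "r \<in> polys R1" "degree r < degree (spec t F)" "poly r u = 0" for r
  proof -
    obtain q P where q: "q \<in> polys L" "poly q t \<noteq> 0" and P: "P \<in> polys (polys L)" "degree P \<le> degree r" "spec t P = smult (poly q t) r"
      using clear_denominators[OF L.M, of r t] r(1) polys_mono[OF R1sub] by blast
    have "P = 0"
    proof (rule min)
      show "P \<in> polys (polys Kbar)" using P(1) polys_mono[OF polys_mono[OF L_Kbar]] by blast
      show "degree P < n" using P(2) r(2) dgF by simp
      show "poly (spec t P) u = 0" using r(3) by (simp add: P(3))
    qed
    then show "r = 0" using P(3) q(2) by (simp add: spec_simps)
  qed
  have "poly (map_poly \<phi>1 P) b = 0" if "P \<in> polys R1" "poly P u = 0" for P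
    by (rule minimal_vanishing[OF h1 sF lF Fu _ minR that]) (use mF ab(4) in simp)
  then obtain R2 \<phi> where R2: "lhom R2 \<phi>" "R1 \<subseteq> R2" "u \<in> R2" "\<And>x. x \<in> R1 \<Longrightarrow> \<phi> x = \<phi>1 x" "\<phi> u = b"
    by (rule lhom_extend[OF R1(1), of u b]) blast+
  have h2: "rhom R2 \<phi>" and linv: "\<And>x. x \<in> R2 \<Longrightarrow> \<phi> x \<noteq> 0 \<Longrightarrow> inverse x \<in> R2" using R2(1) by (auto simp: lhom_def)
  note S2 = sringD[OF rhomD(1)[OF h2]]
  have LR: "L \<subseteq> R2" and tR: "t \<in> R2" and fixL: "\<And>x. x \<in> L \<Longrightarrow> \<phi> x = x" and \<phi>t: "\<phi> t = a"
    using R1(2-5) R2(2,4) by auto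
  have KR: "K \<subseteq> R2" and fixK: "\<And>x. x \<in> K \<Longrightarrow> \<phi> x = x" using LR fixL L.E_subset by auto
  have pt: "poly p t \<in> R2" "\<phi> (poly p t) = poly p a" if p: "p \<in> polys K" for p
  proof -
    show "poly p t \<in> R2" using p polys_mono[OF KR] by (intro poly_in[OF rhomD(1)[OF h2] _ tR]) blast
    show "\<phi> (poly p t) = poly p a" using rhom_poly_fixed[OF h2 KR tR fixK p] \<phi>t by simp
  qed
  have quot: "x / poly q t \<in> R2 \<and> \<phi> (x / poly q t) \<in> K \<and> \<phi> (x / poly q t) = \<phi> x / poly q a" if q: "q \<in> polys K" "poly q a \<noteq> 0" and x: "x \<in> R2" "\<phi> x \<in> K" for x q
  proof -
    have i: "inverse (poly q t) \<in> R2" using linv pt[OF q(1)] q(2) by simp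
    have "poly q a \<in> K" using poly_in[OF sfieldD(1)[OF L.E] q(1)] ab(1) K0(2) by blast
    moreover have "\<phi> (x / poly q t) = \<phi> x / poly q a"
      using rhomD(7)[OF h2 x(1) i] rhom_inverse[OF h2 pt(1)[OF q(1)] i] pt(2)[OF q(1)] by (simp add: divide_inverse)
    ultimately show ?thesis using S2(6)[OF x(1) i] x(2) sfieldD(3)[OF L.E] by (simp add: divide_inverse)
  qed
  \<comment> \<open>The ring of elements with value in \<open>K\<close>. It contains
    \<open>Y \<gamma> \<one>\<close> because \<open>a\<close> and \<open>b\<close> lie in
    \<open>K\<close>, and the coefficients of \<open>hh i\<close> because \<open>qq i\<close> does
    not vanish at \<open>a\<close>; so it contains the sums \<open>Y (w ^ i) \<one>\<close>.\<close>
  define R' where "R' = {x \<in> R2. \<phi> x \<in> K}"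
  have R': "sring R'"
    unfolding sring_def R'_def using S2 sringD[OF sfieldD(1)[OF L.E]] rhomD[OF h2] by auto
  have ptK: "poly p t \<in> R'" if "p \<in> polys K" for p
    using pt[OF that] poly_in[OF sfieldD(1)[OF L.E] that] ab(1) K0(2) unfolding R'_def by auto
  have YR': "Y \<gamma> \<one> \<in> R'"
  proof -
    have "Y \<gamma> \<one> = u / poly (d ^ 2) t" using d2(2) by (simp add: u')
    moreover have "poly (d ^ 2) a \<noteq> 0" "\<phi> u \<in> K" using R2(5) ab(2,3) by auto
    ultimately show ?thesis using quot[OF d2(1) _ R2(3)] unfolding R'_def by (metis (no_types, lifting) mem_Collect_eq)
  qed
  have YwR': "Y (w ^ i) \<one> \<in> R'" if i: "i < n" for i
  proof -
    have "coeff (hh i) k \<in> R'" for k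
    proof -
      have "poly (coeff (PP i) k) t = poly (qq i) t * coeff (hh i) k"
        using arg_cong[OF PP(2)[of i], of "\<lambda>p. coeff p k"] by (simp add: coeff_spec)
      then have eq: "coeff (hh i) k = poly (coeff (PP i) k) t / poly (qq i) t" using qq(2)[of i] by (simp add: field_simps)
      show ?thesis using quot[OF qq(1) nz(5)[OF i]] ptK[OF polysD[OF PP(1)], of i k] unfolding R'_def eq by blast
    qed
    then show ?thesis using poly_in[OF R' polysI YR', of "hh i"] hh[of i] by simp
  qed
  have "\<phi> \<Delta> = poly num a / poly den a"
    using quot[OF nd(2) nz(4), of "poly num t"] pt[OF nd(1)] ptK[OF nd(1)] by (simp add: nd(4) R'_def)
  then have "\<phi> \<Delta> \<noteq> 0" using nz(3,4) by simp
  then show ?thesis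
    using YwR' nz(2) ab(1) unfolding \<Delta>_def R'_def
    by (intro occurs_of_point[OF h2 LR tR fixL]) (auto simp: \<phi>t)
qed

end

subsection \<open>Regular groups and descent\<close>

text \<open>The hypothesis \<open>ind\<close> says that the monomials in \<open>t\<close> and
  \<open>z\<close> of degree below \<open>n\<close> in \<open>z\<close> are independent over
  \<open>K\<close>. Linear disjointness transfers this to \<open>C\<close>.\<close>

lemma linearly_disjoint_minimal:
  fixes F0 :: "'a::alg_closed_field set"
  assumes disj: "linearly_disjoint K F0 C" and K: "sfield K" and C: "sfield C" and F0: "sfield F0" "t \<in> F0" "z \<in> F0"
    and ind: "\<And>r. r \<in> polys (polys K) \<Longrightarrow> degree r < n \<Longrightarrow> poly (spec t r) z = 0 \<Longrightarrow> r = 0"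
    and r: "r \<in> polys (polys C)" "degree r < n" "poly (spec t r) z = 0"
  shows "r = 0"
proof -
  \<comment> \<open>A bound for the degrees in \<open>t\<close>, which makes the set of monomials
    finite.\<close>
  define D where "D = Max ((\<lambda>i. degree (coeff r i)) ` {..<n})"
  have D: "degree (coeff r i) \<le> D" if "i < n" for i unfolding D_def using that by (intro Max_ge) auto
  define I where "I = {..<n} \<times> {..D}"
  define v where "v p = t ^ snd p * z ^ fst p" for p :: "nat \<times> nat"
  have ev: "(\<Sum>p\<in>I. c p * v p) = poly (spec t (\<Sum>i<n. monom (\<Sum>j\<le>D. monom (c (i, j)) j) i)) z" for c
  proof -
    have "spec t (\<Sum>i<n. monom (\<Sum>j\<le>D. monom (c (i, j)) j) i) = (\<Sum>i<n. monom (\<Sum>j\<le>D. c (i, j) * t ^ j) i)"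
      by (rule poly_eqI) (simp add: coeff_spec coeff_sum poly_sum poly_monom if_distrib[of "\<lambda>p. poly p t"] cong: if_cong)
    then have "poly (spec t (\<Sum>i<n. monom (\<Sum>j\<le>D. monom (c (i, j)) j) i)) z = (\<Sum>i<n. (\<Sum>j\<le>D. c (i, j) * t ^ j) * z ^ i)"
      by (simp add: poly_sum poly_monom)
    also have "\<dots> = (\<Sum>i<n. \<Sum>j\<le>D. c (i, j) * v (i, j))"
      unfolding sum_distrib_right by (intro sum.cong refl) (simp add: v_def mult.assoc)
    also have "\<dots> = (\<Sum>p\<in>I. c p * v p)" unfolding I_def by (simp add: sum.cartesian_product)
    finally show ?thesis by simp
  qed
  have cf: "coeff (\<Sum>i<n. monom (q i) i) i = (if i < n then q i else 0)" for q :: "nat \<Rightarrow> 'a poly" and i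
    by (simp add: coeff_sum)
  have cf': "coeff (\<Sum>j\<le>D. monom (q j) j) j = (if j \<le> D then q j else 0)" for q :: "nat \<Rightarrow> 'a" and j
    by (simp add: coeff_sum)
  have eq: "r = (\<Sum>i<n. monom (\<Sum>j\<le>D. monom (coeff (coeff r i) j) j) i)"
  proof (rule poly_eqI)
    fix i
    have "coeff r i = (\<Sum>j\<le>D. monom (coeff (coeff r i) j) j)" if "i < n"
      using D[OF that] by (intro poly_eqI) (auto simp: cf' coeff_eq_0)
    moreover have "coeff r i = 0" if "\<not> i < n" using that r(2) by (intro coeff_eq_0) simp
    ultimately show "coeff r i = coeff (\<Sum>i<n. monom (\<Sum>j\<le>D. monom (coeff (coeff r i) j) j) i) i"
      unfolding cf by auto
  qed
  have "coeff (coeff r i) j = 0" if ij: "i < n" "j \<le> D" for i j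
  proof -
    have "(\<lambda>p. coeff (coeff r (fst p)) (snd p)) (i, j) = 0"
    proof (rule linearly_disjoint_family[OF disj K C, of I v])
      show "finite I" by (simp add: I_def)
      show "v ` I \<subseteq> F0" unfolding v_def
        using sringD(6)[OF sfieldD(1)[OF F0(1)]] sring_power[OF sfieldD(1)[OF F0(1)]] F0(2,3) by auto
      show "(\<lambda>p. coeff (coeff r (fst p)) (snd p)) ` I \<subseteq> C" using polysD[OF polysD[OF r(1)]] by auto
      show "(\<Sum>p\<in>I. coeff (coeff r (fst p)) (snd p) * v p) = 0"
        using ev[of "\<lambda>p. coeff (coeff r (fst p)) (snd p)"] eq r(3) by simp
      show "(i, j) \<in> I" using ij by (simp add: I_def)
      fix c assume c: "c ` I \<subseteq> K" "(\<Sum>p\<in>I. c p * v p) = 0"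
      define s where "s = (\<Sum>i<n. monom (\<Sum>j\<le>D. monom (c (i, j)) j) i)"
      note PK = sring_polys[OF sfieldD(1)[OF K]]
      have "s = 0"
      proof (rule ind)
        show "s \<in> polys (polys K)" unfolding s_def
          by (intro sring_sum[OF sring_polys[OF PK]] polys_monom[OF PK] sring_sum[OF PK] polys_monom[OF sfieldD(1)[OF K]])
            (use c(1) in \<open>auto simp: I_def\<close>)
        show "degree s < n" unfolding s_def using ij(1)
          by (intro degree_sum_less) (auto intro: le_less_trans[OF degree_monom_le])
        show "poly (spec t s) z = 0" using c(2) ev[of c] by (simp add: s_def)
      qed
      show "\<forall>p\<in>I. c p = 0"
      proof
        fix p assume p: "p \<in> I"
        have "coeff (coeff s (fst p)) (snd p) = c p" using p by (auto simp: s_def cf cf' I_def)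
        then show "c p = 0" using \<open>s = 0\<close> by simp
      qed
    qed
    then show ?thesis by simp
  qed
  then have "coeff r i = 0" for i
  proof (cases "i < n")
    case True
    with \<open>\<And>i j. i < n \<Longrightarrow> j \<le> D \<Longrightarrow> coeff (coeff r i) j = 0\<close> show ?thesis
      using D[OF True] by (intro poly_eqI) (metis coeff_0 coeff_eq_0 not_le order.strict_trans1)
  qed (use r(2) in \<open>simp add: coeff_eq_0\<close>)
  then show ?thesis by (intro poly_eqI) simp
qed

text \<open>If the primitive element is 0, its conjugates coincide, so the group is trivial and 1 is
  primitive.\<close>

lemma (in galois_action) primitive_exists_nonzero:
  assumes "infinite E" "\<And>g h. g \<in> carrier G \<Longrightarrow> h \<in> carrier G \<Longrightarrow> g \<noteq> h \<Longrightarrow> \<exists>x\<in>M. act g x \<noteq> act h x"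
  obtains w where "w \<in> M" "w \<noteq> 0" "inj_on (\<lambda>g. act g w) (carrier G)"
proof -
  obtain w where w: "w \<in> M" "inj_on (\<lambda>g. act g w) (carrier G)" by (rule primitive_exists[OF assms]) auto
  show thesis
  proof (cases "w = 0")
    case False then show ?thesis using w that by blast
  next
    case True
    have "inj_on (\<lambda>g. act g 1) (carrier G)"
      using w(2) rhomD(2,3)[OF act_hom] unfolding True inj_on_def by auto
    then show ?thesis using that[of 1] sringD(2)[OF sfieldD(1)[OF M]] by simp
  qed
qed

text \<open>The given parameter \<open>t0\<close> is only known to be transcendental over
  \<open>K0\<close> and may be algebraic over \<open>K\<close>. Polynomial data over
  \<open>K0\<close> are extracted and transported along an embedding with \<open>t0\<close> going to
  \<open>t\<close>. Irreducibility of \<open>f\<close> needs no transport, being a statement about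
  two variables over the universal domain.\<close>

lemma regular_group_model:
  fixes K0 :: "'a::alg_closed_field set" and G :: "('g, 'm) monoid_scheme" (structure)
  assumes K0: "sfield K0" "infinite K0" and G: "group G" "finite (carrier G)"
    and reg: "regular_group_over G K0" and t: "\<not> alg K0 t"
  obtains Z f \<delta> H where "inj_on Z (carrier G)" "\<And>g. g \<in> carrier G \<Longrightarrow> Z g \<noteq> 0"
    "f \<in> polys (polys K0)" "lead_coeff f = 1" "irreducible f" "spec t f = (\<Prod>g\<in>carrier G. [:- Z g, 1:])"
    "\<delta> \<in> polys K0" "\<delta> \<noteq> 0" "\<And>g. g \<in> carrier G \<Longrightarrow> H g \<in> polys (polys K0)"
    "\<And>g h. g \<in> carrier G \<Longrightarrow> h \<in> carrier G \<Longrightarrow> poly \<delta> t * Z (h \<otimes> g) = poly (spec t (H g)) (Z h)"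
proof -
  note RK = sfieldD(1)[OF K0(1)] note PK = sring_polys[OF RK]
  obtain t0 F0 where tr: "ring.transcendental Dom K0 t0" and gal: "finite_galois_extension (field_adjoin K0 {t0}) F0"
    and iso: "G \<cong> galois_group (field_adjoin K0 {t0}) F0" and regF: "regular_extension K0 F0"
    using reg unfolding regular_group_over_def by blast
  have t0: "\<not> alg K0 t0" using tr algebraic_Dom[OF RK, of t0] by simp
  let ?E = "field_adjoin K0 {t0}"
  note b = field_adjoin_props[where K = K0 and S = "{t0}"]
  obtain \<sigma> where act: "galois_action G ?E F0 \<sigma>"
    and faithful: "\<And>g h. g \<in> carrier G \<Longrightarrow> h \<in> carrier G \<Longrightarrow> g \<noteq> h \<Longrightarrow> \<exists>x\<in>F0. \<sigma> g x \<noteq> \<sigma> h x"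
    using galois_action_of_extension[OF G gal iso] by blast
  interpret S: galois_action G ?E F0 \<sigma> by (rule act)
  let ?n = "card (carrier G)"
  have n_pos: "?n > 0" using G(2) S.one_closed by (auto simp: card_gt_0_iff)
  have infE: "infinite ?E" using K0(2) b(2) finite_subset by blast
  have t0E: "t0 \<in> ?E" using b(3) by blast
  obtain z where z: "z \<in> F0" "z \<noteq> 0" "inj_on (\<lambda>g. \<sigma> g z) (carrier G)"
    using S.primitive_exists_nonzero[OF infE faithful] by blast
  obtain q P where q: "q \<in> polys K0" "poly q t0 \<noteq> 0"
    and P: "P \<in> polys (polys K0)" "spec t0 P = smult (poly q t0) (\<Prod>g\<in>carrier G. [:- \<sigma> g z, 1:])"
    using clear_denominators[OF K0(1) S.conjugates_polynomial[OF z(1)]] by blast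
  obtain f where f: "f \<in> polys (polys K0)" "lead_coeff f = 1" "degree f = ?n"
    "spec t0 f = (\<Prod>g\<in>carrier G. [:- (poly q t0 ^ 2 * \<sigma> g z), 1:])"
    by (rule integral_scaling[OF K0(1) G(2) q P, of q 1]) (use q sringD(2)[OF PK] in auto)
  \<comment> \<open>The scaling makes the polynomial of the conjugates monic with coefficients in
    \<open>K0[t0]\<close>; the square comes from \<open>integral_scaling\<close>, applied with
    \<open>e = 1\<close>.\<close>
  define z0 where "z0 = poly q t0 ^ 2 * z"
  have qE: "poly q t0 ^ 2 \<in> ?E" by (intro sring_power sfieldD(1) b(1) poly_in_field_adjoin q)
  then have qF: "poly q t0 ^ 2 \<in> F0" using S.E_subset by blast
  have z0F: "z0 \<in> F0" unfolding z0_def by (rule sringD(6)[OF sfieldD(1)[OF S.M] qF z(1)])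
  have \<sigma>z0: "\<sigma> g z0 = poly q t0 ^ 2 * \<sigma> g z" if "g \<in> carrier G" for g
    unfolding z0_def using rhomD(7)[OF S.act_hom[OF that] qF z(1)] S.act_E[OF that qE] by simp
  have inj0: "inj_on (\<lambda>g. \<sigma> g z0) (carrier G)"
    using z(3) q(2) \<sigma>z0 by (auto simp: inj_on_def)
  have sf: "spec t0 f = (\<Prod>g\<in>carrier G. [:- \<sigma> g z0, 1:])" unfolding f(4) by (intro prod.cong) (auto simp: \<sigma>z0)
  have root0: "poly (spec t0 f) (\<sigma> g z0) = 0" if "g \<in> carrier G" for g
    unfolding sf using G(2) that by (auto simp: poly_prod prod_zero_iff)
  have \<sigma>1: "\<sigma> \<one> z0 = z0" by (rule S.act_one[OF z0F])
  define \<Phi> where "\<Phi> g r q P \<longleftrightarrow> r \<in> polys ?E \<and> (\<forall>h\<in>carrier G. \<sigma> (h \<otimes> g) z0 = poly r (\<sigma> h z0)) \<and>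
      q \<in> polys K0 \<and> poly q t0 \<noteq> 0 \<and> P \<in> polys (polys K0) \<and> spec t0 P = smult (poly q t0) r" for g r q P
  have "\<exists>x. \<Phi> g (fst x) (fst (snd x)) (snd (snd x))" if g: "g \<in> carrier G" for g
  proof -
    obtain r where r: "r \<in> polys ?E" "\<And>h. h \<in> carrier G \<Longrightarrow> \<sigma> h (\<sigma> g z0) = poly r (\<sigma> h z0)"
      using S.primitive_polynomial[OF z0F inj0 S.act_closed[OF g z0F]] by blast
    obtain q P where "q \<in> polys K0" "poly q t0 \<noteq> 0" "P \<in> polys (polys K0)" "spec t0 P = smult (poly q t0) r"
      using clear_denominators[OF K0(1) r(1)] by blast
    then have "\<Phi> g r q P" unfolding \<Phi>_def using r S.act_mult[OF _ g z0F] by simp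
    then show ?thesis by (intro exI[of _ "(r, q, P)"]) simp
  qed
  then have "\<forall>g\<in>carrier G. \<exists>x. \<Phi> g (fst x) (fst (snd x)) (snd (snd x))" by blast
  from bchoice[OF this] obtain x where x: "\<And>g. g \<in> carrier G \<Longrightarrow> \<Phi> g (fst (x g)) (fst (snd (x g))) (snd (snd (x g)))" by blast
  define rr qq PP where "rr g = fst (x g)" and "qq g = fst (snd (x g))" and "PP g = snd (snd (x g))" for g
  have rr: "\<And>g. g \<in> carrier G \<Longrightarrow> rr g \<in> polys ?E"
      "\<And>g h. g \<in> carrier G \<Longrightarrow> h \<in> carrier G \<Longrightarrow> \<sigma> (h \<otimes> g) z0 = poly (rr g) (\<sigma> h z0)"
    and qq: "\<And>g. g \<in> carrier G \<Longrightarrow> qq g \<in> polys K0" "\<And>g. g \<in> carrier G \<Longrightarrow> poly (qq g) t0 \<noteq> 0"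
    and PP: "\<And>g. g \<in> carrier G \<Longrightarrow> PP g \<in> polys (polys K0)" "\<And>g. g \<in> carrier G \<Longrightarrow> spec t0 (PP g) = smult (poly (qq g) t0) (rr g)"
    using x unfolding \<Phi>_def rr_def qq_def PP_def by blast+
  \<comment> \<open>A common denominator of all \<open>rr g\<close>; \<open>H g\<close> multiplies
    \<open>PP g\<close> by the remaining denominators.\<close>
  define \<delta> where "\<delta> = (\<Prod>g\<in>carrier G. qq g)"
  define H where "H g = [:\<Prod>h\<in>carrier G - {g}. qq h:] * PP g" for g
  have \<delta>K: "\<delta> \<in> polys K0" unfolding \<delta>_def by (intro sring_prod[OF PK] qq)
  have \<delta>0: "poly \<delta> t0 \<noteq> 0" using qq(2) G(2) by (simp add: \<delta>_def poly_prod prod_zero_iff)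
  have HK: "H g \<in> polys (polys K0)" if "g \<in> carrier G" for g
    unfolding H_def using that qq(1) by (intro sringD(6)[OF sring_polys[OF PK]] PP) (auto simp: polys_const[OF PK] intro!: sring_prod[OF PK])
  have Hrel: "poly \<delta> t0 * \<sigma> (h \<otimes> g) z0 = poly (spec t0 (H g)) (\<sigma> h z0)" if g: "g \<in> carrier G" and h: "h \<in> carrier G" for g h
  proof -
    have "\<delta> = qq g * (\<Prod>h\<in>carrier G - {g}. qq h)" unfolding \<delta>_def by (rule prod.remove[OF G(2) g])
    then show ?thesis using rr(2)[OF g h] PP(2)[OF g] by (simp add: H_def spec_smult algebra_simps)
  qed
  have min0: "r = 0" if r: "r \<in> polys ?E" "degree r < ?n" "poly r z0 = 0" for r
    by (rule S.primitive_degree[OF z0F inj0 r])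
  have minK: "r = 0" if r: "r \<in> polys (polys K0)" "degree r < ?n" "poly (spec t0 r) z0 = 0" for r
  proof -
    have "spec t0 r = 0" by (rule min0[OF spec_field_adjoin[OF r(1)]]) (use r(2,3) degree_spec_le[of t0 r] in auto)
    then have "poly (coeff r i) t0 = 0" for i using coeff_spec[of t0 r i] by simp
    then show "r = 0" using t0 polysD[OF r(1)] unfolding alg_def by (intro poly_eqI) (metis coeff_0)
  qed
  let ?C = "{x. alg K0 x}"
  note C = sfield_algebraics[OF K0(1)]
  \<comment> \<open>Regularity enters here: it extends the degree bound for \<open>z0\<close> from
    \<open>K0\<close> to its algebraic closure, from where \<open>irreducible_of_minimal\<close>
    leads to the universal domain.\<close>
  have "linearly_disjoint K0 F0 ?C" using regF algebraic_Dom[OF RK] by (simp add: regular_extension_def)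
  from linearly_disjoint_minimal[OF this K0(1) C(1) S.M _ z0F minK]
  have minC: "r = 0" if "r \<in> polys (polys ?C)" "degree r < ?n" "poly (spec t0 r) z0 = 0" for r
    using that t0E S.E_subset by blast
  have irrf: "irreducible f"
  proof (rule irreducible_of_minimal[OF C(1), of f t0 z0])
    show "infinite ?C" using K0(2) C(2) finite_subset by blast
    show "x \<in> ?C" if "alg ?C x" for x using alg_trans[OF K0(1) that] by simp
    show "f \<in> polys (polys ?C)" using f(1) polys_mono[OF polys_mono[OF C(2)]] by blast
    show "poly (spec t0 f) z0 = 0" using root0[OF S.one_closed] \<sigma>1 by simp
  qed (use f n_pos minC in auto)
  have "poly p t0 = 0 \<longleftrightarrow> poly (map_poly (\<lambda>x. x) p) t = 0" if "p \<in> polys K0" for p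
  proof -
    have "map_poly (\<lambda>x. x) p = p" by (rule map_poly_fixed) auto
    then show ?thesis using t t0 that unfolding alg_def by auto
  qed
  then obtain \<psi>0 where \<psi>0: "rhom ?E \<psi>0" "\<And>x. x \<in> K0 \<Longrightarrow> \<psi>0 x = x" "\<psi>0 t0 = t"
    using rhom_extend_field[OF K0(1) rhom_id[OF RK], of t0 t] by metis
  have m0: "map_poly \<psi>0 (spec t0 p) = spec t p" if "p \<in> polys (polys K0)" for p
    using map_spec_fixed[OF \<psi>0(1) b(2) t0E \<psi>0(2) that] \<psi>0(3) by simp
  have "degree (spec t f) > 0" using spec_monic(1)[OF f(2)] f(3) n_pos by simp
  then obtain z' where z': "poly (spec t f) z' = 0" using alg_closed_imp_poly_has_root by blast
  have lf: "lead_coeff (spec t0 f) = 1" and df: "degree (spec t0 f) = ?n" using spec_monic[OF f(2)] f(3) by auto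
  have sfE: "spec t0 f \<in> polys ?E" by (rule spec_field_adjoin[OF f(1)])
  have r1: "poly (spec t0 f) z0 = 0" using root0[OF S.one_closed] \<sigma>1 by simp
  have "poly (map_poly \<psi>0 p) z' = 0" if "p \<in> polys ?E" "poly p z0 = 0" for p
    by (rule minimal_vanishing[OF \<psi>0(1) sfE lf r1 _ min0 that]) (use m0[OF f(1)] z' df in auto)
  then obtain \<psi> where \<psi>: "rhom (field_adjoin ?E {z0}) \<psi>" "\<And>x. x \<in> ?E \<Longrightarrow> \<psi> x = \<psi>0 x"
    using rhom_extend_alg[OF b(1) \<psi>0(1) S.alg_E[OF z0F], of z'] by metis
  let ?N = "field_adjoin ?E {z0}"
  note c = field_adjoin_props[where K = ?E and S = "{z0}"]
  have KN: "K0 \<subseteq> ?N" and tN: "t0 \<in> ?N" using b(2) c(2) t0E by blast+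
  have fix\<psi>: "\<psi> x = x" if "x \<in> K0" for x using \<psi>(2)[of x] \<psi>0(2)[OF that] that b(2) by (simp add: subset_iff)
  have \<psi>t: "\<psi> t0 = t" using \<psi>(2)[OF t0E] \<psi>0(3) by simp
  have m\<psi>: "map_poly \<psi> (spec t0 p) = spec t p" if "p \<in> polys (polys K0)" for p
    using map_spec_fixed[OF \<psi>(1) KN tN fix\<psi> that] \<psi>t by simp
  have inN: "\<sigma> g z0 \<in> ?N" if g: "g \<in> carrier G" for g
    using rr(2)[OF g S.one_closed] poly_in_field_adjoin[OF rr(1)[OF g], of z0] g \<sigma>1 by simp
  define Z where "Z g = \<psi> (\<sigma> g z0)" for g
  show thesis
  proof (rule that[of Z f \<delta> H])
    show "inj_on Z (carrier G)"
    proof (rule inj_onI)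
      fix g h assume gh: "g \<in> carrier G" "h \<in> carrier G" "Z g = Z h"
      then have "\<sigma> g z0 = \<sigma> h z0"
        using rhom_field_inj[OF \<psi>(1) c(1)] inN unfolding Z_def inj_on_def by blast
      then show "g = h" using inj0 gh unfolding inj_on_def by blast
    qed
    show "Z g \<noteq> 0" if g: "g \<in> carrier G" for g
    proof -
      have "z0 \<noteq> 0" using z(2) q(2) by (simp add: z0_def)
      then have "\<sigma> g z0 \<noteq> 0" by (rule rhom_field_nz[OF S.act_hom[OF g] S.M z0F])
      then show ?thesis unfolding Z_def by (rule rhom_field_nz[OF \<psi>(1) c(1) inN[OF g]])
    qed
    show "spec t f = (\<Prod>g\<in>carrier G. [:- Z g, 1:])"
    proof -
      note SN = sfieldD(1)[OF c(1)]
      have lin: "[:- \<sigma> g z0, 1:] \<in> polys ?N" if "g \<in> carrier G" for g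
        by (rule polys_linear[OF SN inN[OF that]])
      have "spec t f = map_poly \<psi> (\<Prod>g\<in>carrier G. [:- \<sigma> g z0, 1:])" unfolding sf[symmetric] by (rule m\<psi>[OF f(1), symmetric])
      also have "\<dots> = (\<Prod>g\<in>carrier G. map_poly \<psi> [:- \<sigma> g z0, 1:])" by (rule rhom_prod[OF map_poly_rhom[OF \<psi>(1)] lin])
      also have "\<dots> = (\<Prod>g\<in>carrier G. [:- Z g, 1:])"
        unfolding Z_def by (intro prod.cong refl map_linear[OF \<psi>(1) inN])
      finally show ?thesis .
    qed
    show "\<delta> \<noteq> 0" using \<delta>0 by auto
    show "poly \<delta> t * Z (h \<otimes> g) = poly (spec t (H g)) (Z h)" if g: "g \<in> carrier G" and h: "h \<in> carrier G" for g h
    proof -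
      have dN: "\<delta> \<in> polys ?N" using \<delta>K polys_mono[OF KN] by blast
      have "\<psi> (poly \<delta> t0) = poly \<delta> t" using rhom_poly_fixed[OF \<psi>(1) KN tN fix\<psi> \<delta>K] \<psi>t by simp
      moreover have d0N: "poly \<delta> t0 \<in> ?N" by (rule poly_in[OF sfieldD(1)[OF c(1)] dN tN])
      moreover have "spec t0 (H g) \<in> polys ?N"
        using spec_field_adjoin[OF HK[OF g], of t0] polys_mono[OF c(2)] by blast
      then have "\<psi> (poly (spec t0 (H g)) (\<sigma> h z0)) = poly (spec t (H g)) (Z h)"
        unfolding Z_def m\<psi>[OF HK[OF g], symmetric] by (rule poly_map[OF \<psi>(1) _ inN[OF h], symmetric])
      moreover have "\<psi> (poly \<delta> t0 * \<sigma> (h \<otimes> g) z0) = \<psi> (poly \<delta> t0) * Z (h \<otimes> g)"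
        unfolding Z_def by (rule rhomD(7)[OF \<psi>(1) d0N inN[OF S.m_closed[OF h g]]])
      ultimately show ?thesis unfolding Hrel[OF g h] by simp
    qed
  qed (use f irrf \<delta>K HK in auto)
qed

theorem PAC_extension_descent:
  fixes K0 K :: "'a::{alg_closed_field, factorial_ring_gcd, semiring_gcd_mult_normalize} set"
    and G :: "('g, 'm) monoid_scheme"
  assumes pac: "PAC_extension K0 K" and t: "\<not> alg K t" and G: "group G" "finite (carrier G)"
    and occ: "occurs_as_galois_group G K" and reg: "regular_group_over G K0"
  shows "occurs_as_galois_group G K0"
proof -
  have K0: "sfield K0" and sub: "K0 \<subseteq> K" using pac unfolding PAC_extension_def field_extension_def subfield_Dom by blast+
  have inf: "infinite K0" by (rule PAC_infinite[OF pac t])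
  have infK: "infinite K" using inf sub finite_subset by blast
  obtain L where L: "finite_galois_extension K L" "G \<cong> galois_group K L" using occ unfolding occurs_as_galois_group_def by blast
  obtain \<tau> where act: "galois_action G K L \<tau>"
    and faithful: "\<And>g h. g \<in> carrier G \<Longrightarrow> h \<in> carrier G \<Longrightarrow> g \<noteq> h \<Longrightarrow> \<exists>x\<in>L. \<tau> g x \<noteq> \<tau> h x"
    using galois_action_of_extension[OF G L] by blast
  obtain w where w: "w \<in> L" "inj_on (\<lambda>g. \<tau> g w) (carrier G)"
    using galois_action.primitive_exists[OF act infK faithful] by blast
  have t0: "\<not> alg K0 t" using t alg_mono[OF sub] by blast
  obtain Z f \<delta> H where Z: "inj_on Z (carrier G)" "\<And>g. g \<in> carrier G \<Longrightarrow> Z g \<noteq> 0"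
    and f: "f \<in> polys (polys K0)" "lead_coeff f = 1" "irreducible f" "spec t f = (\<Prod>g\<in>carrier G. [:- Z g, 1:])"
    and \<delta>: "\<delta> \<in> polys K0" "\<delta> \<noteq> 0" and H: "\<And>g. g \<in> carrier G \<Longrightarrow> H g \<in> polys (polys K0)"
    "\<And>g h. g \<in> carrier G \<Longrightarrow> h \<in> carrier G \<Longrightarrow> poly \<delta> t * Z (h \<otimes>\<^bsub>G\<^esub> g) = poly (spec t (H g)) (Z h)"
    using regular_group_model[OF K0 inf G reg t0] by blast
  interpret field_crossing G K L \<tau> K0 t w Z f \<delta> H
    by (intro field_crossing.intro field_crossing_axioms.intro act K0 sub inf t w Z f \<delta> H)
  show ?thesis by (rule occurs_over_base[OF pac])
qed

section \<open>A transcendental element of the universal domain\<close>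

lemma lookup_mpol1: "Poly_Mapping.lookup (mpol1 p) (Poly_Mapping.single 0 i) = coeff p i"
proof -
  have "mpol1 p = mpol1 (\<Sum>j\<le>degree p. monom (coeff p j) j)" by (simp add: poly_as_sum_of_monoms)
  also have "\<dots> = (\<Sum>j\<le>degree p. Poly_Mapping.single (Poly_Mapping.single 0 j) (coeff p j))"
    by (subst rhom_sum[OF rhom_mpol1]) (simp_all add: mpol1_monom)
  finally have "Poly_Mapping.lookup (mpol1 p) (Poly_Mapping.single 0 i) =
      (\<Sum>j\<le>degree p. coeff p j when Poly_Mapping.single 0 j = (Poly_Mapping.single 0 i :: nat \<Rightarrow>\<^sub>0 nat))"
    by (simp only: lookup_sum lookup_single)
  also have "\<dots> = (\<Sum>j\<le>degree p. if j = i then coeff p j else 0)"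
  proof (intro sum.cong refl)
    fix j
    have "Poly_Mapping.single (0::nat) j = Poly_Mapping.single 0 i \<longleftrightarrow> j = i" by (metis lookup_single_eq)
    then show "(coeff p j when Poly_Mapping.single 0 j = (Poly_Mapping.single 0 i :: nat \<Rightarrow>\<^sub>0 nat)) = (if j = i then coeff p j else 0)"
      by (simp add: when_def)
  qed
  finally have "Poly_Mapping.lookup (mpol1 p) (Poly_Mapping.single 0 i) = (\<Sum>j\<le>degree p. if j = i then coeff p j else 0)" .
  then show ?thesis by (simp add: coeff_eq_0)
qed

text \<open>The first variable serves as \<open>t\<close>. A relation pulls back to a polynomial
  \<open>p\<close> over \<open>'k\<close> with \<open>mpol1 p = 0\<close>, and
  \<open>lookup_mpol1\<close> reads off its coefficients.\<close>

lemma transcendental_over_base: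
  "\<not> alg (to_universal_domain ` (UNIV :: 'k::field set)) (to_ac (Fract (mvar 0) 1) :: 'k universal_domain)"
proof
  let ?t = "to_ac (Fract (mvar 0) 1) :: 'k universal_domain"
  let ?\<iota> = "to_universal_domain :: 'k \<Rightarrow> 'k universal_domain"
  assume "alg (range ?\<iota>) ?t"
  then obtain P where P: "P \<in> polys (range ?\<iota>)" "P \<noteq> 0" "poly P ?t = 0" unfolding alg_def by blast
  define p where "p = map_poly (inv_into UNIV ?\<iota>) P"
  have \<iota>0: "?\<iota> 0 = 0" by (rule to_universal_domain_hom)
  have i0: "inv_into UNIV ?\<iota> 0 = 0" using inv_f_f[OF inj_to_universal_domain, of "0 :: 'k"] by (simp only: \<iota>0)
  have Pp: "P = map_poly ?\<iota> p"
  proof (rule poly_eqI)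
    fix i
    have "coeff P i \<in> range ?\<iota>" by (rule polysD[OF P(1)])
    then show "coeff P i = coeff (map_poly ?\<iota> p) i"
      by (simp add: coeff_map_poly \<iota>0 i0 p_def f_inv_into_f)
  qed
  have "poly (map_poly ?\<iota> q) ?t = to_ac (Fract (mpol1 q) 1)" for q
  proof (induction q)
    case 0 show ?case by (simp add: Zero_fract_def[symmetric])
  next
    case (pCons a q)
    have "map_poly ?\<iota> (pCons a q) = pCons (?\<iota> a) (map_poly ?\<iota> q)"
      by (rule map_poly_pCons) (rule \<iota>0)
    moreover have "to_ac (Fract (mpol1 (pCons a q)) 1) = ?\<iota> a + ?t * to_ac (Fract (mpol1 q) 1)"
      by (simp add: mpol1_pCons to_universal_domain_def flip: to_ac_add to_ac_mult)
    ultimately show ?case using pCons.IH by simp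
  qed
  then have "Fract (mpol1 p) 1 = 0" using P(3) unfolding Pp by (metis to_ac_eq_0_iff)
  then have "mpol1 p = 0" by (simp add: Zero_fract_def eq_fract)
  then have "p = 0" using lookup_mpol1[of p] by (intro poly_eqI) simp
  then show False using P(2) Pp by simp
qed

theorem corollary6p1:
  fixes K0 :: "'k::field set"
    and G :: "('g, 'm) monoid_scheme"
  assumes "subfield K0 (ring_of_type_algebra :: 'k ring)"
    and "PAC_extension (to_universal_domain ` K0) (to_universal_domain ` (UNIV :: 'k set))"
    and "group G" and "finite (carrier G)"
    and "occurs_as_galois_group G (to_universal_domain ` (UNIV :: 'k set))"
    and "regular_group_over G (to_universal_domain ` K0)"
  shows "occurs_as_galois_group G (to_universal_domain ` K0)"
  by (rule PAC_extension_descent[OF assms(2) transcendental_over_base assms(3-6)])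

end
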